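(* Let $r,\mu,\rho\in\mathbb{R}$, $\sigma>0$, $\lambda=\frac{\mu-r}{\sigma}$, $\gamma>1$, and assume $\rho>(1-\gamma)\left(r+\frac{\lambda^2}{2\gamma}\right)$. Then there exists a (finite) constant $a>0$ such that $$V(x)=a\,\frac{x^{1-\gamma}}{1-\gamma}\qquad\text{for all }x>0.$$
   Context: $W$ is a standard one-dimensional Brownian motion on a filtered probability space $(\Omega,\mathcal{F},\mathbb{F}=(\mathcal{F}_t)_{t\ge0},\mathbb{P})$ satisfying the usual conditions. $\mathbb{R}^+$ denotes the set of nonnegative reals. $L^{2,\mathbb{F}}_{\mathrm{loc}}(\Omega\times[0,\infty);\mathbb{R})$ is the space of $\mathbb{F}$-adapted real-valued (measurable in $(\omega,t)$) processes $Z$ with $\mathbb{E}\left[\int_0^R|Z_t|^2\mathrm{d}t\right]<\infty$ for every $R>0$; $L^{1,\mathbb{F}}_{\mathrm{loc}}(\Omega\times[0,\infty);\mathbb{R}^+)$ is the space of $\mathbb{F}$-adapted $\mathbb{R}^+$-valued (measurable) processes $Z$ with $\mathbb{E}\left[\int_0^R|Z_t|\mathrm{d}t\right]<\infty$ for every $R>0$. For $x>0$, $c\in L^{1,\mathbb{F}}_{\mathrm{loc}}(\Omega\times[0,\infty);\mathbb{R}^+)$ and $\pi\in L^{2,\mathbb{F}}_{\mathrm{loc}}(\Omega\times[0,\infty);\mathbb{R})$, the wealth process $X=X^{x;c,\pi}$ is the unique strong solution of $$\mathrm{d}X_t=(rX_t+\sigma\lambda\pi_t)\,\mathrm{d}t+\sigma\pi_t\,\mathrm{d}W_t-c_t\,\mathrm{d}t,\qquad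 X_0=x.$$ The set of admissible strategies is $$\mathcal{A}(x)=\{(c,\pi)\in L^{1,\mathbb{F}}_{\mathrm{loc}}(\Omega\times[0,\infty);\mathbb{R}^+)\times L^{2,\mathbb{F}}_{\mathrm{loc}}(\Omega\times[0,\infty);\mathbb{R}):\ X^{x;c,\pi}\ge0\}.$$ The objective functional is $J(c)=\mathbb{E}\left[\int_0^\infty e^{-\rho s}\frac{c_s^{1-\gamma}}{1-\gamma}\,\mathrm{d}s\right]\in[-\infty,0]$ (with the convention that $\frac{0^{1-\gamma}}{1-\gamma}=-\infty$), and the value function is $V(x)=\sup_{(c,\pi)\in\mathcal{A}(x)}J(c)\in[-\infty,0]$. *)

theory Defs
  imports "HOL-Probability.Probability"
begin

text \<open>Processes are functions \<open>real \<Rightarrow> 'a \<Rightarrow> real\<close> and filtrations are functions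
  \<open>real \<Rightarrow> 'a measure\<close>; only their values at times \<open>t \<ge> 0\<close> ever matter.\<close>

locale usual_filtered_prob_space = prob_space M for M :: "'a measure" +
  fixes F :: "real \<Rightarrow> 'a measure"
  assumes filtration_subalgebra: "\<And>t. 0 \<le> t \<Longrightarrow> subalgebra M (F t)"
    and filtration_mono: "\<And>s t. 0 \<le> s \<Longrightarrow> s \<le> t \<Longrightarrow> sets (F s) \<subseteq> sets (F t)"
    and filtration_complete: "\<And>N A. N \<in> null_sets M \<Longrightarrow> A \<subseteq> N \<Longrightarrow> A \<in> sets (F 0)"
    and filtration_right_continuous: "\<And>t. 0 \<le> t \<Longrightarrow> sets (F t) = (\<Inter>u\<in>{t<..}. sets (F u))"

definition adapted :: "(real \<Rightarrow> 'a measure) \<Rightarrow> (real \<Rightarrow> 'a \<Rightarrow> real) \<Rightarrow> bool" where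
  "adapted F Z \<longleftrightarrow> (\<forall>t\<ge>0. Z t \<in> borel_measurable (F t))"

definition continuous_paths :: "'a measure \<Rightarrow> (real \<Rightarrow> 'a \<Rightarrow> real) \<Rightarrow> bool" where
  "continuous_paths M Z \<longleftrightarrow> (AE \<omega> in M. continuous_on {0..} (\<lambda>t. Z t \<omega>))"

definition standard_brownian_motion ::
  "'a measure \<Rightarrow> (real \<Rightarrow> 'a measure) \<Rightarrow> (real \<Rightarrow> 'a \<Rightarrow> real) \<Rightarrow> bool" where
  "standard_brownian_motion M F W \<longleftrightarrow>
     adapted F W \<and> continuous_paths M W \<and> (AE \<omega> in M. W 0 \<omega> = 0) \<and>
     (\<forall>s t. 0 \<le> s \<longrightarrow> s < t \<longrightarrow>
        distributed M lborel (\<lambda>\<omega>. W t \<omega> - W s \<omega>) (normal_density 0 (sqrt (t - s))) \<and>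
        prob_space.indep_set M (sets (F s))
          (sets (vimage_algebra (space M) (\<lambda>\<omega>. W t \<omega> - W s \<omega>) borel)))"

definition jointly_measurable :: "'a measure \<Rightarrow> (real \<Rightarrow> 'a \<Rightarrow> real) \<Rightarrow> bool" where
  "jointly_measurable M Z \<longleftrightarrow>
     (\<lambda>(\<omega>, t). Z t \<omega>) \<in> borel_measurable (M \<Otimes>\<^sub>M restrict_space borel {0..})"

definition L2_loc :: "'a measure \<Rightarrow> (real \<Rightarrow> 'a measure) \<Rightarrow> (real \<Rightarrow> 'a \<Rightarrow> real) set" where
  "L2_loc M F = {Z. adapted F Z \<and> jointly_measurable M Z \<and>
     (\<forall>R>0. (\<integral>\<^sup>+\<omega>. (\<integral>\<^sup>+t\<in>{0..R}. ennreal (\<bar>Z t \<omega>\<bar>\<^sup>2) \<partial>lborel) \<partial>M) < \<infinity>)}"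

definition L1_loc_nonneg :: "'a measure \<Rightarrow> (real \<Rightarrow> 'a measure) \<Rightarrow> (real \<Rightarrow> 'a \<Rightarrow> real) set" where
  "L1_loc_nonneg M F = {Z. adapted F Z \<and> jointly_measurable M Z \<and>
     (\<forall>t\<ge>0. \<forall>\<omega>\<in>space M. 0 \<le> Z t \<omega>) \<and>
     (\<forall>R>0. (\<integral>\<^sup>+\<omega>. (\<integral>\<^sup>+t\<in>{0..R}. ennreal \<bar>Z t \<omega>\<bar> \<partial>lborel) \<partial>M) < \<infinity>)}"

text \<open>A simple integrand is \<open>\<Sum>i<n. \<xi> i * 1\<^bsub>(\<tau> i, \<tau> (i+1)]\<^esub>\<close> with deterministic times \<open>\<tau>\<close> and
  bounded coefficients \<open>\<xi> i\<close> measurable with respect to \<open>F (\<tau> i)\<close>.\<close>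

definition simple_data ::
  "'a measure \<Rightarrow> (real \<Rightarrow> 'a measure) \<Rightarrow> nat \<Rightarrow> (nat \<Rightarrow> real) \<Rightarrow> (nat \<Rightarrow> 'a \<Rightarrow> real) \<Rightarrow> bool" where
  "simple_data M F n \<tau> \<xi> \<longleftrightarrow>
     0 \<le> \<tau> 0 \<and> (\<forall>i<n. \<tau> i \<le> \<tau> (Suc i)) \<and>
     (\<forall>i<n. \<xi> i \<in> borel_measurable (F (\<tau> i)) \<and> (\<exists>B. \<forall>\<omega>\<in>space M. \<bar>\<xi> i \<omega>\<bar> \<le> B))"

definition simple_process ::
  "nat \<Rightarrow> (nat \<Rightarrow> real) \<Rightarrow> (nat \<Rightarrow> 'a \<Rightarrow> real) \<Rightarrow> real \<Rightarrow> 'a \<Rightarrow> real" where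
  "simple_process n \<tau> \<xi> t \<omega> = (\<Sum>i<n. \<xi> i \<omega> * indicator {\<tau> i<..\<tau> (Suc i)} t)"

definition simple_ito_integral ::
  "(real \<Rightarrow> 'a \<Rightarrow> real) \<Rightarrow> nat \<Rightarrow> (nat \<Rightarrow> real) \<Rightarrow> (nat \<Rightarrow> 'a \<Rightarrow> real) \<Rightarrow> real \<Rightarrow> 'a \<Rightarrow> real" where
  "simple_ito_integral W n \<tau> \<xi> t \<omega> =
     (\<Sum>i<n. \<xi> i \<omega> * (W (min (\<tau> (Suc i)) t) \<omega> - W (min (\<tau> i) t) \<omega>))"

text \<open>\<open>I\<close> is a version of the Ito integral process \<open>t \<mapsto> \<integral>\<^sub>0\<^sup>t H dW\<close> of an \<open>H\<close> in \<open>L2_loc\<close>: the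
  continuous adapted process that is the \<open>L\<^sup>2\<close>-limit of the elementary integrals of simple
  processes approximating \<open>H\<close> in \<open>L\<^sup>2(\<Omega> \<times> [0, T])\<close>. By the Ito isometry it does not depend on the
  approximating sequences and is unique up to indistinguishability.\<close>

definition is_ito_integral ::
  "'a measure \<Rightarrow> (real \<Rightarrow> 'a measure) \<Rightarrow> (real \<Rightarrow> 'a \<Rightarrow> real) \<Rightarrow> (real \<Rightarrow> 'a \<Rightarrow> real) \<Rightarrow>
   (real \<Rightarrow> 'a \<Rightarrow> real) \<Rightarrow> bool" where
  "is_ito_integral M F W H I \<longleftrightarrow>
     adapted F I \<and> continuous_paths M I \<and>
     (\<forall>T>0. \<exists>n \<tau> \<xi>.
        (\<forall>k. simple_data M F (n k) (\<tau> k) (\<xi> k)) \<and>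
        (\<lambda>k::nat. \<integral>\<^sup>+\<omega>. (\<integral>\<^sup>+t\<in>{0..T}.
           ennreal ((simple_process (n k) (\<tau> k) (\<xi> k) t \<omega> - H t \<omega>)\<^sup>2) \<partial>lborel) \<partial>M)
          \<longlonglongrightarrow> 0 \<and>
        (\<forall>t\<in>{0..T}.
           (\<lambda>k. \<integral>\<^sup>+\<omega>. ennreal ((simple_ito_integral W (n k) (\<tau> k) (\<xi> k) t \<omega> - I t \<omega>)\<^sup>2) \<partial>M)
             \<longlonglongrightarrow> 0))"

text \<open>\<open>X\<close> is a strong solution of
  \<open>dX = (r X + \<sigma> lam \<pi>) dt + \<sigma> \<pi> dW - c dt\<close>, \<open>X\<^sub>0 = x\<close>; for \<open>c \<in> L1_loc_nonneg M F\<close> and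
  \<open>\<pi> \<in> L2_loc M F\<close> it is determined up to indistinguishability.\<close>

definition wealth_process ::
  "'a measure \<Rightarrow> (real \<Rightarrow> 'a measure) \<Rightarrow> (real \<Rightarrow> 'a \<Rightarrow> real) \<Rightarrow> real \<Rightarrow> real \<Rightarrow> real \<Rightarrow> real \<Rightarrow>
   (real \<Rightarrow> 'a \<Rightarrow> real) \<Rightarrow> (real \<Rightarrow> 'a \<Rightarrow> real) \<Rightarrow> (real \<Rightarrow> 'a \<Rightarrow> real) \<Rightarrow> bool" where
  "wealth_process M F W r \<sigma> lam x c \<pi> X \<longleftrightarrow>
     adapted F X \<and> continuous_paths M X \<and>
     (\<exists>I. is_ito_integral M F W (\<lambda>t \<omega>. \<sigma> * \<pi> t \<omega>) I \<and>
        (AE \<omega> in M. \<forall>t\<ge>0.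
           X t \<omega> = x + (LINT s:{0..t}|lborel. r * X s \<omega> + \<sigma> * lam * \<pi> s \<omega>) + I t \<omega>
                     - (LINT s:{0..t}|lborel. c s \<omega>)))"

definition admissible ::
  "'a measure \<Rightarrow> (real \<Rightarrow> 'a measure) \<Rightarrow> (real \<Rightarrow> 'a \<Rightarrow> real) \<Rightarrow> real \<Rightarrow> real \<Rightarrow> real \<Rightarrow> real \<Rightarrow>
   ((real \<Rightarrow> 'a \<Rightarrow> real) \<times> (real \<Rightarrow> 'a \<Rightarrow> real)) set" where
  "admissible M F W r \<sigma> lam x =
     {(c, \<pi>). c \<in> L1_loc_nonneg M F \<and> \<pi> \<in> L2_loc M F \<and>
        (\<exists>X. wealth_process M F W r \<sigma> lam x c \<pi> X \<and> (AE \<omega> in M. \<forall>t\<ge>0. 0 \<le> X t \<omega>))}"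

definition crra_utility :: "real \<Rightarrow> real \<Rightarrow> ereal" where
  "crra_utility \<gamma> y = (if y = 0 then - \<infinity> else ereal (y powr (1 - \<gamma>) / (1 - \<gamma>)))"

text \<open>For \<open>\<gamma> > 1\<close> the integrand is \<open>[-\<infinity>, 0]\<close>-valued, so its integral is minus the nonnegative
  integral of its negation.\<close>

definition objective :: "'a measure \<Rightarrow> real \<Rightarrow> real \<Rightarrow> (real \<Rightarrow> 'a \<Rightarrow> real) \<Rightarrow> ereal" where
  "objective M \<rho> \<gamma> c =
     - enn2ereal (\<integral>\<^sup>+\<omega>. (\<integral>\<^sup>+s\<in>{0..}.
         e2ennreal (- (ereal (exp (- \<rho> * s)) * crra_utility \<gamma> (c s \<omega>))) \<partial>lborel) \<partial>M)"

definition value_function ::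
  "'a measure \<Rightarrow> (real \<Rightarrow> 'a measure) \<Rightarrow> (real \<Rightarrow> 'a \<Rightarrow> real) \<Rightarrow> real \<Rightarrow> real \<Rightarrow> real \<Rightarrow> real \<Rightarrow> real \<Rightarrow>
   real \<Rightarrow> ereal" where
  "value_function M F W r \<sigma> lam \<rho> \<gamma> x =
     (SUP (c, \<pi>)\<in>admissible M F W r \<sigma> lam x. objective M \<rho> \<gamma> c)"

end

theory Submission
  imports Defs
begin

text \<open>
  Scaling strategies by \<open>k > 0\<close> gives \<open>V (k x) = k\<^sup>1\<^sup>-\<^sup>\<gamma> V x\<close>, so it suffices to see that
  \<open>-\<infinity> < V 1 < 0\<close>.

  Upper bound: the state price density \<open>L = exp (- \<lambda> W\<^sub>T - \<lambda>\<^sup>2 T / 2)\<close> satisfies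
  \<open>E[L (\<integral>\<^sub>0\<^sup>s H dW + \<lambda> \<integral>\<^sub>0\<^sup>s H dt)] = 0\<close> for \<open>s \<le> T\<close>; this is checked for simple integrands and passes
  to \<open>L\<^sup>2\<close>-limits. Together with \<open>X \<ge> 0\<close> and a pathwise Gronwall argument it bounds
  \<open>E[L \<integral>\<^sub>0\<^sup>1 c dt]\<close> uniformly over all strategies, and Young's inequality applied to \<open>L c\<close> and
  \<open>e\<^sup>-\<^sup>\<rho>\<^sup>t c\<^sup>1\<^sup>-\<^sup>\<gamma>\<close>, in which \<open>c\<close> cancels, bounds the objective away from 0.

  Lower bound: the feedback strategy \<open>c = \<kappa> X\<close>, \<open>\<sigma> \<pi> = (\<lambda> / \<gamma>) X\<close> with small \<open>\<kappa> > 0\<close> makes \<open>X\<close> a geometric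
  Brownian motion, and its objective is finite exactly by the hypothesis on \<open>\<rho>\<close>. That \<open>X\<close> solves the
  wealth equation needs the Ito integral of a geometric Brownian motion, which is computed directly
  from the definition by Riemann sums with truncated coefficients.
\<close>

subsection \<open>Brownian increments\<close>

text \<open>The Ito integral is given as an \<open>L\<^sup>2\<close>-limit of elementary sums, and
  the proof works from that alone, without Ito formula, product rule or change of measure. This
  shapes both bounds. In the upper bound everything is tested against one random variable
  \<open>L\<close> fixed at the terminal time: pairing with a square integrable \<open>L\<close> is
  linear and continuous in \<open>L\<^sup>2\<close>, so orthogonality survives the limit, whereas
  the usual supermartingale argument for density times wealth would need a product rule. Interest is
  not discounted away but absorbed pathwise. The crude constants that result cost nothing, since
  scaling asks only for some strictly negative bound on \<open>V 1\<close>; likewise neither the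
  optimal strategy nor the exact value has to be identified, and any strategy with finite objective
  will do. The horizon 1 is arbitrary: disutility after it is nonnegative and is simply discarded.
  Geometric Brownian motion is treated path by path, so the work takes place for a version of
  \<open>W\<close> that is continuous and starts at 0 on the whole space; the end of the proof
  transfers the result to a general \<open>W\<close>.\<close>

context prob_space
begin

lemma integrable_mult_of_squares:
  fixes f g :: "'a \<Rightarrow> real"
  assumes [measurable]: "f \<in> borel_measurable M" "g \<in> borel_measurable M"
    and "integrable M (\<lambda>\<omega>. (f \<omega>)\<^sup>2)" "integrable M (\<lambda>\<omega>. (g \<omega>)\<^sup>2)"
  shows "integrable M (\<lambda>\<omega>. f \<omega> * g \<omega>)"
proof (rule Bochner_Integration.integrable_bound)
  show "integrable M (\<lambda>\<omega>. (f \<omega>)\<^sup>2 + (g \<omega>)\<^sup>2)" using assms by simp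
  have "\<bar>a * b\<bar> \<le> a\<^sup>2 + b\<^sup>2" for a b :: real
    using sum_squares_bound[of "\<bar>a\<bar>" "\<bar>b\<bar>"] mult_nonneg_nonneg[of "\<bar>a\<bar>" "\<bar>b\<bar>"]
    unfolding abs_mult power2_abs by linarith
  then show "AE x in M. norm (f x * g x) \<le> norm ((f x)\<^sup>2 + (g x)\<^sup>2)" by auto
qed measurable

lemma integrable_square_add:
  fixes f g :: "'a \<Rightarrow> real"
  assumes [measurable]: "f \<in> borel_measurable M" "g \<in> borel_measurable M"
    and "integrable M (\<lambda>\<omega>. (f \<omega>)\<^sup>2)" "integrable M (\<lambda>\<omega>. (g \<omega>)\<^sup>2)"
  shows "integrable M (\<lambda>\<omega>. (f \<omega> + g \<omega>)\<^sup>2)"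
  using integrable_mult_of_squares[of f g] assms unfolding power2_sum by (simp add: mult.assoc)

end

text \<open>Completing the square. Weighting a centred normal density by an exponential shifts its
  mean by \<open>b * h\<close>; this is the one-dimensional core of the change of measure, and every
  exponential moment of an increment below comes from it.\<close>

lemma normal_density_tilt:
  assumes "h > 0"
  shows "normal_density 0 (sqrt h) x * exp (b * x) = exp (b\<^sup>2 * h / 2) * normal_density (b * h) (sqrt h) x"
proof -
  have "- x\<^sup>2 / (2 * h) + b * x = b\<^sup>2 * h / 2 + (- (x - b * h)\<^sup>2 / (2 * h))"
    using assms by (simp add: field_simps power2_eq_square)
  then have "exp (- x\<^sup>2 / (2 * h)) * exp (b * x) = exp (b\<^sup>2 * h / 2) * exp (- (x - b * h)\<^sup>2 / (2 * h))"
    by (simp only: exp_add[symmetric])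
  then show ?thesis using assms by (simp add: normal_density_def)
qed

text \<open>Continuity and the initial value hold at every point rather than almost everywhere, so
  that joint measurability can be read off from the paths without exceptional sets.
  \<open>brownian_continuous_version\<close> reduces the general case to this one.\<close>

locale brownian = usual_filtered_prob_space M F
  for M :: "'a measure" and F :: "real \<Rightarrow> 'a measure" +
  fixes W :: "real \<Rightarrow> 'a \<Rightarrow> real"
  assumes bm: "standard_brownian_motion M F W"
    and W_continuous: "\<And>\<omega>. \<omega> \<in> space M \<Longrightarrow> continuous_on {0..} (\<lambda>t. W t \<omega>)"
    and W_zero: "\<And>\<omega>. \<omega> \<in> space M \<Longrightarrow> W 0 \<omega> = 0"
begin

section \<open>Measurability along the filtration and independence of increments\<close>

lemma space_F: "0 \<le> t \<Longrightarrow> space (F t) = space M"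
  using filtration_subalgebra by (auto simp: subalgebra_def)

lemma measurable_F_M: "0 \<le> t \<Longrightarrow> f \<in> borel_measurable (F t) \<Longrightarrow> f \<in> borel_measurable M"
  using filtration_subalgebra by (rule measurable_from_subalg)

lemma measurable_F_mono:
  assumes "0 \<le> s" "s \<le> t" "f \<in> borel_measurable (F s)"
  shows "f \<in> borel_measurable (F t)"
proof -
  have "subalgebra (F t) (F s)"
    using assms space_F filtration_mono by (auto simp: subalgebra_def)
  then show ?thesis using assms(3) by (rule measurable_from_subalg)
qed

lemma W_adapted: "0 \<le> t \<Longrightarrow> W t \<in> borel_measurable (F t)"
  using bm by (auto simp: standard_brownian_motion_def adapted_def)

lemma W_adapted': "0 \<le> s \<Longrightarrow> s \<le> t \<Longrightarrow> W s \<in> borel_measurable (F t)"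
  using measurable_F_mono W_adapted by blast

lemma W_measurable: "0 \<le> t \<Longrightarrow> W t \<in> borel_measurable M"
  using measurable_F_M W_adapted by blast

lemma increment_distributed:
  "0 \<le> s \<Longrightarrow> s < t \<Longrightarrow>
    distributed M lborel (\<lambda>\<omega>. W t \<omega> - W s \<omega>) (normal_density 0 (sqrt (t - s)))"
  using bm by (auto simp: standard_brownian_motion_def)

text \<open>The sigma-algebra generated by \<open>\<xi>\<close> lies in \<open>F s\<close>, so the
  independence of \<open>F s\<close> from the increment is inherited.\<close>

lemma indep_increment:
  assumes "0 \<le> s" "s < t" and \<xi>: "\<xi> \<in> borel_measurable (F s)"
  shows "indep_var borel \<xi> borel (\<lambda>\<omega>. W t \<omega> - W s \<omega>)"
proof -
  let ?D = "\<lambda>\<omega>. W t \<omega> - W s \<omega>"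
  have \<xi>M: "\<xi> \<in> borel_measurable M" and D: "?D \<in> borel_measurable M"
    using assms measurable_F_M W_measurable by auto
  have "indep_set (sets (F s)) (sets (vimage_algebra (space M) ?D borel))"
    using bm assms by (auto simp: standard_brownian_motion_def)
  moreover have "sigma_sets (space M) {\<xi> -` A \<inter> space M |A. A \<in> sets borel} \<subseteq> sets (F s)"
    using measurable_sets[OF \<xi>] space_F[OF assms(1)]
    by (subst space_F[OF assms(1), symmetric], intro sets.sigma_sets_subset) auto
  moreover have "sets (vimage_algebra (space M) ?D borel) =
      sigma_sets (space M) {?D -` A \<inter> space M |A. A \<in> sets borel}"
    by (subst sets_vimage_algebra) auto
  ultimately have "indep_set (sigma_sets (space M) {\<xi> -` A \<inter> space M |A. A \<in> sets borel})
     (sigma_sets (space M) {?D -` A \<inter> space M |A. A \<in> sets borel})"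
    unfolding indep_set_def
    by (elim indep_sets_mono_sets) (auto split: bool.splits)
  then show ?thesis
    unfolding indep_var_eq using \<xi>M D by auto
qed

text \<open>Besides independence this covers \<open>s = t\<close>, where the increment is 0 and
  \<open>g\<close> contributes a constant. Partitions clipped at a time produce such empty steps,
  and no caller has to single them out.\<close>

lemma expectation_mult_increment:
  fixes g :: "real \<Rightarrow> real"
  assumes "0 \<le> s" "s \<le> t" and \<xi>: "\<xi> \<in> borel_measurable (F s)" and g[measurable]: "g \<in> borel_measurable borel"
    and i\<xi>: "integrable M \<xi>" and ig: "integrable M (\<lambda>\<omega>. g (W t \<omega> - W s \<omega>))"
  shows "integrable M (\<lambda>\<omega>. \<xi> \<omega> * g (W t \<omega> - W s \<omega>))"
    and "expectation (\<lambda>\<omega>. \<xi> \<omega> * g (W t \<omega> - W s \<omega>)) = expectation \<xi> * expectation (\<lambda>\<omega>. g (W t \<omega> - W s \<omega>))"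
proof -
  have "integrable M (\<lambda>\<omega>. \<xi> \<omega> * g (W t \<omega> - W s \<omega>)) \<and>
    expectation (\<lambda>\<omega>. \<xi> \<omega> * g (W t \<omega> - W s \<omega>)) = expectation \<xi> * expectation (\<lambda>\<omega>. g (W t \<omega> - W s \<omega>))"
  proof (cases "s < t")
    case True
    have "indep_var borel (id \<circ> \<xi>) borel (g \<circ> (\<lambda>\<omega>. W t \<omega> - W s \<omega>))"
      using indep_var_compose[OF indep_increment[OF assms(1) True \<xi>], of id borel g borel] by auto
    then have "indep_var borel \<xi> borel (\<lambda>\<omega>. g (W t \<omega> - W s \<omega>))"
      by (simp add: comp_def)
    from indep_var_integrable[OF this i\<xi> ig] indep_var_lebesgue_integral[OF this i\<xi> ig]
    show ?thesis by simp
  next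
    case False
    then have "s = t" using assms by simp
    then show ?thesis using i\<xi> by (simp add: prob_space)
  qed
  then show "integrable M (\<lambda>\<omega>. \<xi> \<omega> * g (W t \<omega> - W s \<omega>))"
    and "expectation (\<lambda>\<omega>. \<xi> \<omega> * g (W t \<omega> - W s \<omega>)) = expectation \<xi> * expectation (\<lambda>\<omega>. g (W t \<omega> - W s \<omega>))"
    by auto
qed

section \<open>Moments of Brownian increments\<close>

lemma has_bochner_increment:
  assumes "0 \<le> s" "s < t" and [measurable]: "g \<in> borel_measurable borel"
    and "has_bochner_integral lborel (\<lambda>x. normal_density 0 (sqrt (t - s)) x * g x) v"
  shows "has_bochner_integral M (\<lambda>\<omega>. g (W t \<omega> - W s \<omega>)) (v::real)"
  using assms distributed_integrable[OF increment_distributed[OF assms(1,2)], of g]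
    distributed_integral[OF increment_distributed[OF assms(1,2)], of g]
  by (auto simp: has_bochner_integral_iff)

lemma exp_increment:
  assumes "0 \<le> s" "s \<le> t"
  shows "has_bochner_integral M (\<lambda>\<omega>. exp (b * (W t \<omega> - W s \<omega>))) (exp (b\<^sup>2 * (t - s) / 2))"
proof (cases "s = t")
  case True
  then show ?thesis by (simp add: has_bochner_integral_iff prob_space)
next
  case False
  with assms have st: "s < t" by simp
  have "has_bochner_integral lborel (\<lambda>x. exp (b\<^sup>2 * (t - s) / 2) * normal_density (b * (t - s)) (sqrt (t - s)) x)
     (exp (b\<^sup>2 * (t - s) / 2) * 1)"
    using st by (intro has_bochner_integral_mult_right) (auto simp: has_bochner_integral_iff)
  then show ?thesis
    using st by (intro has_bochner_increment assms) (auto simp: normal_density_tilt)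
qed

text \<open>After tilting, this is the first moment of a normal density with mean
  \<open>b * (t - s)\<close>. The case \<open>b = 0\<close> gives the mean of the increment
  itself.\<close>

lemma mult_exp_increment:
  assumes "0 \<le> s" "s \<le> t"
  shows "has_bochner_integral M (\<lambda>\<omega>. (W t \<omega> - W s \<omega>) * exp (b * (W t \<omega> - W s \<omega>)))
     (b * (t - s) * exp (b\<^sup>2 * (t - s) / 2))"
proof (cases "s = t")
  case True
  then show ?thesis by (simp add: has_bochner_integral_iff prob_space)
next
  case False
  with assms have st: "s < t" by simp
  have *: "has_bochner_integral lborel (\<lambda>x. exp (b\<^sup>2 * (t - s) / 2) * (normal_density (b * (t - s)) (sqrt (t - s)) x * x))
     (exp (b\<^sup>2 * (t - s) / 2) * (b * (t - s)))"
    using st by (intro has_bochner_integral_mult_right normal_moment_nz_1) auto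
  have eq: "normal_density 0 (sqrt (t - s)) x * (x * exp (b * x)) =
     exp (b\<^sup>2 * (t - s) / 2) * (normal_density (b * (t - s)) (sqrt (t - s)) x * x)" for x
    using normal_density_tilt[of "t - s" x b] st by (simp add: algebra_simps)
  have v: "b * (t - s) * exp (b\<^sup>2 * (t - s) / 2) = exp (b\<^sup>2 * (t - s) / 2) * (b * (t - s))"
    by simp
  show ?thesis
    unfolding v by (intro has_bochner_increment[where g="\<lambda>x. x * exp (b * x)"] assms st) (auto simp only: eq *, measurable)
qed

lemma increment_mean:
  assumes "0 \<le> s" "s \<le> t"
  shows "has_bochner_integral M (\<lambda>\<omega>. W t \<omega> - W s \<omega>) 0"
  using mult_exp_increment[OF assms, of 0] by simp

lemma increment_square:
  assumes "0 \<le> s" "s \<le> t"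
  shows "has_bochner_integral M (\<lambda>\<omega>. (W t \<omega> - W s \<omega>)\<^sup>2) (t - s)"
proof (cases "s = t")
  case True
  then show ?thesis by (simp add: has_bochner_integral_iff)
next
  case False
  with assms have st: "s < t" by simp
  have "has_bochner_integral lborel (\<lambda>x. normal_density 0 (sqrt (t - s)) x * x\<^sup>2) (t - s)"
    using normal_moment_even[of "sqrt (t - s)" 0 1] st by (simp add: diff_divide_distrib)
  then show ?thesis
    using st by (intro has_bochner_increment[where g="\<lambda>x. x\<^sup>2"] assms) auto
qed

text \<open>A discrete Ito isometry: each summand is a coefficient known at the left endpoint times
  a centred function of the next increment, so distinct summands are orthogonal. The functions
  \<open>g i\<close> are general because the lemma serves twice, with the identity for elementary
  integrals and with compensated exponentials for the martingale error of geometric Brownian motion.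
  Measurability at \<open>s n\<close> is carried along by the induction.\<close>

lemma increment_sum_square:
  fixes s :: "nat \<Rightarrow> real" and G :: "nat \<Rightarrow> 'a \<Rightarrow> real" and g :: "nat \<Rightarrow> real \<Rightarrow> real"
  assumes s0: "0 \<le> s 0" and mono: "\<And>i. i < n \<Longrightarrow> s i \<le> s (Suc i)"
    and G: "\<And>i. i < n \<Longrightarrow> G i \<in> borel_measurable (F (s i))"
    and G2: "\<And>i. i < n \<Longrightarrow> integrable M (\<lambda>\<omega>. (G i \<omega>)\<^sup>2)"
    and g: "\<And>i. g i \<in> borel_measurable borel"
    and g1: "\<And>i. i < n \<Longrightarrow> has_bochner_integral M (\<lambda>\<omega>. g i (W (s (Suc i)) \<omega> - W (s i) \<omega>)) 0"
    and g2: "\<And>i. i < n \<Longrightarrow> has_bochner_integral M (\<lambda>\<omega>. (g i (W (s (Suc i)) \<omega> - W (s i) \<omega>))\<^sup>2) (v i)"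
  shows "has_bochner_integral M (\<lambda>\<omega>. (\<Sum>i<n. G i \<omega> * g i (W (s (Suc i)) \<omega> - W (s i) \<omega>))\<^sup>2)
     (\<Sum>i<n. expectation (\<lambda>\<omega>. (G i \<omega>)\<^sup>2) * v i)" (is ?P)
    and "0 \<le> s n"
    and "(\<lambda>\<omega>. \<Sum>i<n. G i \<omega> * g i (W (s (Suc i)) \<omega> - W (s i) \<omega>)) \<in> borel_measurable (F (s n))" (is ?Q)
proof -
  have "?P \<and> 0 \<le> s n \<and> ?Q"
    using assms(2,3,4,6,7)
  proof (induction n)
    case 0
    then show ?case using s0 by (simp add: has_bochner_integral_iff)
  next
    case (Suc n)
    let ?D = "\<lambda>i \<omega>. W (s (Suc i)) \<omega> - W (s i) \<omega>"
    let ?S = "\<lambda>\<omega>. \<Sum>i<n. G i \<omega> * g i (?D i \<omega>)"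
    note [measurable] = g
    have IH: "has_bochner_integral M (\<lambda>\<omega>. (?S \<omega>)\<^sup>2) (\<Sum>i<n. expectation (\<lambda>\<omega>. (G i \<omega>)\<^sup>2) * v i)"
      and sn: "0 \<le> s n" and SF: "?S \<in> borel_measurable (F (s n))"
      using Suc by auto
    have le: "s n \<le> s (Suc n)" using Suc.prems by simp
    have GF: "G n \<in> borel_measurable (F (s n))" using Suc.prems by simp
    note SM = measurable_F_M[OF sn SF] and GM = measurable_F_M[OF sn GF]
    have S2: "integrable M (\<lambda>\<omega>. (?S \<omega>)\<^sup>2)" using IH by (simp add: has_bochner_integral_iff)
    have Gn2: "integrable M (\<lambda>\<omega>. (G n \<omega>)\<^sup>2)" using Suc.prems by simp
    have gn1: "integrable M (\<lambda>\<omega>. g n (?D n \<omega>))" "expectation (\<lambda>\<omega>. g n (?D n \<omega>)) = 0"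
      using Suc.prems(4)[of n] by (auto simp: has_bochner_integral_iff)
    have gn2: "integrable M (\<lambda>\<omega>. (g n (?D n \<omega>))\<^sup>2)" "expectation (\<lambda>\<omega>. (g n (?D n \<omega>))\<^sup>2) = v n"
      using Suc.prems(5)[of n] by (auto simp: has_bochner_integral_iff)
    have SG: "integrable M (\<lambda>\<omega>. ?S \<omega> * G n \<omega>)"
      using SM GM S2 Gn2 by (rule integrable_mult_of_squares)
    have SGF: "(\<lambda>\<omega>. ?S \<omega> * G n \<omega>) \<in> borel_measurable (F (s n))"
      using SF GF by (rule borel_measurable_times)
    have G2F: "(\<lambda>\<omega>. (G n \<omega>)\<^sup>2) \<in> borel_measurable (F (s n))"
      using GF by measurable
    note c = expectation_mult_increment[OF sn le SGF g SG gn1(1)]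
    note d = expectation_mult_increment[OF sn le G2F _ Gn2 gn2(1)]
    \<comment> \<open>The cross term: all of \<open>?S * G n\<close> is known at time
      \<open>s n\<close>, and the remaining factor is independent of it with mean 0.\<close>
    have c': "has_bochner_integral M (\<lambda>\<omega>. 2 * (?S \<omega> * G n \<omega> * g n (?D n \<omega>))) (2 * 0)"
      using c gn1 by (intro has_bochner_integral_mult_right) (auto simp: has_bochner_integral_iff)
    have d': "has_bochner_integral M (\<lambda>\<omega>. (G n \<omega>)\<^sup>2 * (g n (?D n \<omega>))\<^sup>2) (expectation (\<lambda>\<omega>. (G n \<omega>)\<^sup>2) * v n)"
      using d gn2 by (auto simp: has_bochner_integral_iff)
    have "has_bochner_integral M (\<lambda>\<omega>. (?S \<omega>)\<^sup>2 + 2 * (?S \<omega> * G n \<omega> * g n (?D n \<omega>)) + (G n \<omega>)\<^sup>2 * (g n (?D n \<omega>))\<^sup>2)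
       ((\<Sum>i<n. expectation (\<lambda>\<omega>. (G i \<omega>)\<^sup>2) * v i) + 2 * 0 + expectation (\<lambda>\<omega>. (G n \<omega>)\<^sup>2) * v n)"
      by (intro has_bochner_integral_add IH c' d')
    also have "(\<lambda>\<omega>. (?S \<omega>)\<^sup>2 + 2 * (?S \<omega> * G n \<omega> * g n (?D n \<omega>)) + (G n \<omega>)\<^sup>2 * (g n (?D n \<omega>))\<^sup>2) =
       (\<lambda>\<omega>. (\<Sum>i<Suc n. G i \<omega> * g i (?D i \<omega>))\<^sup>2)"
      by (auto simp: power2_sum power_mult_distrib algebra_simps)
    finally have 1: "has_bochner_integral M (\<lambda>\<omega>. (\<Sum>i<Suc n. G i \<omega> * g i (?D i \<omega>))\<^sup>2)
      (\<Sum>i<Suc n. expectation (\<lambda>\<omega>. (G i \<omega>)\<^sup>2) * v i)" by simp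
    have m1: "?S \<in> borel_measurable (F (s (Suc n)))" and m2: "G n \<in> borel_measurable (F (s (Suc n)))"
      using measurable_F_mono[OF sn le] SF GF by auto
    have m3: "W (s (Suc n)) \<in> borel_measurable (F (s (Suc n)))" "W (s n) \<in> borel_measurable (F (s (Suc n)))"
      using W_adapted' sn le by auto
    have "(\<lambda>\<omega>. ?S \<omega> + G n \<omega> * g n (?D n \<omega>)) \<in> borel_measurable (F (s (Suc n)))"
      using m1 m2 m3 by measurable
    then show ?case using 1 sn le by simp
  qed
  then show ?P "0 \<le> s n" ?Q by auto
qed

end

subsection \<open>Simple integrands and the state price density\<close>

lemma chain_le:
  fixes \<tau> :: "nat \<Rightarrow> real"
  assumes "\<forall>i<n. \<tau> i \<le> \<tau> (Suc i)" "i \<le> j" "j \<le> n"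
  shows "\<tau> i \<le> \<tau> j"
  using assms(2,3)
proof (induction j rule: dec_induct)
  case (step m)
  then have "\<tau> m \<le> \<tau> (Suc m)" using assms(1) by simp
  with step show ?case by simp
qed simp

lemma simple_process_beyond:
  assumes "\<forall>i<n. \<tau> i \<le> \<tau> (Suc i)" "\<tau> n < t"
  shows "simple_process n \<tau> \<xi> t \<omega> = 0"
  unfolding simple_process_def
proof (rule sum.neutral, intro ballI)
  fix i assume "i \<in> {..<n}"
  then have "\<tau> (Suc i) \<le> \<tau> n" using chain_le[OF assms(1), of "Suc i" n] by simp
  then show "\<xi> i \<omega> * indicator {\<tau> i<..\<tau> (Suc i)} t = 0" using assms(2) by simp
qed

text \<open>The intervals are disjoint: when the last one is added, the process built so far already
  vanishes on it, so no mixed products arise.\<close>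

lemma simple_process_square:
  assumes "\<forall>i<n. \<tau> i \<le> \<tau> (Suc i)"
  shows "(simple_process n \<tau> \<xi> t \<omega>)\<^sup>2 = (\<Sum>i<n. (\<xi> i \<omega>)\<^sup>2 * indicator {\<tau> i<..\<tau> (Suc i)} t)"
  using assms
proof (induction n)
  case 0 show ?case by (simp add: simple_process_def)
next
  case (Suc n)
  have eq: "simple_process (Suc n) \<tau> \<xi> t \<omega> = simple_process n \<tau> \<xi> t \<omega> + \<xi> n \<omega> * indicator {\<tau> n<..\<tau> (Suc n)} t"
    by (simp add: simple_process_def)
  have "simple_process n \<tau> \<xi> t \<omega> * (\<xi> n \<omega> * indicator {\<tau> n<..\<tau> (Suc n)} t) = 0"
    using simple_process_beyond[of n \<tau> t \<xi> \<omega>] Suc.prems by (auto simp: indicator_def)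
  then have "(simple_process (Suc n) \<tau> \<xi> t \<omega>)\<^sup>2 =
      (simple_process n \<tau> \<xi> t \<omega>)\<^sup>2 + (\<xi> n \<omega> * indicator {\<tau> n<..\<tau> (Suc n)} t)\<^sup>2"
    unfolding eq power2_sum by simp
  also have "(\<xi> n \<omega> * indicator {\<tau> n<..\<tau> (Suc n)} t)\<^sup>2 = (\<xi> n \<omega>)\<^sup>2 * indicator {\<tau> n<..\<tau> (Suc n)} t"
    by (simp add: indicator_def)
  finally show ?case using Suc by simp
qed

lemma emeasure_interval_clip:
  fixes a b s :: real
  assumes "0 \<le> a" "a \<le> b" "0 \<le> s"
  shows "emeasure lborel ({a<..b} \<inter> {0..s}) = ennreal (min b s - min a s)"
proof (cases "a \<le> s")
  case True
  then have "{a<..b} \<inter> {0..s} = {a<..min b s}" using assms by auto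
  then show ?thesis using True assms by (simp add: min_def)
next
  case False
  then have "{a<..b} \<inter> {0..s} = {}" by auto
  then show ?thesis using False assms by (simp add: min_def)
qed

lemma set_integral_simple_process:
  assumes "0 \<le> \<tau> 0" "\<forall>i<n. \<tau> i \<le> \<tau> (Suc i)" "0 \<le> s"
  shows "set_integrable lborel {0..s} (\<lambda>t. simple_process n \<tau> \<xi> t \<omega>)"
    and "(LINT t:{0..s}|lborel. simple_process n \<tau> \<xi> t \<omega>) =
      (\<Sum>i<n. \<xi> i \<omega> * (min (\<tau> (Suc i)) s - min (\<tau> i) s))"
proof -
  have 1: "has_bochner_integral lborel (\<lambda>t. \<xi> i \<omega> * indicator ({\<tau> i<..\<tau> (Suc i)} \<inter> {0..s}) t)
     (\<xi> i \<omega> * (min (\<tau> (Suc i)) s - min (\<tau> i) s))" if "i < n" for i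
  proof (rule has_bochner_integral_mult_right)
    have i: "0 \<le> \<tau> i" "\<tau> i \<le> \<tau> (Suc i)"
      using that assms chain_le[OF assms(2), of 0 i] by auto
    note m = emeasure_interval_clip[OF i assms(3)]
    have "has_bochner_integral lborel (indicator ({\<tau> i<..\<tau> (Suc i)} \<inter> {0..s}) :: real \<Rightarrow> real)
       (measure lborel ({\<tau> i<..\<tau> (Suc i)} \<inter> {0..s}))"
      using m by (intro has_bochner_integral_real_indicator) auto
    then show "has_bochner_integral lborel (indicator ({\<tau> i<..\<tau> (Suc i)} \<inter> {0..s}) :: real \<Rightarrow> real)
       (min (\<tau> (Suc i)) s - min (\<tau> i) s)"
      using m i by (simp add: measure_def min_def)
  qed
  have "has_bochner_integral lborel (\<lambda>t. \<Sum>i<n. \<xi> i \<omega> * indicator ({\<tau> i<..\<tau> (Suc i)} \<inter> {0..s}) t)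
     (\<Sum>i<n. \<xi> i \<omega> * (min (\<tau> (Suc i)) s - min (\<tau> i) s))"
    using 1 by (intro has_bochner_integral_sum) auto
  moreover have "(\<lambda>t. \<Sum>i<n. \<xi> i \<omega> * indicator ({\<tau> i<..\<tau> (Suc i)} \<inter> {0..s}) t) =
     (\<lambda>t. indicator {0..s} t *\<^sub>R simple_process n \<tau> \<xi> t \<omega>)"
    unfolding simple_process_def scaleR_sum_right
    by (intro ext sum.cong refl) (auto simp: indicator_def)
  ultimately show "set_integrable lborel {0..s} (\<lambda>t. simple_process n \<tau> \<xi> t \<omega>)"
    and "(LINT t:{0..s}|lborel. simple_process n \<tau> \<xi> t \<omega>) =
      (\<Sum>i<n. \<xi> i \<omega> * (min (\<tau> (Suc i)) s - min (\<tau> i) s))"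
    by (auto simp: set_integrable_def set_lebesgue_integral_def has_bochner_integral_iff)
qed

lemma nn_integral_simple_process_square:
  assumes "0 \<le> \<tau> 0" "\<forall>i<n. \<tau> i \<le> \<tau> (Suc i)" "0 \<le> s"
  shows "(\<integral>\<^sup>+t\<in>{0..s}. ennreal ((simple_process n \<tau> \<xi> t \<omega>)\<^sup>2) \<partial>lborel) =
      ennreal (\<Sum>i<n. (\<xi> i \<omega>)\<^sup>2 * (min (\<tau> (Suc i)) s - min (\<tau> i) s))"
proof -
  \<comment> \<open>The square is again a simple process, with squared coefficients, so the formula
    for its time integral applies.\<close>
  have sq: "\<And>t. (simple_process n \<tau> \<xi> t \<omega>)\<^sup>2 = simple_process n \<tau> (\<lambda>i \<omega>. (\<xi> i \<omega>)\<^sup>2) t \<omega>"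
    using simple_process_square[OF assms(2)] by (simp add: simple_process_def)
  have "(\<integral>\<^sup>+t\<in>{0..s}. ennreal ((simple_process n \<tau> \<xi> t \<omega>)\<^sup>2) \<partial>lborel) =
     (\<integral>\<^sup>+t. ennreal (indicator {0..s} t *\<^sub>R (simple_process n \<tau> (\<lambda>i \<omega>. (\<xi> i \<omega>)\<^sup>2) t \<omega>)) \<partial>lborel)"
    unfolding sq by (intro nn_integral_cong) (auto simp: indicator_def)
  also have "\<dots> = ennreal (LINT t:{0..s}|lborel. simple_process n \<tau> (\<lambda>i \<omega>. (\<xi> i \<omega>)\<^sup>2) t \<omega>)"
    using set_integral_simple_process(1)[OF assms, of "\<lambda>i \<omega>. (\<xi> i \<omega>)\<^sup>2" \<omega>] zero_le_power2
    unfolding set_lebesgue_integral_def set_integrable_def sq[symmetric]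
    by (intro nn_integral_eq_integral) auto
  finally show ?thesis
    by (simp add: set_integral_simple_process(2)[OF assms])
qed

context brownian
begin

section \<open>The Ito isometry for elementary integrals\<close>

lemma simple_dataD:
  assumes "simple_data M F n \<tau> \<xi>"
  shows "0 \<le> \<tau> 0" "\<forall>i<n. \<tau> i \<le> \<tau> (Suc i)" "i \<le> n \<Longrightarrow> 0 \<le> \<tau> i"
    "i < n \<Longrightarrow> \<xi> i \<in> borel_measurable (F (\<tau> i))"
    "i < n \<Longrightarrow> \<xi> i \<in> borel_measurable M"
    "i < n \<Longrightarrow> integrable M (\<lambda>\<omega>. (\<xi> i \<omega>)\<^sup>2)"
proof -
  show 1: "0 \<le> \<tau> 0" "\<forall>i<n. \<tau> i \<le> \<tau> (Suc i)" and 2: "i < n \<Longrightarrow> \<xi> i \<in> borel_measurable (F (\<tau> i))" for i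
    using assms by (auto simp: simple_data_def)
  show 3: "i \<le> n \<Longrightarrow> 0 \<le> \<tau> i" for i
    using chain_le[OF 1(2), of 0 i] 1(1) by simp
  show 4: "i < n \<Longrightarrow> \<xi> i \<in> borel_measurable M" for i
    by (meson measurable_F_M 2 3 less_imp_le)
  show "integrable M (\<lambda>\<omega>. (\<xi> i \<omega>)\<^sup>2)" if i: "i < n"
  proof -
    obtain B where "\<forall>\<omega>\<in>space M. \<bar>\<xi> i \<omega>\<bar> \<le> B"
      using assms i unfolding simple_data_def by blast
    then have "\<forall>\<omega>\<in>space M. (\<xi> i \<omega>)\<^sup>2 \<le> B\<^sup>2"
      by (metis abs_ge_zero power2_abs power_mono)
    then show ?thesis
      using 4[OF i] by (intro integrable_const_bound[where B="B\<^sup>2"]) auto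
  qed
qed

text \<open>Coefficients are merely square integrable here, in contrast to
  \<open>simple_data\<close>: the truncation errors of geometric Brownian motion are unbounded and
  need the isometry as well.\<close>

lemma ito_sum_square:
  assumes \<tau>0: "0 \<le> \<tau> 0" and mono: "\<forall>i<n. \<tau> i \<le> \<tau> (Suc i)"
    and meas: "\<And>i. i < n \<Longrightarrow> \<xi> i \<in> borel_measurable (F (\<tau> i))"
    and sq: "\<And>i. i < n \<Longrightarrow> integrable M (\<lambda>\<omega>. (\<xi> i \<omega>)\<^sup>2)" and s: "0 \<le> s"
  shows "has_bochner_integral M (\<lambda>\<omega>. (simple_ito_integral W n \<tau> \<xi> s \<omega>)\<^sup>2)
     (\<Sum>i<n. expectation (\<lambda>\<omega>. (\<xi> i \<omega>)\<^sup>2) * (min (\<tau> (Suc i)) s - min (\<tau> i) s))"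
proof -
  have nn: "0 \<le> \<tau> i" if "i \<le> n" for i
    using chain_le[OF mono, of 0 i] \<tau>0 that by simp
  let ?s = "\<lambda>i. min (\<tau> i) s"
  \<comment> \<open>If \<open>\<tau> i\<close> exceeds \<open>s\<close>, then \<open>\<xi> i\<close>
    need not be measurable at the clipped time. The clipped increment is 0 in that case, so the
    coefficient can be replaced by 0.\<close>
  let ?G = "\<lambda>i. if \<tau> i \<le> s then \<xi> i else (\<lambda>_. 0)"
  have "has_bochner_integral M (\<lambda>\<omega>. (\<Sum>i<n. ?G i \<omega> * (\<lambda>x. x) (W (?s (Suc i)) \<omega> - W (?s i) \<omega>))\<^sup>2)
     (\<Sum>i<n. expectation (\<lambda>\<omega>. (?G i \<omega>)\<^sup>2) * (?s (Suc i) - ?s i))"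
  proof (rule increment_sum_square(1))
    fix i assume i: "i < n"
    have 0: "0 \<le> ?s i" "?s i \<le> ?s (Suc i)" using nn[of i] mono i s by (auto intro: min.mono)
    show "has_bochner_integral M (\<lambda>\<omega>. W (?s (Suc i)) \<omega> - W (?s i) \<omega>) 0"
      "has_bochner_integral M (\<lambda>\<omega>. (W (?s (Suc i)) \<omega> - W (?s i) \<omega>)\<^sup>2) (?s (Suc i) - ?s i)"
      using increment_mean[OF 0] increment_square[OF 0] by auto
    show "?G i \<in> borel_measurable (F (?s i))"
      using meas[OF i] by (simp add: min_def)
    show "integrable M (\<lambda>\<omega>. (?G i \<omega>)\<^sup>2)" using sq[OF i] by simp
  qed (use \<tau>0 mono s in \<open>auto intro: min.mono\<close>)
  moreover have "(\<lambda>\<omega>. (\<Sum>i<n. ?G i \<omega> * (\<lambda>x. x) (W (?s (Suc i)) \<omega> - W (?s i) \<omega>))\<^sup>2) =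
     (\<lambda>\<omega>. (simple_ito_integral W n \<tau> \<xi> s \<omega>)\<^sup>2)"
    unfolding simple_ito_integral_def
    using mono by (intro ext arg_cong[where f="\<lambda>x. x\<^sup>2"] sum.cong) (auto simp: min_def)
  moreover have "(\<Sum>i<n. expectation (\<lambda>\<omega>. (?G i \<omega>)\<^sup>2) * (?s (Suc i) - ?s i)) =
     (\<Sum>i<n. expectation (\<lambda>\<omega>. (\<xi> i \<omega>)\<^sup>2) * (?s (Suc i) - ?s i))"
    using mono by (intro sum.cong) (auto simp: min_def)
  ultimately show ?thesis by (simp only:)
qed

lemma simple_ito_square:
  assumes sd: "simple_data M F n \<tau> \<xi>" and s: "0 \<le> s"
  shows "has_bochner_integral M (\<lambda>\<omega>. (simple_ito_integral W n \<tau> \<xi> s \<omega>)\<^sup>2)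
     (\<Sum>i<n. expectation (\<lambda>\<omega>. (\<xi> i \<omega>)\<^sup>2) * (min (\<tau> (Suc i)) s - min (\<tau> i) s))"
  using simple_dataD[OF sd] s by (intro ito_sum_square) auto

lemma simple_ito_measurable:
  assumes sd: "simple_data M F n \<tau> \<xi>" and s: "0 \<le> s"
  shows "simple_ito_integral W n \<tau> \<xi> s \<in> borel_measurable M"
  unfolding simple_ito_integral_def
  using simple_dataD[OF sd] s
  by (intro borel_measurable_sum borel_measurable_times borel_measurable_diff W_measurable) auto

lemma simple_ito_isometry:
  assumes sd: "simple_data M F n \<tau> \<xi>" and s: "0 \<le> s"
  shows "(\<integral>\<^sup>+\<omega>. ennreal ((simple_ito_integral W n \<tau> \<xi> s \<omega>)\<^sup>2) \<partial>M) =
     (\<integral>\<^sup>+\<omega>. (\<integral>\<^sup>+t\<in>{0..s}. ennreal ((simple_process n \<tau> \<xi> t \<omega>)\<^sup>2) \<partial>lborel) \<partial>M)"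
proof -
  note D = simple_dataD[OF sd]
  have "0 \<le> min (\<tau> (Suc i)) s - min (\<tau> i) s" if "i < n" for i using D(2) that by (auto simp: min_def)
  then have "(\<integral>\<^sup>+\<omega>. ennreal (\<Sum>i<n. (\<xi> i \<omega>)\<^sup>2 * (min (\<tau> (Suc i)) s - min (\<tau> i) s)) \<partial>M) =
     ennreal (\<integral>\<omega>. (\<Sum>i<n. (\<xi> i \<omega>)\<^sup>2 * (min (\<tau> (Suc i)) s - min (\<tau> i) s)) \<partial>M)"
    using D(6) by (intro nn_integral_eq_integral) (auto intro!: sum_nonneg)
  also have "\<dots> = ennreal (\<Sum>i<n. expectation (\<lambda>\<omega>. (\<xi> i \<omega>)\<^sup>2) * (min (\<tau> (Suc i)) s - min (\<tau> i) s))"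
    using D(6) by (subst Bochner_Integration.integral_sum) auto
  also have "\<dots> = (\<integral>\<^sup>+\<omega>. ennreal ((simple_ito_integral W n \<tau> \<xi> s \<omega>)\<^sup>2) \<partial>M)"
    using simple_ito_square[OF sd s]
    by (subst nn_integral_eq_integral) (auto simp: has_bochner_integral_iff)
  finally show ?thesis
    unfolding nn_integral_simple_process_square[OF D(1,2) s] by (rule sym)
qed

text \<open>The exponential martingale that turns \<open>W t + l * t\<close> into a Brownian motion
  on a finite horizon. It carries no discount factor: interest is dealt with separately in
  \<open>wealth_path_bound\<close>.\<close>

definition state_price :: "real \<Rightarrow> real \<Rightarrow> 'a \<Rightarrow> real" where
  "state_price l t \<omega> = exp (- l * W t \<omega> - l\<^sup>2 * t / 2)"

lemma state_price_pos: "0 < state_price l t \<omega>"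
  by (simp add: state_price_def)

lemma state_price_adapted: "0 \<le> t \<Longrightarrow> state_price l t \<in> borel_measurable (F t)"
  unfolding state_price_def using W_adapted[of t] by measurable

lemma state_price_measurable: "0 \<le> t \<Longrightarrow> state_price l t \<in> borel_measurable M"
  using state_price_adapted measurable_F_M by blast

lemma exp_W:
  assumes "0 \<le> t"
  shows "has_bochner_integral M (\<lambda>\<omega>. exp (b * W t \<omega>)) (exp (b\<^sup>2 * t / 2))"
proof -
  have "has_bochner_integral M (\<lambda>\<omega>. exp (b * (W t \<omega> - W 0 \<omega>))) (exp (b\<^sup>2 * (t - 0) / 2))"
    using assms by (intro exp_increment) auto
  moreover have "\<And>\<omega>. \<omega> \<in> space M \<Longrightarrow> exp (b * (W t \<omega> - W 0 \<omega>)) = exp (b * W t \<omega>)"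
    by (simp add: W_zero)
  ultimately show ?thesis by (simp cong: has_bochner_integral_cong)
qed

lemma state_price_integrable:
  assumes "0 \<le> t"
  shows "integrable M (state_price l t)" "expectation (state_price l t) = 1"
    "integrable M (\<lambda>\<omega>. (state_price l t \<omega>)\<^sup>2)"
proof -
  have "has_bochner_integral M (\<lambda>\<omega>. exp (- l * W t \<omega>) * exp (- l\<^sup>2 * t / 2)) (exp ((- l)\<^sup>2 * t / 2) * exp (- l\<^sup>2 * t / 2))"
    by (intro has_bochner_integral_mult_left exp_W assms)
  then have "has_bochner_integral M (state_price l t) 1"
    unfolding state_price_def by (simp add: exp_add[symmetric] mult_exp_exp)
  then show "integrable M (state_price l t)" "expectation (state_price l t) = 1"
    by (auto simp: has_bochner_integral_iff)
  have "integrable M (\<lambda>\<omega>. exp (- (2 * l) * W t \<omega>) * exp (- l\<^sup>2 * t))"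
    using exp_W[OF assms, of "- (2 * l)"] by (intro integrable_mult_left) (auto simp: has_bochner_integral_iff)
  moreover have "exp (- (2 * l) * W t \<omega>) * exp (- l\<^sup>2 * t) = (state_price l t \<omega>)\<^sup>2" for \<omega>
    unfolding state_price_def power2_eq_square mult_exp_exp by (simp add: algebra_simps)
  ultimately show "integrable M (\<lambda>\<omega>. (state_price l t \<omega>)\<^sup>2)" by (simp only:)
qed

text \<open>The density at \<open>T\<close> factors into its value at \<open>u\<close> and
  exponentials of the increments over \<open>{u..v}\<close> and \<open>{v..T}\<close>. Tilting by
  \<open>- l\<close> gives the middle increment the mean \<open>- l * (v - u)\<close>, which the
  added drift \<open>l * (v - u)\<close> cancels. The coefficient before it and the exponential
  after it are independent of that increment, so the whole product has mean 0.\<close>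

lemma state_price_orthogonal:
  assumes uvT: "0 \<le> u" "u \<le> v" "v \<le> T" and \<xi>: "\<xi> \<in> borel_measurable (F u)"
    and \<xi>2: "integrable M (\<lambda>\<omega>. (\<xi> \<omega>)\<^sup>2)"
  shows "has_bochner_integral M (\<lambda>\<omega>. state_price l T \<omega> * (\<xi> \<omega> * (W v \<omega> - W u \<omega> + l * (v - u)))) 0"
proof -
  define g1 where "g1 x = (x + l * (v - u)) * exp (- l * x - l\<^sup>2 * (v - u) / 2)" for x
  define g2 where "g2 x = exp (- l * x - l\<^sup>2 * (T - v) / 2)" for x
  have [measurable]: "g1 \<in> borel_measurable borel" "g2 \<in> borel_measurable borel"
    unfolding g1_def g2_def by measurable
  have v: "0 \<le> v" using uvT by simp
  let ?A = "\<lambda>\<omega>. state_price l u \<omega> * \<xi> \<omega>"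
  have A: "?A \<in> borel_measurable (F u)"
    using state_price_adapted[OF uvT(1), of l] \<xi> by measurable
  have iA: "integrable M ?A"
    using state_price_measurable[OF uvT(1)] state_price_integrable[OF uvT(1)] measurable_F_M[OF uvT(1) \<xi>] \<xi>2
    by (intro integrable_mult_of_squares) auto
  let ?e = "exp (- l\<^sup>2 * (v - u) / 2)"
  have "has_bochner_integral M (\<lambda>\<omega>. ((W v \<omega> - W u \<omega>) * exp (- l * (W v \<omega> - W u \<omega>)) + l * (v - u) * exp (- l * (W v \<omega> - W u \<omega>))) * ?e)
     ((- l * (v - u) * exp ((- l)\<^sup>2 * (v - u) / 2) + l * (v - u) * exp ((- l)\<^sup>2 * (v - u) / 2)) * ?e)"
    by (intro has_bochner_integral_mult_left has_bochner_integral_add has_bochner_integral_mult_right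
        mult_exp_increment exp_increment uvT)
  moreover have "(x * exp (- l * x) + l * (v - u) * exp (- l * x)) * ?e = g1 x" for x
  proof -
    have e: "exp (- l * x - l\<^sup>2 * (v - u) / 2) = exp (- l * x) * ?e" by (simp add: mult_exp_exp)
    show ?thesis unfolding g1_def e by (simp only: distrib_right mult.assoc)
  qed
  ultimately have g1: "has_bochner_integral M (\<lambda>\<omega>. g1 (W v \<omega> - W u \<omega>)) 0"
    by simp
  \<comment> \<open>Everything up to time \<open>v\<close>; it has mean 0 and is known at
    \<open>v\<close>, so multiplying by the independent last factor keeps the mean 0.\<close>
  let ?B = "\<lambda>\<omega>. ?A \<omega> * g1 (W v \<omega> - W u \<omega>)"
  have B: "integrable M ?B" "expectation ?B = 0"
    using expectation_mult_increment[OF uvT(1,2) A _ iA, of g1] g1 by (auto simp: has_bochner_integral_iff)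
  have "?A \<in> borel_measurable (F v)" "W v \<in> borel_measurable (F v)" "W u \<in> borel_measurable (F v)"
    using measurable_F_mono[OF uvT(1,2) A] W_adapted' uvT v by auto
  then have BF: "?B \<in> borel_measurable (F v)" by measurable
  have "has_bochner_integral M (\<lambda>\<omega>. exp (- l * (W T \<omega> - W v \<omega>)) * exp (- l\<^sup>2 * (T - v) / 2))
     (exp ((- l)\<^sup>2 * (T - v) / 2) * exp (- l\<^sup>2 * (T - v) / 2))"
    by (intro has_bochner_integral_mult_left exp_increment uvT v)
  then have "integrable M (\<lambda>\<omega>. g2 (W T \<omega> - W v \<omega>))"
    by (auto simp: has_bochner_integral_iff g2_def mult_exp_exp)
  from expectation_mult_increment[OF v uvT(3) BF _ B(1) this]
  have "has_bochner_integral M (\<lambda>\<omega>. ?B \<omega> * g2 (W T \<omega> - W v \<omega>)) 0"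
    using B by (auto simp: has_bochner_integral_iff)
  moreover have "?B \<omega> * g2 (W T \<omega> - W v \<omega>) = state_price l T \<omega> * (\<xi> \<omega> * (W v \<omega> - W u \<omega> + l * (v - u)))" for \<omega>
  proof -
    have "state_price l u \<omega> * exp (- l * (W v \<omega> - W u \<omega>) - l\<^sup>2 * (v - u) / 2) * g2 (W T \<omega> - W v \<omega>) = state_price l T \<omega>"
      unfolding state_price_def g2_def mult_exp_exp by (simp add: field_simps)
    then show ?thesis unfolding g1_def by (simp add: algebra_simps)
  qed
  ultimately show ?thesis by simp
qed

lemma state_price_simple:
  assumes sd: "simple_data M F n \<tau> \<xi>" and s: "0 \<le> s" "s \<le> T"
  shows "has_bochner_integral M (\<lambda>\<omega>. state_price l T \<omega> * (simple_ito_integral W n \<tau> \<xi> s \<omega> +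
     l * (LINT t:{0..s}|lborel. simple_process n \<tau> \<xi> t \<omega>))) 0"
proof -
  note D = simple_dataD[OF sd]
  let ?s = "\<lambda>i. min (\<tau> i) s"
  have "has_bochner_integral M (\<lambda>\<omega>. \<Sum>i<n. state_price l T \<omega> * (\<xi> i \<omega> * (W (?s (Suc i)) \<omega> - W (?s i) \<omega> + l * (?s (Suc i) - ?s i)))) (\<Sum>i<n. 0)"
  proof (rule has_bochner_integral_sum)
    fix i assume "i \<in> {..<n}"
    then have i: "i < n" by simp
    show "has_bochner_integral M (\<lambda>\<omega>. state_price l T \<omega> * (\<xi> i \<omega> * (W (?s (Suc i)) \<omega> - W (?s i) \<omega> + l * (?s (Suc i) - ?s i)))) 0"
    \<comment> \<open>For \<open>\<tau> i > s\<close> the coefficient may fail to be measurable at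
      the clipped time, but then both clipped endpoints equal \<open>s\<close> and the summand is
      0.\<close>
    proof (cases "\<tau> i \<le> s")
      case True
      then show ?thesis
        using D i s by (intro state_price_orthogonal) (auto simp: min_def)
    next
      case False
      then have "?s (Suc i) = ?s i" using D(2) i by (auto simp: min_def)
      then show ?thesis by (simp add: has_bochner_integral_zero)
    qed
  qed
  moreover have "(\<Sum>i<n. state_price l T \<omega> * (\<xi> i \<omega> * (W (?s (Suc i)) \<omega> - W (?s i) \<omega> + l * (?s (Suc i) - ?s i)))) =
    state_price l T \<omega> * (simple_ito_integral W n \<tau> \<xi> s \<omega> + l * (LINT t:{0..s}|lborel. simple_process n \<tau> \<xi> t \<omega>))" for \<omega>
    unfolding simple_ito_integral_def set_integral_simple_process(2)[OF D(1,2) s(1)]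
    by (simp add: sum_distrib_left sum.distrib[symmetric] algebra_simps)
  ultimately show ?thesis by simp
qed

end

subsection \<open>Measurability and square integrability\<close>

lemma ennreal_square_add_le:
  "ennreal ((a + b)\<^sup>2) \<le> 2 * ennreal (a\<^sup>2) + 2 * ennreal (b\<^sup>2)"
proof -
  have "(a + b)\<^sup>2 \<le> 2 * a\<^sup>2 + 2 * b\<^sup>2"
    using sum_squares_bound[of a b] by (simp add: power2_sum)
  then have "ennreal ((a + b)\<^sup>2) \<le> ennreal (2 * a\<^sup>2 + 2 * b\<^sup>2)" by (rule ennreal_leI)
  then show ?thesis by (simp add: ennreal_plus ennreal_mult)
qed

text \<open>Joint measurability is defined over the half line of times. Composing with
  \<open>max 0\<close> extends the process to all times, which allows products with
  \<open>lborel\<close> and hence Fubini.\<close>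

lemma jointly_measurable_clip:
  assumes "jointly_measurable M Z"
  shows "(\<lambda>(\<omega>, t). Z (max 0 t) \<omega>) \<in> borel_measurable (M \<Otimes>\<^sub>M borel)"
proof -
  have "(\<lambda>(\<omega>, t). (\<omega>, max 0 t)) \<in> (M \<Otimes>\<^sub>M borel) \<rightarrow>\<^sub>M (M \<Otimes>\<^sub>M restrict_space borel {0::real..})"
    unfolding split_beta
    by (intro measurable_Pair measurable_restrict_space2) auto
  from measurable_compose[OF this assms[unfolded jointly_measurable_def]]
  show ?thesis by (simp add: split_beta)
qed

lemma jointly_measurable_indicator:
  assumes "jointly_measurable M Z"
  shows "(\<lambda>(\<omega>, t). indicator {0..s} t * Z t \<omega>) \<in> borel_measurable (M \<Otimes>\<^sub>M borel)"
proof -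
  note [measurable] = jointly_measurable_clip[OF assms]
  have "(\<lambda>x. indicator {0..s} (snd x) * (\<lambda>(\<omega>, t). Z (max 0 t) \<omega>) x) \<in> borel_measurable (M \<Otimes>\<^sub>M borel)"
    by measurable
  moreover have "(\<lambda>x. indicator {0..s} (snd x) * (\<lambda>(\<omega>, t). Z (max 0 t) \<omega>) x) = (\<lambda>(\<omega>, t). indicator {0..s} t * Z t \<omega>)"
    by (auto simp: fun_eq_iff indicator_def)
  ultimately show ?thesis by simp
qed

lemma jointly_measurable_section:
  assumes "jointly_measurable M Z" "\<omega> \<in> space M"
  shows "(\<lambda>t. indicator {0..s} t * Z t \<omega>) \<in> borel_measurable borel"
  using measurable_compose[OF measurable_Pair1'[OF assms(2)] jointly_measurable_indicator[OF assms(1), of s]]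
  by simp

lemma jointly_measurable_diff:
  "jointly_measurable M Y \<Longrightarrow> jointly_measurable M Z \<Longrightarrow> jointly_measurable M (\<lambda>t \<omega>. Y t \<omega> - Z t \<omega>)"
  unfolding jointly_measurable_def split_beta by measurable

text \<open>The condition \<open>g 0 = 0\<close> allows the indicator of the time interval to move
  inside \<open>g\<close>, where the process times the indicator is known to be measurable.\<close>

lemma jointly_measurable_nn_integral:
  assumes Z: "jointly_measurable M Z" and [measurable]: "g \<in> borel_measurable borel" and g: "g 0 = 0"
  shows "(\<lambda>\<omega>. \<integral>\<^sup>+t\<in>{0..s}. ennreal (g (Z t \<omega>)) \<partial>lborel) \<in> borel_measurable M"
proof -
  note [measurable] = jointly_measurable_indicator[OF Z, of s]
  have "(\<lambda>x. g ((\<lambda>(\<omega>, t). indicator {0..s} t * Z t \<omega>) x)) \<in> borel_measurable (M \<Otimes>\<^sub>M borel)"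
    by measurable
  then have "(\<lambda>x. ennreal (g ((\<lambda>(\<omega>, t). indicator {0..s} t * Z t \<omega>) x))) \<in> borel_measurable (M \<Otimes>\<^sub>M lborel)"
    by measurable
  then have "(\<lambda>\<omega>. \<integral>\<^sup>+t. ennreal (g (indicator {0..s} t * Z t \<omega>)) \<partial>lborel) \<in> borel_measurable M"
    by (intro lborel.borel_measurable_nn_integral) (simp add: split_beta)
  moreover have "(\<integral>\<^sup>+t. ennreal (g (indicator {0..s} t * Z t \<omega>)) \<partial>lborel) = (\<integral>\<^sup>+t\<in>{0..s}. ennreal (g (Z t \<omega>)) \<partial>lborel)" for \<omega>
    using g by (intro nn_integral_cong) (auto simp: indicator_def)
  ultimately show ?thesis by simp
qed

lemma jointly_measurable_set_integral:
  assumes Z: "jointly_measurable M Z"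
  shows "(\<lambda>\<omega>. LINT t:{0..s}|lborel. Z t \<omega>) \<in> borel_measurable M"
proof -
  have "(\<lambda>(\<omega>, t). indicator {0..s} t * Z t \<omega>) \<in> borel_measurable (M \<Otimes>\<^sub>M lborel)"
    using jointly_measurable_indicator[OF Z, of s] by measurable
  then have "(\<lambda>\<omega>. \<integral>t. indicator {0..s} t * Z t \<omega> \<partial>lborel) \<in> borel_measurable M"
    by (intro lborel.borel_measurable_lebesgue_integral) simp
  then show ?thesis by (simp add: set_lebesgue_integral_def)
qed

text \<open>Cauchy-Schwarz against the constant 1. No integrability is assumed, so the bound can be
  applied on every path.\<close>

lemma set_integral_square_le:
  assumes "0 \<le> s" and m[measurable]: "(\<lambda>t. indicator {0..s} t * f t) \<in> borel_measurable borel"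
  shows "ennreal ((LINT t:{0..s}|lborel. f t)\<^sup>2) \<le> ennreal s * (\<integral>\<^sup>+t\<in>{0..s}. ennreal ((f t)\<^sup>2) \<partial>lborel)"
proof (cases "set_integrable lborel {0..s} f")
  case True
  have "ennreal (norm (LINT t:{0..s}|lborel. f t)) \<le> (\<integral>\<^sup>+t. norm (indicator {0..s} t *\<^sub>R f t) \<partial>lborel)"
    using True unfolding set_integrable_def set_lebesgue_integral_def by (rule integral_norm_bound_ennreal)
  also have "\<dots> = (\<integral>\<^sup>+t. indicator {0..s} t * ennreal \<bar>indicator {0..s} t * f t\<bar> \<partial>lborel)"
    by (intro nn_integral_cong) (auto simp: indicator_def)
  finally have "(ennreal (norm (LINT t:{0..s}|lborel. f t)))\<^sup>2 \<le>
     (\<integral>\<^sup>+t. indicator {0..s} t * ennreal \<bar>indicator {0..s} t * f t\<bar> \<partial>lborel)\<^sup>2"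
    by (rule power_mono) simp
  also have "\<dots> \<le> (\<integral>\<^sup>+t. (indicator {0..s} t)\<^sup>2 \<partial>lborel) * (\<integral>\<^sup>+t. (ennreal \<bar>indicator {0..s} t * f t\<bar>)\<^sup>2 \<partial>lborel)"
    by (rule Cauchy_Schwarz_nn_integral) auto
  also have "(\<integral>\<^sup>+t. (indicator {0..s} t)\<^sup>2 \<partial>lborel) = (\<integral>\<^sup>+t. indicator {0..s} t \<partial>lborel)"
    by (intro nn_integral_cong) (auto simp: indicator_def)
  also have "\<dots> = ennreal s" using assms by simp
  also have "(\<integral>\<^sup>+t. (ennreal \<bar>indicator {0..s} t * f t\<bar>)\<^sup>2 \<partial>lborel) = (\<integral>\<^sup>+t\<in>{0..s}. ennreal ((f t)\<^sup>2) \<partial>lborel)"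
    by (intro nn_integral_cong) (auto simp: indicator_def ennreal_power)
  finally show ?thesis by (simp add: ennreal_power)
next
  case False
  \<comment> \<open>A function that is not integrable has Bochner integral 0 by convention, and the
    bound holds trivially.\<close>
  then have "(LINT t:{0..s}|lborel. f t) = 0"
    unfolding set_integrable_def set_lebesgue_integral_def by (rule not_integrable_integral_eq)
  then show ?thesis by simp
qed

text \<open>On a bounded interval \<open>\<bar>x\<bar> \<le> 1 + x\<^sup>2\<close> dominates the
  function by an integrable one.\<close>

lemma set_integrable_of_square:
  assumes m[measurable]: "(\<lambda>t. indicator {0..s} t * f t) \<in> borel_measurable borel"
    and fin: "(\<integral>\<^sup>+t\<in>{0..s}. ennreal ((f t)\<^sup>2) \<partial>lborel) < \<infinity>"
  shows "set_integrable lborel {0..s::real} (f :: real \<Rightarrow> real)"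
  unfolding set_integrable_def
proof (rule integrableI_bounded)
  have le: "ennreal \<bar>x\<bar> \<le> 1 + ennreal (x\<^sup>2)" for x :: real
  proof -
    have "0 \<le> (\<bar>x\<bar> - 1)\<^sup>2" by simp
    then have "\<bar>x\<bar> \<le> 1 + x\<^sup>2" by (simp add: power2_diff)
    then have "ennreal \<bar>x\<bar> \<le> ennreal (1 + x\<^sup>2)" by (rule ennreal_leI)
    then show ?thesis by (simp add: ennreal_plus)
  qed
  have m2: "(\<lambda>t. ennreal ((f t)\<^sup>2) * indicator {0..s} t) = (\<lambda>t. ennreal ((indicator {0..s} t * f t)\<^sup>2))"
    by (auto simp: indicator_def)
  have [measurable]: "(\<lambda>t. ennreal ((f t)\<^sup>2) * indicator {0..s} t) \<in> borel_measurable borel"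
    unfolding m2 by measurable
  have "(\<integral>\<^sup>+t. norm (indicator {0..s} t *\<^sub>R f t) \<partial>lborel) \<le>
     (\<integral>\<^sup>+t. indicator {0..s} t + ennreal ((f t)\<^sup>2) * indicator {0..s} t \<partial>lborel)"
    using le by (intro nn_integral_mono) (auto simp: indicator_def)
  also have "\<dots> = emeasure lborel {0..s} + (\<integral>\<^sup>+t\<in>{0..s}. ennreal ((f t)\<^sup>2) \<partial>lborel)"
    by (subst nn_integral_add) auto
  also have "\<dots> < \<infinity>" using fin by (simp add: emeasure_lborel_Icc_eq)
  finally show "(\<integral>\<^sup>+t. norm (indicator {0..s} t *\<^sub>R f t) \<partial>lborel) < \<infinity>" .
qed simp

lemma jointly_measurable_simple_process:
  assumes "\<And>i. i < n \<Longrightarrow> \<xi> i \<in> borel_measurable M"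
  shows "jointly_measurable M (simple_process n \<tau> \<xi>)"
proof -
  have "(\<lambda>x. \<xi> i (fst x) * indicator {\<tau> i<..\<tau> (Suc i)} (snd x)) \<in> borel_measurable (M \<Otimes>\<^sub>M restrict_space borel {0..})" if "i < n" for i
  proof -
    note [measurable] = assms[OF that]
    have "(\<lambda>x. snd x) \<in> (M \<Otimes>\<^sub>M restrict_space borel {0::real..}) \<rightarrow>\<^sub>M borel"
      by (rule measurable_compose[OF measurable_snd]) (rule measurable_restrict_space1, simp)
    then show ?thesis by measurable
  qed
  then show ?thesis
    unfolding jointly_measurable_def simple_process_def split_beta
    by (intro borel_measurable_sum) auto
qed

context prob_space
begin

text \<open>Pairing with \<open>L\<close> is continuous in mean square: by Cauchy-Schwarz the
  pairing of \<open>L\<close> with \<open>f\<close> is at most the norm of \<open>L\<close> times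
  the distance from \<open>f\<close> to \<open>g k\<close>, which tends to 0.\<close>

lemma L2_limit_orthogonal:
  fixes L f :: "'a \<Rightarrow> real" and g :: "nat \<Rightarrow> 'a \<Rightarrow> real"
  assumes [measurable]: "L \<in> borel_measurable M" "f \<in> borel_measurable M" "\<And>k. g k \<in> borel_measurable M"
    and L2: "integrable M (\<lambda>\<omega>. (L \<omega>)\<^sup>2)" and g2: "\<And>k. integrable M (\<lambda>\<omega>. (g k \<omega>)\<^sup>2)"
    and lim: "(\<lambda>k. \<integral>\<^sup>+\<omega>. ennreal ((g k \<omega> - f \<omega>)\<^sup>2) \<partial>M) \<longlonglongrightarrow> 0"
    and orth: "\<And>k. expectation (\<lambda>\<omega>. L \<omega> * g k \<omega>) = 0"
  shows "integrable M (\<lambda>\<omega>. (f \<omega>)\<^sup>2)" "integrable M (\<lambda>\<omega>. L \<omega> * f \<omega>)" "expectation (\<lambda>\<omega>. L \<omega> * f \<omega>) = 0"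
proof -
  note mult = integrable_mult_of_squares
  have ev: "eventually (\<lambda>k. (\<integral>\<^sup>+\<omega>. ennreal ((g k \<omega> - f \<omega>)\<^sup>2) \<partial>M) < 1) sequentially"
    using lim by (rule order_tendstoD) simp
  have d2: "integrable M (\<lambda>\<omega>. (g k \<omega> - f \<omega>)\<^sup>2)" if "(\<integral>\<^sup>+\<omega>. ennreal ((g k \<omega> - f \<omega>)\<^sup>2) \<partial>M) < 1" for k
  proof -
    have "(\<integral>\<^sup>+\<omega>. ennreal ((g k \<omega> - f \<omega>)\<^sup>2) \<partial>M) < \<infinity>"
      using that by (rule order.strict_trans) simp
    then show ?thesis by (intro integrableI_bounded) auto
  qed
  \<comment> \<open>One \<open>g k0\<close> at finite distance from \<open>f\<close> already makes
    \<open>f\<close> square integrable, by expanding the square of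
    \<open>f = g k0 - (g k0 - f)\<close>.\<close>
  obtain k0 where "(\<integral>\<^sup>+\<omega>. ennreal ((g k0 \<omega> - f \<omega>)\<^sup>2) \<partial>M) < 1"
    using ev by (auto simp: eventually_sequentially)
  note d = d2[OF this]
  have "integrable M (\<lambda>\<omega>. (g k0 \<omega>)\<^sup>2 - 2 * (g k0 \<omega> * (g k0 \<omega> - f \<omega>)) + (g k0 \<omega> - f \<omega>)\<^sup>2)"
    using g2[of k0] d mult[of "g k0" "\<lambda>\<omega>. g k0 \<omega> - f \<omega>"] by simp
  then show f2: "integrable M (\<lambda>\<omega>. (f \<omega>)\<^sup>2)"
    by (simp add: power2_eq_square algebra_simps)
  show Lf: "integrable M (\<lambda>\<omega>. L \<omega> * f \<omega>)"
    using L2 f2 by (intro mult) auto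
  let ?C = "\<integral>\<^sup>+\<omega>. ennreal ((L \<omega>)\<^sup>2) \<partial>M"
  have C: "?C < top"
    using L2 by (subst nn_integral_eq_integral) auto
  \<comment> \<open>As \<open>g k\<close> is orthogonal to \<open>L\<close>, it can be subtracted
    from \<open>f\<close> without changing the expectation, before Cauchy-Schwarz is
    applied.\<close>
  have "eventually (\<lambda>k. (ennreal \<bar>expectation (\<lambda>\<omega>. L \<omega> * f \<omega>)\<bar>)\<^sup>2 \<le> ?C * (\<integral>\<^sup>+\<omega>. ennreal ((g k \<omega> - f \<omega>)\<^sup>2) \<partial>M)) sequentially"
    using ev
  proof eventually_elim
    case (elim k)
    note d = d2[OF elim]
    have "integrable M (\<lambda>\<omega>. L \<omega> * g k \<omega>)" using L2 g2 by (intro mult) auto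
    then have "expectation (\<lambda>\<omega>. L \<omega> * (f \<omega> - g k \<omega>)) = expectation (\<lambda>\<omega>. L \<omega> * f \<omega>)"
      using Lf orth[of k] by (simp add: right_diff_distrib)
    moreover have i: "integrable M (\<lambda>\<omega>. L \<omega> * (f \<omega> - g k \<omega>))"
      using L2 d by (intro mult) (auto simp: power2_commute)
    ultimately have "ennreal \<bar>expectation (\<lambda>\<omega>. L \<omega> * f \<omega>)\<bar> \<le> (\<integral>\<^sup>+\<omega>. norm (L \<omega> * (f \<omega> - g k \<omega>)) \<partial>M)"
      using integral_norm_bound_ennreal[OF i] by simp
    also have "\<dots> = (\<integral>\<^sup>+\<omega>. ennreal \<bar>L \<omega>\<bar> * ennreal \<bar>f \<omega> - g k \<omega>\<bar> \<partial>M)"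
      by (simp add: abs_mult ennreal_mult)
    finally have "(ennreal \<bar>expectation (\<lambda>\<omega>. L \<omega> * f \<omega>)\<bar>)\<^sup>2 \<le> (\<integral>\<^sup>+\<omega>. ennreal \<bar>L \<omega>\<bar> * ennreal \<bar>f \<omega> - g k \<omega>\<bar> \<partial>M)\<^sup>2"
      by (rule power_mono) simp
    also have "\<dots> \<le> (\<integral>\<^sup>+\<omega>. (ennreal \<bar>L \<omega>\<bar>)\<^sup>2 \<partial>M) * (\<integral>\<^sup>+\<omega>. (ennreal \<bar>f \<omega> - g k \<omega>\<bar>)\<^sup>2 \<partial>M)"
      by (rule Cauchy_Schwarz_nn_integral) auto
    finally show ?case by (simp add: ennreal_power power2_commute)
  qed
  moreover have "(\<lambda>k. ?C * (\<integral>\<^sup>+\<omega>. ennreal ((g k \<omega> - f \<omega>)\<^sup>2) \<partial>M)) \<longlonglongrightarrow> ?C * 0"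
    by (rule ennreal_tendsto_cmult[OF C lim])
  ultimately have "(ennreal \<bar>expectation (\<lambda>\<omega>. L \<omega> * f \<omega>)\<bar>)\<^sup>2 \<le> ?C * 0"
    by (intro tendsto_lowerbound[where F=sequentially]) auto
  then show "expectation (\<lambda>\<omega>. L \<omega> * f \<omega>) = 0" by simp
qed

end

lemma nn_integral_indicator_mono:
  fixes T s :: real
  assumes "s \<le> T"
  shows "(\<integral>\<^sup>+t\<in>{0..s}. f t \<partial>lborel) \<le> (\<integral>\<^sup>+t\<in>{0..T}. f t \<partial>lborel)"
  using assms by (intro nn_integral_mono) (auto simp: indicator_def)

context brownian
begin

text \<open>\<open>N\<close> is the integral of \<open>H\<close> against \<open>W t + l * t\<close>,
  so it inherits from the simple integrands the orthogonality to the density at \<open>T\<close>.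
  The second moment bound is uniform in \<open>s\<close>, which is what Fubini over paths and times
  requires in \<open>budget_constraint\<close>. Its constant is not sharp: the 8 combines two uses
  of \<open>(a + b)\<^sup>2 \<le> 2 * a\<^sup>2 + 2 * b\<^sup>2\<close> in the bound for
  \<open>I s\<close> with a third one for \<open>N\<close>.\<close>

lemma ito_integral_state_price:
  fixes l s T :: real and H I :: "real \<Rightarrow> 'a \<Rightarrow> real"
  assumes jH: "jointly_measurable M H"
    and H2: "(\<integral>\<^sup>+\<omega>. (\<integral>\<^sup>+t\<in>{0..T}. ennreal ((H t \<omega>)\<^sup>2) \<partial>lborel) \<partial>M) < \<infinity>"
    and ito: "is_ito_integral M F W H I"
    and s: "0 \<le> s" "s \<le> T" "0 < T"
  defines "N \<equiv> \<lambda>\<omega>. I s \<omega> + l * (LINT t:{0..s}|lborel. H t \<omega>)"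
  defines "A \<equiv> \<integral>\<^sup>+\<omega>. (\<integral>\<^sup>+t\<in>{0..T}. ennreal ((H t \<omega>)\<^sup>2) \<partial>lborel) \<partial>M"
  shows "N \<in> borel_measurable M"
    and "integrable M (\<lambda>\<omega>. state_price l T \<omega> * N \<omega>)"
    and "expectation (\<lambda>\<omega>. state_price l T \<omega> * N \<omega>) = 0"
    and "(\<integral>\<^sup>+\<omega>. ennreal ((N \<omega>)\<^sup>2) \<partial>M) \<le> (8 + 2 * ennreal (l\<^sup>2 * T)) * A"
proof -
  let ?H = "\<lambda>n \<tau> \<xi> k t \<omega>. simple_process (n k) (\<tau> k) (\<xi> k) t \<omega> - H t \<omega>"
  from ito have "\<exists>n \<tau> \<xi>. (\<forall>k. simple_data M F (n k) (\<tau> k) (\<xi> k)) \<and>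
      (\<lambda>k::nat. \<integral>\<^sup>+\<omega>. (\<integral>\<^sup>+t\<in>{0..T}. ennreal ((?H n \<tau> \<xi> k t \<omega>)\<^sup>2) \<partial>lborel) \<partial>M) \<longlonglongrightarrow> 0 \<and>
      (\<forall>t\<in>{0..T}. (\<lambda>k. \<integral>\<^sup>+\<omega>. ennreal ((simple_ito_integral W (n k) (\<tau> k) (\<xi> k) t \<omega> - I t \<omega>)\<^sup>2) \<partial>M) \<longlonglongrightarrow> 0)"
    using s(3) unfolding is_ito_integral_def by blast
  then obtain n \<tau> \<xi> where sd: "\<And>k. simple_data M F (n k) (\<tau> k) (\<xi> k)"
    and Q: "(\<lambda>k::nat. \<integral>\<^sup>+\<omega>. (\<integral>\<^sup>+t\<in>{0..T}. ennreal ((?H n \<tau> \<xi> k t \<omega>)\<^sup>2) \<partial>lborel) \<partial>M) \<longlonglongrightarrow> 0"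
    and "\<forall>t\<in>{0..T}. (\<lambda>k. \<integral>\<^sup>+\<omega>. ennreal ((simple_ito_integral W (n k) (\<tau> k) (\<xi> k) t \<omega> - I t \<omega>)\<^sup>2) \<partial>M) \<longlonglongrightarrow> 0"
    by (elim exE conjE) blast
  then have e: "(\<lambda>k. \<integral>\<^sup>+\<omega>. ennreal ((simple_ito_integral W (n k) (\<tau> k) (\<xi> k) s \<omega> - I s \<omega>)\<^sup>2) \<partial>M) \<longlonglongrightarrow> 0"
    using s by simp
  note D = simple_dataD[OF sd]
  define Hk where "Hk k = simple_process (n k) (\<tau> k) (\<xi> k)" for k
  define S where "S k = simple_ito_integral W (n k) (\<tau> k) (\<xi> k) s" for k
  define J where "J \<omega> = (LINT t:{0..s}|lborel. H t \<omega>)" for \<omega>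
  define Jk where "Jk k \<omega> = (LINT t:{0..s}|lborel. Hk k t \<omega>)" for k \<omega>
  define q where "q k \<omega> = (\<integral>\<^sup>+t\<in>{0..T}. ennreal ((Hk k t \<omega> - H t \<omega>)\<^sup>2) \<partial>lborel)" for k \<omega>
  define a where "a \<omega> = (\<integral>\<^sup>+t\<in>{0..T}. ennreal ((H t \<omega>)\<^sup>2) \<partial>lborel)" for \<omega>
  note Q' = Q[folded Hk_def, folded q_def] and e' = e[folded S_def]
  have A_def': "A = (\<integral>\<^sup>+\<omega>. a \<omega> \<partial>M)" unfolding A_def a_def ..
  have jHk: "jointly_measurable M (Hk k)" for k
    unfolding Hk_def by (rule jointly_measurable_simple_process) (use D in auto)
  have [measurable]: "I s \<in> borel_measurable M"
    using ito s measurable_F_M by (auto simp: is_ito_integral_def adapted_def)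
  have [measurable]: "S k \<in> borel_measurable M" for k
    unfolding S_def by (rule simple_ito_measurable[OF sd s(1)])
  have [measurable]: "J \<in> borel_measurable M" "Jk k \<in> borel_measurable M" for k
    unfolding J_def Jk_def by (auto intro!: jointly_measurable_set_integral jH jHk)
  have [measurable]: "q k \<in> borel_measurable M" for k
    unfolding q_def by (rule jointly_measurable_nn_integral[OF jointly_measurable_diff[OF jHk jH]]) auto
  have [measurable]: "a \<in> borel_measurable M"
    unfolding a_def by (rule jointly_measurable_nn_integral[OF jH]) auto
  have [measurable]: "state_price l T \<in> borel_measurable M"
    using s by (intro state_price_measurable) simp
  have N: "N = (\<lambda>\<omega>. I s \<omega> + l * J \<omega>)" unfolding N_def J_def ..
  show mN: "N \<in> borel_measurable M" unfolding N by measurable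
  have "AE \<omega> in M. a \<omega> \<noteq> \<infinity>"
    using H2 unfolding a_def[symmetric] by (intro nn_integral_PInf_AE) auto
  \<comment> \<open>On these paths the time integral of \<open>H\<close> is genuine. Elsewhere it
    may be the default value 0, and the difference of two integrals need not be the integral of the
    difference.\<close>
  then have fin: "AE \<omega> in M. set_integrable lborel {0..s} (\<lambda>t. H t \<omega>)"
    using AE_space
  proof eventually_elim
    case (elim \<omega>)
    have "(\<integral>\<^sup>+t\<in>{0..s}. ennreal ((H t \<omega>)\<^sup>2) \<partial>lborel) \<le> a \<omega>"
      unfolding a_def by (rule nn_integral_indicator_mono[OF s(2)])
    also have "\<dots> < \<infinity>" using elim by (simp add: less_top)
    finally show ?case
      by (rule set_integrable_of_square[OF jointly_measurable_section[OF jH elim(2)]])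
  qed
  have dJ: "AE \<omega> in M. ennreal ((Jk k \<omega> - J \<omega>)\<^sup>2) \<le> ennreal T * q k \<omega>" for k
    using fin AE_space
  proof eventually_elim
    case (elim \<omega>)
    have "Jk k \<omega> - J \<omega> = (LINT t:{0..s}|lborel. Hk k t \<omega> - H t \<omega>)"
      unfolding Jk_def J_def Hk_def
      using set_integral_simple_process(1)[OF D(1,2) s(1)] elim(1) by (subst set_integral_diff) auto
    then have "ennreal ((Jk k \<omega> - J \<omega>)\<^sup>2) \<le> ennreal s * (\<integral>\<^sup>+t\<in>{0..s}. ennreal ((Hk k t \<omega> - H t \<omega>)\<^sup>2) \<partial>lborel)"
      using set_integral_square_le[OF s(1) jointly_measurable_section[OF jointly_measurable_diff[OF jHk jH] elim(2)]]
      by simp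
    also have "\<dots> \<le> ennreal T * q k \<omega>"
      unfolding q_def using s by (intro mult_mono ennreal_leI nn_integral_indicator_mono) auto
    finally show ?case .
  qed
  have J2: "AE \<omega> in M. ennreal ((J \<omega>)\<^sup>2) \<le> ennreal T * a \<omega>"
  proof (rule AE_I2)
    fix \<omega> assume \<omega>: "\<omega> \<in> space M"
    have "ennreal ((J \<omega>)\<^sup>2) \<le> ennreal s * (\<integral>\<^sup>+t\<in>{0..s}. ennreal ((H t \<omega>)\<^sup>2) \<partial>lborel)"
      unfolding J_def by (rule set_integral_square_le[OF s(1) jointly_measurable_section[OF jH \<omega>]])
    also have "\<dots> \<le> ennreal T * a \<omega>"
      unfolding a_def using s by (intro mult_mono ennreal_leI nn_integral_indicator_mono) auto
    finally show "ennreal ((J \<omega>)\<^sup>2) \<le> ennreal T * a \<omega>" .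
  qed
  define g where "g k \<omega> = S k \<omega> + l * Jk k \<omega>" for k \<omega>
  have [measurable]: "g k \<in> borel_measurable M" for k unfolding g_def by measurable
  have S2: "integrable M (\<lambda>\<omega>. (S k \<omega>)\<^sup>2)" for k
    using simple_ito_square[OF sd s(1)] unfolding S_def by (auto simp: has_bochner_integral_iff)
  have Jk2: "integrable M (\<lambda>\<omega>. (Jk k \<omega>)\<^sup>2)" for k
  proof (rule Bochner_Integration.integrable_bound)
    let ?B = "\<lambda>\<omega>. s * (\<Sum>i<n k. (\<xi> k i \<omega>)\<^sup>2 * (min (\<tau> k (Suc i)) s - min (\<tau> k i) s))"
    show "integrable M ?B" using D(6) by auto
    have nn: "0 \<le> ?B \<omega>" for \<omega>
      using s D(2)[of k] by (intro mult_nonneg_nonneg sum_nonneg) (auto simp: min_def)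
    show "AE \<omega> in M. norm ((Jk k \<omega>)\<^sup>2) \<le> norm (?B \<omega>)"
    proof (rule AE_I2)
      fix \<omega> assume \<omega>: "\<omega> \<in> space M"
      have "ennreal ((Jk k \<omega>)\<^sup>2) \<le> ennreal s * (\<integral>\<^sup>+t\<in>{0..s}. ennreal ((Hk k t \<omega>)\<^sup>2) \<partial>lborel)"
        unfolding Jk_def by (rule set_integral_square_le[OF s(1) jointly_measurable_section[OF jHk \<omega>]])
      also have "\<dots> = ennreal (?B \<omega>)"
        unfolding Hk_def nn_integral_simple_process_square[OF D(1,2) s(1)]
        using s by (simp add: ennreal_mult')
      finally show "norm ((Jk k \<omega>)\<^sup>2) \<le> norm (?B \<omega>)"
        using nn[of \<omega>] by (simp add: ennreal_le_iff)
    qed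
  qed measurable
  have g2: "integrable M (\<lambda>\<omega>. (g k \<omega>)\<^sup>2)" for k
    unfolding g_def using S2 Jk2 by (intro integrable_square_add) (auto simp: power_mult_distrib)
  have "(\<lambda>k. 2 * (\<integral>\<^sup>+\<omega>. ennreal ((S k \<omega> - I s \<omega>)\<^sup>2) \<partial>M) + 2 * ennreal (l\<^sup>2 * T) * (\<integral>\<^sup>+\<omega>. q k \<omega> \<partial>M)) \<longlonglongrightarrow>
     2 * 0 + 2 * ennreal (l\<^sup>2 * T) * 0"
    using Q' e' by (intro tendsto_add ennreal_tendsto_cmult) (auto simp: ennreal_mult_less_top)
  then have lim0: "(\<lambda>k. 2 * (\<integral>\<^sup>+\<omega>. ennreal ((S k \<omega> - I s \<omega>)\<^sup>2) \<partial>M) + 2 * ennreal (l\<^sup>2 * T) * (\<integral>\<^sup>+\<omega>. q k \<omega> \<partial>M)) \<longlonglongrightarrow> 0"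
    by simp
  have le: "(\<integral>\<^sup>+\<omega>. ennreal ((g k \<omega> - N \<omega>)\<^sup>2) \<partial>M) \<le>
     2 * (\<integral>\<^sup>+\<omega>. ennreal ((S k \<omega> - I s \<omega>)\<^sup>2) \<partial>M) + 2 * ennreal (l\<^sup>2 * T) * (\<integral>\<^sup>+\<omega>. q k \<omega> \<partial>M)" for k
  proof -
    have "(\<integral>\<^sup>+\<omega>. ennreal ((g k \<omega> - N \<omega>)\<^sup>2) \<partial>M) \<le>
      (\<integral>\<^sup>+\<omega>. 2 * ennreal ((S k \<omega> - I s \<omega>)\<^sup>2) + 2 * ennreal (l\<^sup>2 * T) * q k \<omega> \<partial>M)"
    proof (rule nn_integral_mono_AE, use dJ[of k] in eventually_elim)
      case (elim \<omega>)
      have eq: "g k \<omega> - N \<omega> = (S k \<omega> - I s \<omega>) + l * (Jk k \<omega> - J \<omega>)"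
        unfolding g_def N by (simp add: algebra_simps)
      have "ennreal ((g k \<omega> - N \<omega>)\<^sup>2) \<le> 2 * ennreal ((S k \<omega> - I s \<omega>)\<^sup>2) + 2 * ennreal ((l * (Jk k \<omega> - J \<omega>))\<^sup>2)"
        unfolding eq by (rule ennreal_square_add_le)
      also have "ennreal ((l * (Jk k \<omega> - J \<omega>))\<^sup>2) = ennreal (l\<^sup>2) * ennreal ((Jk k \<omega> - J \<omega>)\<^sup>2)"
        by (simp add: power_mult_distrib ennreal_mult)
      also have "2 * (ennreal (l\<^sup>2) * ennreal ((Jk k \<omega> - J \<omega>)\<^sup>2)) \<le> 2 * (ennreal (l\<^sup>2) * (ennreal T * q k \<omega>))"
        using elim by (intro mult_left_mono) auto
      also have "\<dots> = 2 * ennreal (l\<^sup>2 * T) * q k \<omega>"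
        using s by (simp add: ennreal_mult mult.assoc)
      finally show ?case by (simp add: add_left_mono)
    qed
    then show ?thesis by (simp add: nn_integral_add nn_integral_cmult)
  qed
  have lim: "(\<lambda>k. \<integral>\<^sup>+\<omega>. ennreal ((g k \<omega> - N \<omega>)\<^sup>2) \<partial>M) \<longlonglongrightarrow> 0"
    by (rule tendsto_sandwich[OF _ _ tendsto_const lim0]) (auto simp: le)
  have orth: "expectation (\<lambda>\<omega>. state_price l T \<omega> * g k \<omega>) = 0" for k
    using state_price_simple[OF sd s(1,2)] unfolding g_def S_def Jk_def Hk_def by (auto simp: has_bochner_integral_iff)
  have sp2: "integrable M (\<lambda>\<omega>. (state_price l T \<omega>)\<^sup>2)"
    using s by (intro state_price_integrable) simp
  show "integrable M (\<lambda>\<omega>. state_price l T \<omega> * N \<omega>)" "expectation (\<lambda>\<omega>. state_price l T \<omega> * N \<omega>) = 0"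
    using L2_limit_orthogonal(2,3)[OF _ mN _ sp2 g2 lim orth] by auto
  \<comment> \<open>The isometry holds for \<open>S k\<close>. Splitting \<open>I s\<close> as
    \<open>(I s - S k) + S k\<close>, and likewise \<open>Hk k\<close> as
    \<open>(Hk k - H) + H\<close>, transfers it to the limit at the price of a factor 2 each
    time.\<close>
  have I2: "(\<integral>\<^sup>+\<omega>. ennreal ((I s \<omega>)\<^sup>2) \<partial>M) \<le> 4 * A"
  proof -
    have "(\<integral>\<^sup>+\<omega>. ennreal ((I s \<omega>)\<^sup>2) \<partial>M) \<le>
      2 * (\<integral>\<^sup>+\<omega>. ennreal ((S k \<omega> - I s \<omega>)\<^sup>2) \<partial>M) + 4 * (\<integral>\<^sup>+\<omega>. q k \<omega> \<partial>M) + 4 * A" for k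
    proof -
      have "(\<integral>\<^sup>+\<omega>. ennreal ((I s \<omega>)\<^sup>2) \<partial>M) \<le>
         (\<integral>\<^sup>+\<omega>. 2 * ennreal ((S k \<omega> - I s \<omega>)\<^sup>2) + 2 * ennreal ((S k \<omega>)\<^sup>2) \<partial>M)"
      proof (rule nn_integral_mono)
        fix \<omega>
        show "ennreal ((I s \<omega>)\<^sup>2) \<le> 2 * ennreal ((S k \<omega> - I s \<omega>)\<^sup>2) + 2 * ennreal ((S k \<omega>)\<^sup>2)"
          using ennreal_square_add_le[of "I s \<omega> - S k \<omega>" "S k \<omega>"] by (simp add: power2_commute)
      qed
      also have "\<dots> = 2 * (\<integral>\<^sup>+\<omega>. ennreal ((S k \<omega> - I s \<omega>)\<^sup>2) \<partial>M) + 2 * (\<integral>\<^sup>+\<omega>. ennreal ((S k \<omega>)\<^sup>2) \<partial>M)"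
        by (simp add: nn_integral_add nn_integral_cmult)
      also have "(\<integral>\<^sup>+\<omega>. ennreal ((S k \<omega>)\<^sup>2) \<partial>M) \<le> (\<integral>\<^sup>+\<omega>. 2 * q k \<omega> + 2 * a \<omega> \<partial>M)"
        unfolding S_def simple_ito_isometry[OF sd s(1)]
      proof (rule nn_integral_mono, fold Hk_def)
        fix \<omega> assume \<omega>: "\<omega> \<in> space M"
        note [measurable] = jointly_measurable_section[OF jointly_measurable_diff[OF jHk jH] \<omega>, of T k]
          jointly_measurable_section[OF jH \<omega>, of T]
        have "(\<integral>\<^sup>+t\<in>{0..s}. ennreal ((Hk k t \<omega>)\<^sup>2) \<partial>lborel) \<le> (\<integral>\<^sup>+t\<in>{0..T}. ennreal ((Hk k t \<omega>)\<^sup>2) \<partial>lborel)"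
          by (rule nn_integral_indicator_mono[OF s(2)])
        also have "\<dots> \<le> (\<integral>\<^sup>+t. 2 * ennreal ((indicator {0..T} t * (Hk k t \<omega> - H t \<omega>))\<^sup>2) + 2 * ennreal ((indicator {0..T} t * H t \<omega>)\<^sup>2) \<partial>lborel)"
        proof (rule nn_integral_mono)
          fix t
          show "ennreal ((Hk k t \<omega>)\<^sup>2) * indicator {0..T} t \<le>
            2 * ennreal ((indicator {0..T} t * (Hk k t \<omega> - H t \<omega>))\<^sup>2) + 2 * ennreal ((indicator {0..T} t * H t \<omega>)\<^sup>2)"
            using ennreal_square_add_le[of "Hk k t \<omega> - H t \<omega>" "H t \<omega>"] by (auto simp: indicator_def)
        qed
        also have "\<dots> = 2 * (\<integral>\<^sup>+t. ennreal ((indicator {0..T} t * (Hk k t \<omega> - H t \<omega>))\<^sup>2) \<partial>lborel) +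
            2 * (\<integral>\<^sup>+t. ennreal ((indicator {0..T} t * H t \<omega>)\<^sup>2) \<partial>lborel)"
          by (simp add: nn_integral_add nn_integral_cmult)
        also have "(\<integral>\<^sup>+t. ennreal ((indicator {0..T} t * (Hk k t \<omega> - H t \<omega>))\<^sup>2) \<partial>lborel) = q k \<omega>"
          unfolding q_def by (intro nn_integral_cong) (auto simp: indicator_def)
        also have "(\<integral>\<^sup>+t. ennreal ((indicator {0..T} t * H t \<omega>)\<^sup>2) \<partial>lborel) = a \<omega>"
          unfolding a_def by (intro nn_integral_cong) (auto simp: indicator_def)
        finally show "(\<integral>\<^sup>+t\<in>{0..s}. ennreal ((Hk k t \<omega>)\<^sup>2) \<partial>lborel) \<le> 2 * q k \<omega> + 2 * a \<omega>" .
      qed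
      also have "\<dots> = 2 * (\<integral>\<^sup>+\<omega>. q k \<omega> \<partial>M) + 2 * A"
        unfolding A_def' by (simp add: nn_integral_add nn_integral_cmult)
      finally have "(\<integral>\<^sup>+\<omega>. ennreal ((I s \<omega>)\<^sup>2) \<partial>M) \<le>
        2 * (\<integral>\<^sup>+\<omega>. ennreal ((S k \<omega> - I s \<omega>)\<^sup>2) \<partial>M) + 2 * (2 * (\<integral>\<^sup>+\<omega>. q k \<omega> \<partial>M) + 2 * A)"
        by (simp add: add_left_mono mult_left_mono)
      then show ?thesis by (simp add: distrib_left add.assoc mult.assoc[symmetric])
    qed
    moreover have "(\<lambda>k. 2 * (\<integral>\<^sup>+\<omega>. ennreal ((S k \<omega> - I s \<omega>)\<^sup>2) \<partial>M) + 4 * (\<integral>\<^sup>+\<omega>. q k \<omega> \<partial>M) + 4 * A) \<longlonglongrightarrow> 2 * 0 + 4 * 0 + 4 * A"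
      using Q' e' by (intro tendsto_add ennreal_tendsto_cmult tendsto_const) auto
    ultimately have "(\<integral>\<^sup>+\<omega>. ennreal ((I s \<omega>)\<^sup>2) \<partial>M) \<le> 2 * 0 + 4 * 0 + 4 * A"
      by (intro tendsto_lowerbound[where F=sequentially]) auto
    then show ?thesis by simp
  qed
  have "(\<integral>\<^sup>+\<omega>. ennreal ((N \<omega>)\<^sup>2) \<partial>M) \<le> (\<integral>\<^sup>+\<omega>. 2 * ennreal ((I s \<omega>)\<^sup>2) + 2 * ennreal (l\<^sup>2 * T) * a \<omega> \<partial>M)"
  proof (rule nn_integral_mono_AE, use J2 in eventually_elim)
    case (elim \<omega>)
    have "ennreal ((N \<omega>)\<^sup>2) \<le> 2 * ennreal ((I s \<omega>)\<^sup>2) + 2 * ennreal ((l * J \<omega>)\<^sup>2)"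
      unfolding N by (rule ennreal_square_add_le)
    also have "ennreal ((l * J \<omega>)\<^sup>2) = ennreal (l\<^sup>2) * ennreal ((J \<omega>)\<^sup>2)"
      by (simp add: power_mult_distrib ennreal_mult)
    also have "2 * (ennreal (l\<^sup>2) * ennreal ((J \<omega>)\<^sup>2)) \<le> 2 * (ennreal (l\<^sup>2) * (ennreal T * a \<omega>))"
      using elim by (intro mult_left_mono) auto
    also have "\<dots> = 2 * ennreal (l\<^sup>2 * T) * a \<omega>"
      using s by (simp add: ennreal_mult mult.assoc)
    finally show ?case by (simp add: add_left_mono)
  qed
  also have "\<dots> = 2 * (\<integral>\<^sup>+\<omega>. ennreal ((I s \<omega>)\<^sup>2) \<partial>M) + 2 * ennreal (l\<^sup>2 * T) * A"
    unfolding A_def' by (simp add: nn_integral_add nn_integral_cmult)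
  also have "\<dots> \<le> 2 * (4 * A) + 2 * ennreal (l\<^sup>2 * T) * A"
    by (intro add_mono mult_left_mono I2) auto
  also have "\<dots> = (8 + 2 * ennreal (l\<^sup>2 * T)) * A"
    by (simp add: distrib_right mult.assoc[symmetric])
  finally show "(\<integral>\<^sup>+\<omega>. ennreal ((N \<omega>)\<^sup>2) \<partial>M) \<le> (8 + 2 * ennreal (l\<^sup>2 * T)) * A" .
qed

end

subsection \<open>The budget constraint\<close>

text \<open>Rounding time down to multiples of \<open>1 / Suc n\<close> leaves countably many values
  of the time argument, hence a jointly measurable approximation; continuity of the paths gives
  pointwise convergence.\<close>

lemma jointly_measurable_continuous:
  fixes Z :: "real \<Rightarrow> 'a \<Rightarrow> real"
  assumes meas: "\<And>t. Z t \<in> borel_measurable M"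
    and cont: "\<And>\<omega>. \<omega> \<in> space M \<Longrightarrow> continuous_on UNIV (\<lambda>t. Z t \<omega>)"
  shows "(\<lambda>(\<omega>, t). Z t \<omega>) \<in> borel_measurable (M \<Otimes>\<^sub>M borel)"
proof -
  define u where "u n x = Z (real_of_int \<lfloor>real (Suc n) * snd x\<rfloor> / real (Suc n)) (fst x)" for n and x :: "'a \<times> real"
  show ?thesis
  proof (rule borel_measurable_LIMSEQ_real)
    fix n
    have 1: "(\<lambda>x. Z (real_of_int i / real (Suc n)) (fst x)) \<in> borel_measurable (M \<Otimes>\<^sub>M borel)" for i :: int
      using meas by measurable
    have 2: "(\<lambda>x. \<lfloor>real (Suc n) * snd x\<rfloor>) \<in> (M \<Otimes>\<^sub>M borel) \<rightarrow>\<^sub>M count_space UNIV"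
      by measurable
    show "u n \<in> borel_measurable (M \<Otimes>\<^sub>M borel)"
      unfolding u_def
      using measurable_compose_countable[where f="\<lambda>i x. Z (real_of_int i / real (Suc n)) (fst x)", OF 1 2] by simp
  next
    fix x assume "x \<in> space (M \<Otimes>\<^sub>M (borel :: real measure))"
    then obtain \<omega> t where x: "x = (\<omega>, t)" "\<omega> \<in> space M" by (auto simp: space_pair_measure)
    have "(\<lambda>n. real_of_int \<lfloor>real (Suc n) * t\<rfloor> / real (Suc n)) \<longlonglongrightarrow> t"
    proof (rule tendsto_sandwich)
      show "\<forall>\<^sub>F n in sequentially. t - 1 / real (Suc n) \<le> real_of_int \<lfloor>real (Suc n) * t\<rfloor> / real (Suc n)"
      proof (rule always_eventually, rule allI)
        fix n
        have "real (Suc n) * t - 1 \<le> real_of_int \<lfloor>real (Suc n) * t\<rfloor>" by linarith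
        then have "(real (Suc n) * t - 1) / real (Suc n) \<le> real_of_int \<lfloor>real (Suc n) * t\<rfloor> / real (Suc n)"
          by (intro divide_right_mono) auto
        then show "t - 1 / real (Suc n) \<le> real_of_int \<lfloor>real (Suc n) * t\<rfloor> / real (Suc n)"
          by (simp add: diff_divide_distrib)
      qed
      show "\<forall>\<^sub>F n in sequentially. real_of_int \<lfloor>real (Suc n) * t\<rfloor> / real (Suc n) \<le> t"
      proof (rule always_eventually, rule allI)
        fix n
        have "real_of_int \<lfloor>real (Suc n) * t\<rfloor> / real (Suc n) \<le> (real (Suc n) * t) / real (Suc n)"
          by (intro divide_right_mono) auto
        then show "real_of_int \<lfloor>real (Suc n) * t\<rfloor> / real (Suc n) \<le> t" by simp
      qed
      show "(\<lambda>n. t - 1 / real (Suc n)) \<longlonglongrightarrow> t"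
        using tendsto_diff[OF tendsto_const LIMSEQ_inverse_real_of_nat, of t]
        by (simp add: inverse_eq_divide)
    qed simp
    moreover have "isCont (\<lambda>t. Z t \<omega>) t"
      using cont[OF x(2)] by (simp add: continuous_on_eq_continuous_at)
    ultimately show "(\<lambda>n. u n x) \<longlonglongrightarrow> (case x of (\<omega>, t) \<Rightarrow> Z t \<omega>)"
      unfolding u_def x by (auto intro: isCont_tendsto_compose)
  qed
qed

text \<open>Gronwall's inequality in integral form; consumption is simply dropped under the integral,
  since only its sign matters there.\<close>

lemma wealth_path_bound:
  fixes X N C :: "real \<Rightarrow> real"
  assumes T: "0 \<le> T" and X: "continuous_on {0..T} X" and N: "continuous_on {0..T} N"
    and X0: "\<And>t. t \<in> {0..T} \<Longrightarrow> 0 \<le> X t" and C0: "\<And>t. t \<in> {0..T} \<Longrightarrow> 0 \<le> C t"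
    and eq: "\<And>t. t \<in> {0..T} \<Longrightarrow> X t = x + r * (LINT s:{0..t}|lborel. X s) + N t - C t"
  defines "R \<equiv> max r 0"
  shows "C T \<le> x + N T + R * exp (R * T) * (LINT s:{0..T}|lborel. exp (- R * s) * (x + N s))"
proof -
  define U where "U t = integral {0..t} X" for t
  have LU: "(LINT s:{0..t}|lborel. X s) = U t" if "t \<in> {0..T}" for t
    unfolding U_def using that
    by (intro set_borel_integral_eq_integral(2) borel_integrable_atLeastAtMost')
       (auto intro: continuous_on_subset[OF X])
  have U0: "0 \<le> U t" if "t \<in> {0..T}" for t
    unfolding U_def using that X0
    by (intro integral_nonneg integrable_continuous_real continuous_on_subset[OF X]) auto
  \<comment> \<open>Integrated wealth is nonnegative, so passing from \<open>r\<close> to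
    \<open>R = max r 0\<close> only enlarges the drift. The sign of \<open>R\<close> is needed when
    the final inequality is multiplied by \<open>R * exp (R * T)\<close>.\<close>
  have rR: "r * U t \<le> R * U t" if "t \<in> {0..T}" for t
    using U0[OF that] by (intro mult_right_mono) (auto simp: R_def)
  have dU: "(U has_real_derivative X t) (at t within {0..T})" if "t \<in> {0..T}" for t
    unfolding U_def has_real_derivative_iff_has_vector_derivative
    by (rule integral_has_vector_derivative[OF X that])
  let ?g = "\<lambda>s. exp (- R * s) * (x + N s)"
  \<comment> \<open>Integrating factor: this derivative will be bounded by \<open>?g\<close>, in
    which wealth no longer occurs.\<close>
  have "((\<lambda>t. exp (- R * t) * U t) has_real_derivative exp (- R * t) * (X t - R * U t)) (at t within {0..T})"
    if "t \<in> {0..T}" for t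
    by (rule derivative_eq_intros dU[OF that] refl | simp)+ (simp add: algebra_simps)
  then have I: "((\<lambda>t. exp (- R * t) * (X t - R * U t)) has_integral (exp (- R * T) * U T - exp (- R * 0) * U 0)) {0..T}"
    by (intro fundamental_theorem_of_calculus T)
       (simp add: has_real_derivative_iff_has_vector_derivative[symmetric])
  have cg: "continuous_on {0..T} ?g" by (intro continuous_intros N)
  have "exp (- R * T) * U T - exp (- R * 0) * U 0 \<le> integral {0..T} ?g"
  proof (rule has_integral_le[OF I integrable_integral[OF integrable_continuous_real[OF cg]]])
    fix t assume t: "t \<in> {0..T}"
    have "X t \<le> x + R * U t + N t"
      using eq[OF t] LU[OF t] rR[OF t] C0[OF t] by simp
    then show "exp (- R * t) * (X t - R * U t) \<le> ?g t" by (intro mult_left_mono) auto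
  qed
  moreover have "U 0 = 0" by (simp add: U_def)
  moreover have "(LINT s:{0..T}|lborel. ?g s) = integral {0..T} ?g"
    by (intro set_borel_integral_eq_integral(2) borel_integrable_atLeastAtMost' cg)
  ultimately have "exp (- R * T) * U T \<le> (LINT s:{0..T}|lborel. ?g s)" by simp
  then have "R * exp (R * T) * (exp (- R * T) * U T) \<le> R * exp (R * T) * (LINT s:{0..T}|lborel. ?g s)"
    by (intro mult_left_mono) (auto simp: R_def)
  moreover have "R * exp (R * T) * (exp (- R * T) * U T) = R * U T"
    by (simp add: exp_minus)
  \<comment> \<open>Terminal wealth is nonnegative, which turns the wealth equation at
    \<open>T\<close> into an upper bound for \<open>C T\<close>.\<close>
  moreover have "0 \<le> x + r * U T + N T - C T"
    using eq[of T] X0[of T] LU[of T] T by simp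
  moreover have "r * U T \<le> R * U T" using rR T by simp
  ultimately show ?thesis by linarith
qed

context brownian
begin

text \<open>The pathwise bound of \<open>wealth_path_bound\<close> is linear in \<open>N\<close>.
  Multiplied by the density it can be integrated term by term: every term with \<open>N\<close> has
  expectation 0, the density has expectation 1, and what remains of the initial wealth collapses to
  \<open>x * exp (R * T)\<close> with \<open>R = max r 0\<close>.\<close>

lemma budget_constraint:
  assumes adm: "(c, \<pi>) \<in> admissible M F W r \<sigma> l x" and x: "0 < x" and T: "0 < T"
  shows "(\<integral>\<^sup>+\<omega>. ennreal (state_price l T \<omega>) * (\<integral>\<^sup>+s\<in>{0..T}. ennreal (c s \<omega>) \<partial>lborel) \<partial>M)
     \<le> ennreal (x * exp (max r 0 * T))"
proof -
  from adm obtain X I where c: "c \<in> L1_loc_nonneg M F" and \<pi>: "\<pi> \<in> L2_loc M F"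
    and Xc: "continuous_paths M X" and ito: "is_ito_integral M F W (\<lambda>t \<omega>. \<sigma> * \<pi> t \<omega>) I"
    and eq: "AE \<omega> in M. \<forall>t\<ge>0.
           X t \<omega> = x + (LINT s:{0..t}|lborel. r * X s \<omega> + \<sigma> * l * \<pi> s \<omega>) + I t \<omega>
                     - (LINT s:{0..t}|lborel. c s \<omega>)"
    and X0: "AE \<omega> in M. \<forall>t\<ge>0. 0 \<le> X t \<omega>"
    unfolding admissible_def wealth_process_def by auto
  define H where "H t \<omega> = \<sigma> * \<pi> t \<omega>" for t \<omega>
  note ito = ito[folded H_def]
  have jc: "jointly_measurable M c" and c0: "\<And>t \<omega>. 0 \<le> t \<Longrightarrow> \<omega> \<in> space M \<Longrightarrow> 0 \<le> c t \<omega>"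
    and c1: "(\<integral>\<^sup>+\<omega>. (\<integral>\<^sup>+t\<in>{0..T}. ennreal \<bar>c t \<omega>\<bar> \<partial>lborel) \<partial>M) < \<infinity>"
    using c T by (auto simp: L1_loc_nonneg_def)
  have j\<pi>: "jointly_measurable M \<pi>"
    and \<pi>2: "(\<integral>\<^sup>+\<omega>. (\<integral>\<^sup>+t\<in>{0..T}. ennreal (\<bar>\<pi> t \<omega>\<bar>\<^sup>2) \<partial>lborel) \<partial>M) < \<infinity>"
    using \<pi> T by (auto simp: L2_loc_def)
  have jH: "jointly_measurable M H"
    using j\<pi> unfolding H_def jointly_measurable_def split_beta by measurable
  have in\<pi>: "(\<lambda>\<omega>. \<integral>\<^sup>+t\<in>{0..T}. ennreal (\<bar>\<pi> t \<omega>\<bar>\<^sup>2) \<partial>lborel) \<in> borel_measurable M"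
    using jointly_measurable_nn_integral[OF j\<pi>, of "\<lambda>x. \<bar>x\<bar>\<^sup>2" T] by simp
  have inH: "(\<integral>\<^sup>+t\<in>{0..T}. ennreal ((H t \<omega>)\<^sup>2) \<partial>lborel) = ennreal (\<sigma>\<^sup>2) * (\<integral>\<^sup>+t\<in>{0..T}. ennreal (\<bar>\<pi> t \<omega>\<bar>\<^sup>2) \<partial>lborel)"
    if "\<omega> \<in> space M" for \<omega>
  proof -
    note [measurable] = jointly_measurable_section[OF j\<pi> that, of T]
    have "(\<integral>\<^sup>+t\<in>{0..T}. ennreal ((H t \<omega>)\<^sup>2) \<partial>lborel) = (\<integral>\<^sup>+t. ennreal (\<sigma>\<^sup>2) * ennreal ((indicator {0..T} t * \<pi> t \<omega>)\<^sup>2) \<partial>lborel)"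
      by (intro nn_integral_cong) (auto simp: indicator_def H_def power_mult_distrib ennreal_mult)
    also have "\<dots> = ennreal (\<sigma>\<^sup>2) * (\<integral>\<^sup>+t. ennreal ((indicator {0..T} t * \<pi> t \<omega>)\<^sup>2) \<partial>lborel)"
      by (intro nn_integral_cmult) measurable
    also have "(\<integral>\<^sup>+t. ennreal ((indicator {0..T} t * \<pi> t \<omega>)\<^sup>2) \<partial>lborel) = (\<integral>\<^sup>+t\<in>{0..T}. ennreal (\<bar>\<pi> t \<omega>\<bar>\<^sup>2) \<partial>lborel)"
      by (intro nn_integral_cong) (auto simp: indicator_def)
    finally show ?thesis .
  qed
  have H2: "(\<integral>\<^sup>+\<omega>. (\<integral>\<^sup>+t\<in>{0..T}. ennreal ((H t \<omega>)\<^sup>2) \<partial>lborel) \<partial>M) < \<infinity>"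
    using \<pi>2 in\<pi> by (simp add: inH nn_integral_cmult ennreal_mult_less_top cong: nn_integral_cong)
  define N where "N t \<omega> = I t \<omega> + l * (LINT s:{0..t}|lborel. H s \<omega>)" for t \<omega>
  note NI = ito_integral_state_price[OF jH H2 ito _ _ T, of _ l, folded N_def]
  have "AE \<omega> in M. (\<integral>\<^sup>+t\<in>{0..T}. ennreal (\<bar>\<pi> t \<omega>\<bar>\<^sup>2) \<partial>lborel) \<noteq> \<infinity>"
    using \<pi>2 in\<pi> by (intro nn_integral_PInf_AE) auto
  moreover have "AE \<omega> in M. (\<integral>\<^sup>+t\<in>{0..T}. ennreal \<bar>c t \<omega>\<bar> \<partial>lborel) \<noteq> \<infinity>"
    using c1 jointly_measurable_nn_integral[OF jc, of "\<lambda>x. \<bar>x\<bar>" T] by (intro nn_integral_PInf_AE) auto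
  moreover have "AE \<omega> in M. continuous_on {0..} (\<lambda>t. I t \<omega>)" "AE \<omega> in M. continuous_on {0..} (\<lambda>t. X t \<omega>)"
    using ito Xc by (auto simp: is_ito_integral_def continuous_paths_def)
  \<comment> \<open>All that holds on almost every path: integrability and continuity, and the
    wealth equation with the interest term split off and the risky gains gathered in
    \<open>N\<close>.\<close>
  ultimately have good: "AE \<omega> in M. \<omega> \<in> space M \<and> set_integrable lborel {0..T} (\<lambda>t. c t \<omega>) \<and>
     continuous_on {0..T} (\<lambda>t. N t \<omega>) \<and> continuous_on {0..T} (\<lambda>t. X t \<omega>) \<and>
     (\<forall>t\<in>{0..T}. X t \<omega> = x + r * (LINT s:{0..t}|lborel. X s \<omega>) + N t \<omega> - (LINT s:{0..t}|lborel. c s \<omega>))"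
    using eq AE_space
  proof eventually_elim
    case (elim \<omega>)
    have i\<pi>: "set_integrable lborel {0..T} (\<lambda>t. \<pi> t \<omega>)"
      using elim(1) by (intro set_integrable_of_square jointly_measurable_section[OF j\<pi>] elim) (simp add: less_top)
    have ic: "set_integrable lborel {0..T} (\<lambda>t. c t \<omega>)"
      unfolding set_integrable_def
    proof (rule integrableI_bounded)
      show "(\<lambda>t. indicator {0..T} t *\<^sub>R c t \<omega>) \<in> borel_measurable lborel"
        using jointly_measurable_section[OF jc elim(6), of T] by simp
      have "(\<integral>\<^sup>+t. norm (indicator {0..T} t *\<^sub>R c t \<omega>) \<partial>lborel) = (\<integral>\<^sup>+t\<in>{0..T}. ennreal \<bar>c t \<omega>\<bar> \<partial>lborel)"
        by (intro nn_integral_cong) (auto simp: indicator_def)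
      then show "(\<integral>\<^sup>+t. norm (indicator {0..T} t *\<^sub>R c t \<omega>) \<partial>lborel) < \<infinity>"
        using elim(2) by (simp add: less_top)
    qed
    have cX: "continuous_on {0..T} (\<lambda>t. X t \<omega>)"
      using elim(4) by (rule continuous_on_subset) auto
    have iH: "set_integrable lborel {0..T} (\<lambda>t. H t \<omega>)"
      using i\<pi> unfolding H_def by simp
    have "continuous_on {0..T} (\<lambda>t. integral {0..t} (\<lambda>s. H s \<omega>))"
      by (intro indefinite_integral_continuous_1 set_borel_integral_eq_integral(1) iH)
    moreover have "integral {0..t} (\<lambda>s. H s \<omega>) = (LINT s:{0..t}|lborel. H s \<omega>)" if "t \<in> {0..T}" for t
      using that by (intro sym[OF set_borel_integral_eq_integral(2)] set_integrable_subset[OF iH]) auto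
    ultimately have "continuous_on {0..T} (\<lambda>t. LINT s:{0..t}|lborel. H s \<omega>)"
      by (rule continuous_on_eq)
    moreover have "continuous_on {0..T} (\<lambda>t. I t \<omega>)"
      using elim(3) by (rule continuous_on_subset) auto
    ultimately have cN: "continuous_on {0..T} (\<lambda>t. N t \<omega>)"
      unfolding N_def by (intro continuous_intros)
    have "X t \<omega> = x + r * (LINT s:{0..t}|lborel. X s \<omega>) + N t \<omega> - (LINT s:{0..t}|lborel. c s \<omega>)" if t: "t \<in> {0..T}" for t
    proof -
      have "set_integrable lborel {0..t} (\<lambda>s. X s \<omega>)"
        using t by (intro borel_integrable_atLeastAtMost' continuous_on_subset[OF cX]) auto
      moreover have "set_integrable lborel {0..t} (\<lambda>s. H s \<omega>)"
        using t by (intro set_integrable_subset[OF iH]) auto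
      ultimately have "(LINT s:{0..t}|lborel. r * X s \<omega> + l * H s \<omega>) = r * (LINT s:{0..t}|lborel. X s \<omega>) + l * (LINT s:{0..t}|lborel. H s \<omega>)"
        by (subst set_integral_add) auto
      moreover have "(\<lambda>s. r * X s \<omega> + l * H s \<omega>) = (\<lambda>s. r * X s \<omega> + \<sigma> * l * \<pi> s \<omega>)"
        by (simp add: H_def ac_simps)
      ultimately show ?thesis
        using elim(5) t unfolding N_def by simp
    qed
    then show ?case using elim(6) ic cX cN by blast
  qed
  define R where "R = max r 0"
  have R0: "0 \<le> R" by (simp add: R_def)
  obtain N0 where N0: "N0 \<in> null_sets M" and N0c: "\<And>\<omega>. \<omega> \<in> space M \<Longrightarrow> \<omega> \<notin> N0 \<Longrightarrow> continuous_on {0..T} (\<lambda>t. N t \<omega>)"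
    using good by (auto elim!: AE_E3 simp: eventually_conj_iff)
  \<comment> \<open>A version of \<open>N\<close> with all paths continuous, constant in time
    outside \<open>{0..T}\<close>. This gives joint measurability without exceptional paths.\<close>
  define N' where "N' t \<omega> = (if \<omega> \<in> N0 then 0 else N (max 0 (min T t)) \<omega>)" for t \<omega>
  have N0s[measurable]: "N0 \<in> sets M" using N0 by auto
  have N'm: "N' t \<in> borel_measurable M" for t
  proof -
    have "0 \<le> max 0 (min T t)" "max 0 (min T t) \<le> T" using T by auto
    from NI(1)[OF this] have "N (max 0 (min T t)) \<in> borel_measurable M" .
    then show ?thesis unfolding N'_def by (intro measurable_If_set) auto
  qed
  have "continuous_on UNIV (\<lambda>t. N' t \<omega>)" if "\<omega> \<in> space M" for \<omega>
  proof (cases "\<omega> \<in> N0")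
    case False
    have "continuous_on UNIV ((\<lambda>t. N t \<omega>) \<circ> (\<lambda>t. max 0 (min T t)))"
      using T by (intro continuous_on_compose continuous_on_subset[OF N0c[OF that False]] continuous_intros) auto
    then show ?thesis using False by (simp add: N'_def comp_def)
  qed (simp add: N'_def)
  note [measurable] = jointly_measurable_continuous[of N', OF N'm this]
  define L where "L = state_price l T"
  have [measurable]: "L \<in> borel_measurable M" unfolding L_def using T by (intro state_price_measurable) simp
  have L0: "0 < L \<omega>" for \<omega> unfolding L_def by (rule state_price_pos)
  have N'N: "AE \<omega> in M. N' t \<omega> = N t \<omega>" if "t \<in> {0..T}" for t
    using AE_not_in[OF N0] by eventually_elim (use that in \<open>auto simp: N'_def\<close>)
  define f where "f \<omega> s = indicator {0..T} s * (exp (- R * s) * (L \<omega> * N' s \<omega>))" for \<omega> s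
  have fm[measurable]: "case_prod f \<in> borel_measurable (M \<Otimes>\<^sub>M lborel)"
    unfolding f_def split_beta by measurable
  interpret P: pair_sigma_finite M lborel ..
  \<comment> \<open>Bounds the expectation of
    \<open>\<bar>L * N s\<bar> \<le> L\<^sup>2 + (N s)\<^sup>2\<close> uniformly in
    \<open>s\<close>, so the integrand is integrable over paths and times together.\<close>
  define K where "K = (\<integral>\<^sup>+\<omega>. ennreal ((L \<omega>)\<^sup>2) \<partial>M) + (8 + 2 * ennreal (l\<^sup>2 * T)) * (\<integral>\<^sup>+\<omega>. (\<integral>\<^sup>+t\<in>{0..T}. ennreal ((H t \<omega>)\<^sup>2) \<partial>lborel) \<partial>M)"
  have "(\<integral>\<^sup>+\<omega>. ennreal ((L \<omega>)\<^sup>2) \<partial>M) < top"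
    unfolding L_def using T state_price_integrable(3)[of T l] by (subst nn_integral_eq_integral) auto
  then have K: "K < top" using H2 by (auto simp: K_def ennreal_mult_less_top)
  have fint: "integrable (M \<Otimes>\<^sub>M lborel) (case_prod f)"
  proof (rule integrableI_bounded)
    have "(\<integral>\<^sup>+z. norm (case_prod f z) \<partial>(M \<Otimes>\<^sub>M lborel)) = (\<integral>\<^sup>+s. (\<integral>\<^sup>+\<omega>. norm (f \<omega> s) \<partial>M) \<partial>lborel)"
      by (subst P.nn_integral_snd[symmetric]) auto
    also have "\<dots> \<le> (\<integral>\<^sup>+s. K * indicator {0..T} s \<partial>lborel)"
    proof (rule nn_integral_mono)
      fix s
      show "(\<integral>\<^sup>+\<omega>. norm (f \<omega> s) \<partial>M) \<le> K * indicator {0..T} s"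
      proof (cases "s \<in> {0..T}")
        case True
        have "(\<integral>\<^sup>+\<omega>. norm (f \<omega> s) \<partial>M) \<le> (\<integral>\<^sup>+\<omega>. ennreal ((L \<omega>)\<^sup>2) + ennreal ((N s \<omega>)\<^sup>2) \<partial>M)"
        proof (rule nn_integral_mono_AE, use N'N[OF True] in eventually_elim)
          case (elim \<omega>)
          have "norm (f \<omega> s) = exp (- R * s) * \<bar>L \<omega> * N s \<omega>\<bar>"
            using True elim by (simp add: f_def abs_mult)
          also have "\<dots> \<le> 1 * \<bar>L \<omega> * N s \<omega>\<bar>"
            using R0 True by (intro mult_right_mono) auto
          also have "\<dots> \<le> (L \<omega>)\<^sup>2 + (N s \<omega>)\<^sup>2"
            using sum_squares_bound[of "\<bar>L \<omega>\<bar>" "\<bar>N s \<omega>\<bar>"] mult_nonneg_nonneg[of "\<bar>L \<omega>\<bar>" "\<bar>N s \<omega>\<bar>"]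
            unfolding abs_mult power2_abs by linarith
          finally have "ennreal (norm (f \<omega> s)) \<le> ennreal ((L \<omega>)\<^sup>2 + (N s \<omega>)\<^sup>2)" by (rule ennreal_leI)
          then show ?case by (simp add: ennreal_plus)
        qed
        also have "\<dots> = (\<integral>\<^sup>+\<omega>. ennreal ((L \<omega>)\<^sup>2) \<partial>M) + (\<integral>\<^sup>+\<omega>. ennreal ((N s \<omega>)\<^sup>2) \<partial>M)"
          using NI(1)[of s] True by (intro nn_integral_add) auto
        also have "\<dots> \<le> K"
          unfolding K_def using NI(4)[of s] True by (intro add_left_mono) auto
        finally show ?thesis using True by simp
      next
        case False
        then show ?thesis by (simp add: f_def)
      qed
    qed
    also have "\<dots> = K * ennreal T"
      using T by (subst nn_integral_cmult) auto
    also have "\<dots> < \<infinity>" using K by (simp add: ennreal_mult_less_top)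
    finally show "(\<integral>\<^sup>+z. norm (case_prod f z) \<partial>(M \<Otimes>\<^sub>M lborel)) < \<infinity>" .
  qed simp
  have f0: "(\<integral>\<omega>. f \<omega> s \<partial>M) = 0" for s
  proof (cases "s \<in> {0..T}")
    case True
    have "(\<integral>\<omega>. f \<omega> s \<partial>M) = exp (- R * s) * (\<integral>\<omega>. L \<omega> * N' s \<omega> \<partial>M)"
      using True by (simp add: f_def)
    also have "(\<integral>\<omega>. L \<omega> * N' s \<omega> \<partial>M) = (\<integral>\<omega>. L \<omega> * N s \<omega> \<partial>M)"
      using N'N[OF True] N'm NI(1)[of s] True by (intro integral_cong_AE) auto
    also have "\<dots> = 0" using NI(3)[of s] True by (simp add: L_def)
    finally show ?thesis by simp
  qed (simp add: f_def)
  have fE: "integrable M (\<lambda>\<omega>. \<integral>s. f \<omega> s \<partial>lborel)" "(\<integral>\<omega>. (\<integral>s. f \<omega> s \<partial>lborel) \<partial>M) = 0"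
    using P.integrable_fst[OF fint] P.Fubini_integral[OF fint] f0 by auto
  define e where "e = (LINT s:{0..T}|lborel. exp (- R * s))"
  have ce: "continuous_on {0..T} (\<lambda>s. exp (- R * s))" by (intro continuous_intros)
  have ie: "set_integrable lborel {0..T} (\<lambda>s. exp (- R * s))"
    by (intro borel_integrable_atLeastAtMost' ce)
  \<comment> \<open>Stated for the product, so that no division by \<open>R\<close> occurs;
    \<open>R\<close> is 0 when \<open>r \<le> 0\<close>.\<close>
  have Re: "R * e = 1 - exp (- R * T)"
  proof -
    have "((\<lambda>s. R * exp (- R * s)) has_integral (- exp (- R * T) - (- exp (- R * 0)))) {0..T}"
      using T by (intro fundamental_theorem_of_calculus)
        (auto simp: has_real_derivative_iff_has_vector_derivative[symmetric] intro!: derivative_eq_intros)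
    then have "integral {0..T} (\<lambda>s. R * exp (- R * s)) = - exp (- R * T) - (- exp (- R * 0))"
      by (rule integral_unique)
    moreover have "R * e = integral {0..T} (\<lambda>s. R * exp (- R * s))"
      using set_borel_integral_eq_integral(2)[OF ie] unfolding e_def by simp
    ultimately show ?thesis by simp
  qed
  \<comment> \<open>The pathwise bound for \<open>C T\<close> times \<open>L\<close>, arranged so
    that each term has a known expectation. It bounds a nonnegative quantity almost surely, so its
    nonnegative integral is its expectation.\<close>
  define B where "B \<omega> = x * L \<omega> + L \<omega> * N T \<omega> + R * exp (R * T) * (x * e * L \<omega> + (\<integral>s. f \<omega> s \<partial>lborel))" for \<omega>
  have LI: "integrable M L" "expectation L = 1"
    unfolding L_def using state_price_integrable[of T l] T by auto
  have LN: "integrable M (\<lambda>\<omega>. L \<omega> * N T \<omega>)" "expectation (\<lambda>\<omega>. L \<omega> * N T \<omega>) = 0"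
    unfolding L_def using NI(2,3)[of T] T by auto
  have "integrable M B" unfolding B_def using LI LN fE by auto
  have "expectation B = x + R * exp (R * T) * (x * e)"
    unfolding B_def using LI LN fE by simp
  also have "\<dots> = x + x * exp (R * T) * (R * e)" by simp
  also have "\<dots> = x * exp (R * T)"
    unfolding Re by (simp add: algebra_simps mult_exp_exp)
  finally have EB: "expectation B = x * exp (R * T)" .
  have AEB: "AE \<omega> in M. ennreal (L \<omega>) * (\<integral>\<^sup>+s\<in>{0..T}. ennreal (c s \<omega>) \<partial>lborel) \<le> ennreal (B \<omega>) \<and> 0 \<le> B \<omega>"
    using good X0 AE_not_in[OF N0]
  proof eventually_elim
    case (elim \<omega>)
    then have \<omega>: "\<omega> \<in> space M" and ic: "set_integrable lborel {0..T} (\<lambda>t. c t \<omega>)"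
      and cN: "continuous_on {0..T} (\<lambda>t. N t \<omega>)" and cX: "continuous_on {0..T} (\<lambda>t. X t \<omega>)"
      and eq: "\<And>t. t\<in>{0..T} \<Longrightarrow> X t \<omega> = x + r * (LINT s:{0..t}|lborel. X s \<omega>) + N t \<omega> - (LINT s:{0..t}|lborel. c s \<omega>)"
      by auto
    define C where "C t = (LINT s:{0..t}|lborel. c s \<omega>)" for t
    have C0: "0 \<le> C t" for t
      unfolding C_def set_lebesgue_integral_def using c0[OF _ \<omega>] by (intro integral_nonneg_AE AE_I2) (auto simp: indicator_def)
    have "C T \<le> x + N T \<omega> + max r 0 * exp (max r 0 * T) * (LINT s:{0..T}|lborel. exp (- max r 0 * s) * (x + N s \<omega>))"
      using T cX cN elim(2) C0 eq by (intro wealth_path_bound[where X="\<lambda>t. X t \<omega>"]) (auto simp: C_def)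
    then have CT: "C T \<le> x + N T \<omega> + R * exp (R * T) * (LINT s:{0..T}|lborel. exp (- R * s) * (x + N s \<omega>))"
      by (simp add: R_def)
    have iN: "set_integrable lborel {0..T} (\<lambda>s. exp (- R * s) * N s \<omega>)"
      by (intro borel_integrable_atLeastAtMost' continuous_intros cN)
    have "(LINT s:{0..T}|lborel. exp (- R * s) * (x + N s \<omega>)) = (LINT s:{0..T}|lborel. x * exp (- R * s) + exp (- R * s) * N s \<omega>)"
      by (simp add: algebra_simps)
    also have "\<dots> = x * e + (LINT s:{0..T}|lborel. exp (- R * s) * N s \<omega>)"
      using ie iN unfolding e_def by (subst set_integral_add) auto
    finally have 1: "(LINT s:{0..T}|lborel. exp (- R * s) * (x + N s \<omega>)) = x * e + (LINT s:{0..T}|lborel. exp (- R * s) * N s \<omega>)" .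
    have "(\<integral>s. f \<omega> s \<partial>lborel) = (\<integral>s. L \<omega> * (indicator {0..T} s *\<^sub>R (exp (- R * s) * N s \<omega>)) \<partial>lborel)"
      using elim(3) unfolding f_def by (intro Bochner_Integration.integral_cong) (auto simp: N'_def indicator_def)
    also have "\<dots> = L \<omega> * (LINT s:{0..T}|lborel. exp (- R * s) * N s \<omega>)"
      unfolding set_lebesgue_integral_def by (rule integral_mult_right_zero)
    finally have 2: "(\<integral>s. f \<omega> s \<partial>lborel) = L \<omega> * (LINT s:{0..T}|lborel. exp (- R * s) * N s \<omega>)" .
    have "L \<omega> * C T \<le> L \<omega> * (x + N T \<omega> + R * exp (R * T) * (x * e + (LINT s:{0..T}|lborel. exp (- R * s) * N s \<omega>)))"
      using CT L0[of \<omega>] unfolding 1 by (intro mult_left_mono) auto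
    also have "\<dots> = B \<omega>" unfolding B_def 2 by (simp add: algebra_simps)
    finally have LB: "L \<omega> * C T \<le> B \<omega>" .
    have "(\<integral>\<^sup>+s\<in>{0..T}. ennreal (c s \<omega>) \<partial>lborel) = (\<integral>\<^sup>+s. ennreal (indicator {0..T} s *\<^sub>R c s \<omega>) \<partial>lborel)"
      by (intro nn_integral_cong) (auto simp: indicator_def)
    also have "\<dots> = ennreal (C T)"
      unfolding C_def set_lebesgue_integral_def using ic c0[OF _ \<omega>] unfolding set_integrable_def
      by (intro nn_integral_eq_integral) (auto simp: indicator_def)
    finally have "ennreal (L \<omega>) * (\<integral>\<^sup>+s\<in>{0..T}. ennreal (c s \<omega>) \<partial>lborel) = ennreal (L \<omega> * C T)"
      using L0[of \<omega>] C0[of T] by (simp add: ennreal_mult)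
    moreover have "0 \<le> L \<omega> * C T" using L0[of \<omega>] C0[of T] by simp
    ultimately show ?case using LB by (auto intro: ennreal_leI)
  qed
  have "(\<integral>\<^sup>+\<omega>. ennreal (L \<omega>) * (\<integral>\<^sup>+s\<in>{0..T}. ennreal (c s \<omega>) \<partial>lborel) \<partial>M) \<le> (\<integral>\<^sup>+\<omega>. ennreal (B \<omega>) \<partial>M)"
    using AEB by (intro nn_integral_mono_AE) auto
  also have "\<dots> = ennreal (expectation B)"
    using AEB \<open>integrable M B\<close> by (intro nn_integral_eq_integral) auto
  finally show ?thesis unfolding EB by (simp add: L_def R_def)
qed

end

subsection \<open>The upper bound\<close>

text \<open>The negated utility integrand with values in \<open>ennreal\<close>. The change of sign
  and the value at zero consumption are settled here once, and the objective becomes minus an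
  ordinary nonnegative integral.\<close>

definition disutility :: "real \<Rightarrow> real \<Rightarrow> real \<Rightarrow> real \<Rightarrow> ennreal" where
  "disutility \<rho> \<gamma> s y = e2ennreal (- (ereal (exp (- \<rho> * s)) * crra_utility \<gamma> y))"

lemma disutility_zero: "disutility \<rho> \<gamma> s 0 = \<infinity>"
  by (simp add: disutility_def crra_utility_def)

lemma disutility_nonzero:
  assumes "y \<noteq> 0"
  shows "disutility \<rho> \<gamma> s y = ennreal (exp (- \<rho> * s) * (y powr (1 - \<gamma>) / (\<gamma> - 1)))"
proof -
  have "- (ereal (exp (- \<rho> * s)) * crra_utility \<gamma> y) = ereal (exp (- \<rho> * s) * (y powr (1 - \<gamma>) / (\<gamma> - 1)))"
    using assms minus_divide_right[of "exp (- \<rho> * s) * y powr (1 - \<gamma>)" "1 - \<gamma>"]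
    by (simp add: crra_utility_def)
  then show ?thesis unfolding disutility_def by (simp only: e2ennreal_ereal)
qed

lemma disutility_measurable:
  "(\<lambda>(s, y). disutility \<rho> \<gamma> s y) \<in> borel_measurable (borel \<Otimes>\<^sub>M borel)"
proof -
  have "(\<lambda>z. if snd z = 0 then \<infinity> else ennreal (exp (- \<rho> * fst z) * (snd z powr (1 - \<gamma>) / (\<gamma> - 1))))
     \<in> borel_measurable (borel \<Otimes>\<^sub>M (borel :: real measure))"
    by measurable
  moreover have "(\<lambda>z. if snd z = 0 then \<infinity> else ennreal (exp (- \<rho> * fst z) * (snd z powr (1 - \<gamma>) / (\<gamma> - 1)))) = (\<lambda>(s, y). disutility \<rho> \<gamma> s y)"
    by (auto simp: fun_eq_iff disutility_zero disutility_nonzero)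
  ultimately show ?thesis by simp
qed

lemma jointly_measurable_disutility:
  assumes "jointly_measurable M c"
  shows "(\<lambda>z. disutility \<rho> \<gamma> (snd z) (c (max 0 (snd z)) (fst z))) \<in> borel_measurable (M \<Otimes>\<^sub>M borel)"
proof -
  have "(\<lambda>z. (snd z, c (max 0 (snd z)) (fst z))) \<in> (M \<Otimes>\<^sub>M borel) \<rightarrow>\<^sub>M (borel \<Otimes>\<^sub>M borel)"
    using jointly_measurable_clip[OF assms] by (simp add: split_beta)
  from measurable_compose[OF this disutility_measurable[of \<rho> \<gamma>]] show ?thesis by simp
qed

lemma objective_disutility:
  "objective M \<rho> \<gamma> c = - enn2ereal (\<integral>\<^sup>+\<omega>. (\<integral>\<^sup>+s\<in>{0..}. disutility \<rho> \<gamma> s (c s \<omega>) \<partial>lborel) \<partial>M)"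
  by (simp add: objective_def disutility_def)

text \<open>Young's inequality with exponents \<open>p\<close> and \<open>q = 1 / \<gamma>\<close>
  for \<open>y * L * c\<close> and \<open>y powr (1 - \<gamma>) * v * c powr (1 - \<gamma>)\<close>,
  where \<open>v\<close> is the discount factor. Since \<open>(1 - \<gamma>) * q = - p\<close>, both
  \<open>c\<close> and the weight \<open>y\<close> cancel from the geometric mean. The weight stays
  free in order to make the budget term small later.\<close>

lemma young_disutility:
  assumes \<gamma>: "\<gamma> > 1" and y: "y > 0" and L: "L > 0" and c: "c \<ge> 0" and s: "0 \<le> s" "s \<le> 1"
  defines "p \<equiv> (\<gamma> - 1) / \<gamma>"
  shows "ennreal (L powr p * exp (- \<bar>\<rho>\<bar>)) \<le> ennreal (p * y) * ennreal (L * c) + ennreal (p * y powr (1 - \<gamma>)) * disutility \<rho> \<gamma> s c"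
\<comment> \<open>With zero consumption the right-hand side is infinite, as the disutility has a
  positive coefficient.\<close>
proof (cases "c = 0")
  case True
  have "p * y powr (1 - \<gamma>) > 0" "p \<noteq> 0" "y \<noteq> 0" using \<gamma> y by (auto simp: p_def)
  then show ?thesis using True by (simp add: disutility_zero ennreal_mult_top)
next
  case False
  with c have c: "c > 0" by simp
  define v where "v = exp (- \<rho> * s)"
  define q where "q = 1 / \<gamma>"
  have pq: "0 < p" "0 < q" "p + q = 1" using \<gamma> by (auto simp: p_def q_def field_simps)
  have pq2: "p = q * (\<gamma> - 1)" by (simp add: p_def q_def)
  \<comment> \<open>Both \<open>q\<close> and \<open>s\<close> lie in the unit interval, which
    bounds the discount factor from below whatever the sign of \<open>\<rho>\<close>.\<close>
  have "- \<bar>\<rho>\<bar> \<le> q * (- \<rho> * s)"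
  proof -
    have "\<bar>q * (- \<rho> * s)\<bar> = (q * s) * \<bar>\<rho>\<bar>" using pq s by (simp add: abs_mult)
    also have "\<dots> \<le> 1 * \<bar>\<rho>\<bar>" using pq s by (intro mult_right_mono mult_le_one) auto
    finally show ?thesis by simp
  qed
  then have v: "exp (- \<bar>\<rho>\<bar>) \<le> v powr q" by (simp add: v_def powr_def)
  have "(y * L * c) powr p * (y powr (1 - \<gamma>) * v * c powr (1 - \<gamma>)) powr q =
     (y powr p * y powr ((1 - \<gamma>) * q)) * L powr p * v powr q * (c powr p * c powr ((1 - \<gamma>) * q))"
    using y L c by (simp add: powr_mult powr_powr v_def algebra_simps)
  also have "(1 - \<gamma>) * q = - p" using pq2 by (simp add: algebra_simps)
  also have "(y powr p * y powr (- p)) * L powr p * v powr q * (c powr p * c powr (- p)) = L powr p * v powr q"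
    using y c by (simp add: powr_add[symmetric])
  finally have eq: "(y * L * c) powr p * (y powr (1 - \<gamma>) * v * c powr (1 - \<gamma>)) powr q = L powr p * v powr q" .
  have "L powr p * exp (- \<bar>\<rho>\<bar>) \<le> L powr p * v powr q"
    using v by (intro mult_left_mono) auto
  also have "\<dots> \<le> p * (y * L * c) + q * (y powr (1 - \<gamma>) * v * c powr (1 - \<gamma>))"
    unfolding eq[symmetric] using pq y L c by (intro Youngs_inequality_0) (auto simp: v_def)
  \<comment> \<open>Here \<open>q = p / (\<gamma> - 1)\<close> supplies the denominator of the
    utility function.\<close>
  also have "q * (y powr (1 - \<gamma>) * v * c powr (1 - \<gamma>)) = p * y powr (1 - \<gamma>) * (v * (c powr (1 - \<gamma>) / (\<gamma> - 1)))"
    using \<gamma> by (simp add: pq2)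
  finally have "ennreal (L powr p * exp (- \<bar>\<rho>\<bar>)) \<le> ennreal (p * y * (L * c) + p * y powr (1 - \<gamma>) * (v * (c powr (1 - \<gamma>) / (\<gamma> - 1))))"
    by (intro ennreal_leI) (simp add: mult.assoc)
  also have "\<dots> = ennreal (p * y) * ennreal (L * c) + ennreal (p * y powr (1 - \<gamma>)) * ennreal (v * (c powr (1 - \<gamma>) / (\<gamma> - 1)))"
  proof -
    have "0 \<le> p * y" "0 \<le> L * c" "0 \<le> p * y powr (1 - \<gamma>)" "0 \<le> v * (c powr (1 - \<gamma>) / (\<gamma> - 1))"
      using pq y L c \<gamma> by (auto simp: v_def)
    then show ?thesis by (simp only: ennreal_plus ennreal_mult mult_nonneg_nonneg)
  qed
  finally show ?thesis using c by (simp add: disutility_nonzero v_def)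
qed

context brownian
begin

text \<open>Integrating \<open>young_disutility\<close> over paths and unit time gives a positive
  constant on the left and, on the right, the budget term plus a multiple of the disutility. The
  budget term is bounded for all strategies at once, so a fixed amount of disutility is
  unavoidable.\<close>

lemma objective_upper_bound:
  assumes \<gamma>: "\<gamma> > 1"
  shows "\<exists>K>0. \<forall>(c, \<pi>)\<in>admissible M F W r \<sigma> l 1. objective M \<rho> \<gamma> c \<le> ereal (- K)"
proof -
  define p where "p = (\<gamma> - 1) / \<gamma>"
  have p: "0 < p" "p < 1" using \<gamma> by (auto simp: p_def)
  define L where "L = state_price l 1"
  have Lm[measurable]: "L \<in> borel_measurable M" unfolding L_def by (rule state_price_measurable) simp
  have L0: "0 < L \<omega>" for \<omega> unfolding L_def by (rule state_price_pos)
  \<comment> \<open>The expectation of \<open>L powr p * exp (- \<bar>\<rho>\<bar>)\<close>: the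
    first factor is the exponential moment of \<open>- l * p * W 1\<close>, the second collects the
    deterministic exponents.\<close>
  define w where "w = exp ((- l * p)\<^sup>2 * 1 / 2) * exp (- p * l\<^sup>2 / 2 - \<bar>\<rho>\<bar>)"
  define K0 where "K0 = exp (max r 0 * 1)"
  \<comment> \<open>With this weight the budget term \<open>p * y * K0\<close> is at most
    \<open>w / 2\<close>, because \<open>p < 1\<close>; the other half of \<open>w\<close> is left
    for the disutility.\<close>
  define y where "y = w / (2 * K0)"
  define k where "k = p * y powr (1 - \<gamma>)"
  have pos: "w > 0" "K0 > 0" "y > 0" "k > 0" using p by (auto simp: w_def K0_def y_def k_def)
  have "has_bochner_integral M (\<lambda>\<omega>. exp (- l * p * W 1 \<omega>) * exp (- p * l\<^sup>2 / 2 - \<bar>\<rho>\<bar>)) w"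
    unfolding w_def by (intro has_bochner_integral_mult_left exp_W) simp
  moreover have "exp (- l * p * W 1 \<omega>) * exp (- p * l\<^sup>2 / 2 - \<bar>\<rho>\<bar>) = L \<omega> powr p * exp (- \<bar>\<rho>\<bar>)" for \<omega>
    by (simp add: L_def state_price_def powr_def mult_exp_exp algebra_simps)
  ultimately have "has_bochner_integral M (\<lambda>\<omega>. L \<omega> powr p * exp (- \<bar>\<rho>\<bar>)) w"
    by (simp only:)
  then have w: "(\<integral>\<^sup>+\<omega>. ennreal (L \<omega> powr p * exp (- \<bar>\<rho>\<bar>)) \<partial>M) = ennreal w"
    by (subst nn_integral_eq_integral) (auto simp: has_bochner_integral_iff)
  have "objective M \<rho> \<gamma> c \<le> ereal (- (w / 2 / k))" if adm: "(c, \<pi>) \<in> admissible M F W r \<sigma> l 1" for c \<pi>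
  proof -
    have jc: "jointly_measurable M c" and c0: "\<And>t \<omega>. 0 \<le> t \<Longrightarrow> \<omega> \<in> space M \<Longrightarrow> 0 \<le> c t \<omega>"
      using adm by (auto simp: admissible_def L1_loc_nonneg_def)
    note [measurable] = jointly_measurable_clip[OF jc]
    define A where "A \<omega> s = ennreal (L \<omega> * c (max 0 s) \<omega>) * indicator {0..1} s" for \<omega> s
    define B where "B \<omega> s = disutility \<rho> \<gamma> s (c (max 0 s) \<omega>) * indicator {0..1} s" for \<omega> s
    define O1 where "O1 = (\<integral>\<^sup>+\<omega>. (\<integral>\<^sup>+s\<in>{0..}. disutility \<rho> \<gamma> s (c s \<omega>) \<partial>lborel) \<partial>M)"
    have cm: "(\<lambda>z. c (max 0 (snd z)) (fst z)) \<in> borel_measurable (M \<Otimes>\<^sub>M borel)"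
      using jointly_measurable_clip[OF jc] by (simp add: split_beta)
    have Am: "(\<lambda>(\<omega>, s). A \<omega> s) \<in> borel_measurable (M \<Otimes>\<^sub>M borel)"
      using cm unfolding A_def split_beta by measurable
    have Bm: "(\<lambda>(\<omega>, s). B \<omega> s) \<in> borel_measurable (M \<Otimes>\<^sub>M borel)"
      using jointly_measurable_disutility[OF jc, of \<rho> \<gamma>] unfolding B_def split_beta by measurable
    have Am2: "A \<omega> \<in> borel_measurable borel" and Bm2: "B \<omega> \<in> borel_measurable borel" if "\<omega> \<in> space M" for \<omega>
      using measurable_compose[OF measurable_Pair1'[OF that] Am] measurable_compose[OF measurable_Pair1'[OF that] Bm] by auto
    have Am3: "(\<lambda>\<omega>. \<integral>\<^sup>+s. A \<omega> s \<partial>lborel) \<in> borel_measurable M" and Bm3: "(\<lambda>\<omega>. \<integral>\<^sup>+s. B \<omega> s \<partial>lborel) \<in> borel_measurable M"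
      using Am Bm by (auto intro!: lborel.borel_measurable_nn_integral)
    have iA: "(\<integral>\<^sup>+\<omega>. (\<integral>\<^sup>+s. A \<omega> s \<partial>lborel) \<partial>M) \<le> ennreal K0"
    proof -
      have "(\<integral>\<^sup>+\<omega>. (\<integral>\<^sup>+s. A \<omega> s \<partial>lborel) \<partial>M) = (\<integral>\<^sup>+\<omega>. ennreal (L \<omega>) * (\<integral>\<^sup>+s\<in>{0..1}. ennreal (c s \<omega>) \<partial>lborel) \<partial>M)"
      proof (rule nn_integral_cong)
        fix \<omega> assume \<omega>: "\<omega> \<in> space M"
        have [measurable]: "(\<lambda>s. c (max 0 s) \<omega>) \<in> borel_measurable borel"
          using measurable_compose[OF measurable_Pair1'[OF \<omega>] cm] by simp
        have "(\<integral>\<^sup>+s. A \<omega> s \<partial>lborel) = (\<integral>\<^sup>+s. ennreal (L \<omega>) * (ennreal (c (max 0 s) \<omega>) * indicator {0..1} s) \<partial>lborel)"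
          unfolding A_def using L0[of \<omega>] c0[OF _ \<omega>] by (intro nn_integral_cong) (auto simp: ennreal_mult mult.assoc)
        also have "\<dots> = ennreal (L \<omega>) * (\<integral>\<^sup>+s. (ennreal (c (max 0 s) \<omega>) * indicator {0..1} s) \<partial>lborel)"
          by (intro nn_integral_cmult) measurable
        also have "(\<integral>\<^sup>+s. (ennreal (c (max 0 s) \<omega>) * indicator {0..1} s) \<partial>lborel) = (\<integral>\<^sup>+s\<in>{0..1}. ennreal (c s \<omega>) \<partial>lborel)"
          by (intro nn_integral_cong) (auto simp: indicator_def)
        finally show "(\<integral>\<^sup>+s. A \<omega> s \<partial>lborel) = ennreal (L \<omega>) * (\<integral>\<^sup>+s\<in>{0..1}. ennreal (c s \<omega>) \<partial>lborel)" .
      qed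
      also have "\<dots> \<le> ennreal K0"
        using budget_constraint[OF adm, of 1] by (simp add: L_def K0_def)
      finally show ?thesis .
    qed
    \<comment> \<open>Disutility is nonnegative, so restricting to the unit time interval can only
      lower it.\<close>
    have iB: "(\<integral>\<^sup>+\<omega>. (\<integral>\<^sup>+s. B \<omega> s \<partial>lborel) \<partial>M) \<le> O1"
      unfolding B_def O1_def by (intro nn_integral_mono) (auto simp: indicator_def)
    have "ennreal w = (\<integral>\<^sup>+\<omega>. (\<integral>\<^sup>+s. ennreal (L \<omega> powr p * exp (- \<bar>\<rho>\<bar>)) * indicator {0..1::real} s \<partial>lborel) \<partial>M)"
      unfolding w[symmetric] by (intro nn_integral_cong) (subst nn_integral_cmult_indicator, auto)
    also have "\<dots> \<le> (\<integral>\<^sup>+\<omega>. (\<integral>\<^sup>+s. ennreal (p * y) * A \<omega> s + ennreal k * B \<omega> s \<partial>lborel) \<partial>M)"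
      using young_disutility[OF \<gamma> pos(3) L0, folded p_def, folded k_def] c0
      by (intro nn_integral_mono) (auto simp: A_def B_def indicator_def)
    also have "\<dots> = (\<integral>\<^sup>+\<omega>. ennreal (p * y) * (\<integral>\<^sup>+s. A \<omega> s \<partial>lborel) + ennreal k * (\<integral>\<^sup>+s. B \<omega> s \<partial>lborel) \<partial>M)"
      using Am2 Bm2 by (intro nn_integral_cong) (simp add: nn_integral_add nn_integral_cmult)
    also have "\<dots> = ennreal (p * y) * (\<integral>\<^sup>+\<omega>. (\<integral>\<^sup>+s. A \<omega> s \<partial>lborel) \<partial>M) + ennreal k * (\<integral>\<^sup>+\<omega>. (\<integral>\<^sup>+s. B \<omega> s \<partial>lborel) \<partial>M)"
      using Am3 Bm3 by (simp add: nn_integral_add nn_integral_cmult)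
    also have "\<dots> \<le> ennreal (p * y) * ennreal K0 + ennreal k * O1"
      by (intro add_mono mult_left_mono iA iB) auto
    finally have main: "ennreal w \<le> ennreal (p * y) * ennreal K0 + ennreal k * O1" .
    have "ennreal (w / 2 / k) \<le> O1"
    proof (cases O1)
      case (real o1)
      have "ennreal w \<le> ennreal (p * y * K0 + k * o1)"
        using main pos p real by (simp add: ennreal_plus ennreal_mult)
      then have "w \<le> p * y * K0 + k * o1"
        using pos p real by (subst (asm) ennreal_le_iff) auto
      moreover have "p * y * K0 \<le> w / 2"
      proof -
        have "p * y * K0 = p * (w / 2)" using pos by (simp add: y_def)
        also have "\<dots> \<le> 1 * (w / 2)" using pos p by (intro mult_right_mono) auto
        finally show ?thesis by simp
      qed
      ultimately have "w / 2 \<le> k * o1" by simp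
      then have "w / 2 / k \<le> o1" using pos by (simp add: field_simps)
      then show ?thesis using real by (simp add: ennreal_leI)
    qed simp
    then have "enn2ereal (ennreal (w / 2 / k)) \<le> enn2ereal O1" by (simp add: less_eq_ennreal.rep_eq)
    then have "ereal (w / 2 / k) \<le> enn2ereal O1" using pos by (simp add: enn2ereal_ennreal)
    then show ?thesis
      unfolding objective_disutility O1_def[symmetric] by (metis ereal_minus_le_minus uminus_ereal.simps(1))
  qed
  moreover have "w / 2 / k > 0" using pos by simp
  ultimately show ?thesis by blast
qed

end

subsection \<open>Geometric Brownian motion\<close>

lemma jointly_measurable_continuous_paths:
  fixes Z :: "real \<Rightarrow> 'a \<Rightarrow> real"
  assumes meas: "\<And>t. 0 \<le> t \<Longrightarrow> Z t \<in> borel_measurable M"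
    and cont: "\<And>\<omega>. \<omega> \<in> space M \<Longrightarrow> continuous_on {0..} (\<lambda>t. Z t \<omega>)"
  shows "jointly_measurable M Z"
proof -
  have "continuous_on UNIV (\<lambda>t. Z (max 0 t) \<omega>)" if "\<omega> \<in> space M" for \<omega>
  proof -
    have "continuous_on UNIV ((\<lambda>t. Z t \<omega>) \<circ> (\<lambda>t. max 0 t))"
      by (intro continuous_on_compose continuous_on_subset[OF cont[OF that]] continuous_intros) auto
    then show ?thesis by (simp add: comp_def)
  qed
  then have "(\<lambda>(\<omega>, t). Z (max 0 t) \<omega>) \<in> borel_measurable (M \<Otimes>\<^sub>M borel)"
    using meas by (intro jointly_measurable_continuous[of "\<lambda>t. Z (max 0 t)"]) auto
  moreover have "(\<lambda>x. (fst x, snd x)) \<in> (M \<Otimes>\<^sub>M restrict_space borel {0::real..}) \<rightarrow>\<^sub>M (M \<Otimes>\<^sub>M borel)"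
    by (intro measurable_Pair measurable_fst measurable_compose[OF measurable_snd] measurable_restrict_space1) simp
  ultimately have "(\<lambda>x. Z (max 0 (snd x)) (fst x)) \<in> borel_measurable (M \<Otimes>\<^sub>M restrict_space borel {0::real..})"
    using measurable_compose by fastforce
  then show ?thesis
    unfolding jointly_measurable_def
    by (rule measurable_cong[THEN iffD1, rotated]) (auto simp: space_pair_measure space_restrict_space)
qed

lemma abs_exp_diff_le:
  fixes x y :: real
  assumes "x \<le> m" "y \<le> m"
  shows "\<bar>exp x - exp y\<bar> \<le> exp m * \<bar>x - y\<bar>"
proof -
  have *: "exp u - exp v \<le> exp m * \<bar>u - v\<bar>" if "u \<le> m" for u v :: real
  proof -
    have "exp u - exp v = exp u * (1 - exp (v - u))" by (simp add: algebra_simps mult_exp_exp)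
    also have "\<dots> \<le> exp u * \<bar>u - v\<bar>"
    proof (rule mult_left_mono)
      show "1 - exp (v - u) \<le> \<bar>u - v\<bar>" using exp_ge_add_one_self[of "v - u"] by linarith
    qed simp
    also have "\<dots> \<le> exp m * \<bar>u - v\<bar>" using that by (intro mult_right_mono) auto
    finally show ?thesis .
  qed
  show ?thesis using *[of x y] *[of y x] assms by (auto simp: abs_if split: if_splits)
qed

text \<open>From \<open>exp x * (1 - x) \<le> 1\<close> the remainder is at most
  \<open>x * (exp x - 1)\<close>, and the Lipschitz bound for \<open>exp\<close> supplies the second
  factor \<open>x\<close>.\<close>

lemma exp_remainder_le:
  fixes x m :: real
  assumes "\<bar>x\<bar> \<le> m"
  shows "\<bar>exp x - 1 - x\<bar> \<le> exp m * x\<^sup>2"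
proof -
  have m0: "0 \<le> m" using assms by (rule order_trans[rotated]) simp
  have "0 \<le> exp x - 1 - x" using exp_ge_add_one_self[of x] by linarith
  have "exp x * exp (- x) = 1" by (simp add: mult_exp_exp)
  moreover have "exp x * (1 + (- x)) \<le> exp x * exp (- x)"
    by (intro mult_left_mono exp_ge_add_one_self) auto
  ultimately have "exp x - 1 - x \<le> x * (exp x - 1)"
    by (simp add: algebra_simps)
  also have "\<dots> \<le> \<bar>x\<bar> * \<bar>exp x - exp 0\<bar>"
    using abs_ge_self[of "x * (exp x - 1)"] by (simp add: abs_mult)
  also have "\<dots> \<le> \<bar>x\<bar> * (exp m * \<bar>x - 0\<bar>)"
    using assms m0 by (intro mult_left_mono abs_exp_diff_le) auto
  also have "\<dots> = exp m * x\<^sup>2" by (simp add: power2_eq_square abs_if)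
  finally show ?thesis using \<open>0 \<le> exp x - 1 - x\<close> by simp
qed

context brownian
begin

text \<open>The solution of \<open>dZ = b Z dt + a Z dW\<close> with \<open>Z\<^sub>0 = 1\<close>:
  the drift \<open>b\<close> is that of the process, and the correction \<open>a\<^sup>2 / 2\<close>
  passes to its logarithm.\<close>

definition gbm :: "real \<Rightarrow> real \<Rightarrow> real \<Rightarrow> 'a \<Rightarrow> real" where
  "gbm a b t \<omega> = exp (a * W t \<omega> + (b - a\<^sup>2 / 2) * t)"

section \<open>Moments and increments of geometric Brownian motion\<close>

lemma gbm_pos: "0 < gbm a b t \<omega>"
  by (simp add: gbm_def)

lemma gbm_zero: "\<omega> \<in> space M \<Longrightarrow> gbm a b 0 \<omega> = 1"
  by (simp add: gbm_def W_zero)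

lemma gbm_adapted: "0 \<le> t \<Longrightarrow> gbm a b t \<in> borel_measurable (F t)"
  unfolding gbm_def using W_adapted[of t] by measurable

lemma gbm_measurable: "0 \<le> t \<Longrightarrow> gbm a b t \<in> borel_measurable M"
  using gbm_adapted measurable_F_M by blast

lemma gbm_continuous: "\<omega> \<in> space M \<Longrightarrow> continuous_on {0..} (\<lambda>t. gbm a b t \<omega>)"
  unfolding gbm_def by (intro continuous_intros W_continuous)

lemma gbm_jointly_measurable: "jointly_measurable M (gbm a b)"
  by (intro jointly_measurable_continuous_paths gbm_measurable gbm_continuous)

text \<open>A power is again an exponential of \<open>W t\<close>. The formula is used with exponent
  2 for mean square estimates, 4 for truncation errors, 1 for the integrability of consumption, and
  \<open>1 - \<gamma>\<close> for the objective.\<close>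

lemma gbm_powr:
  assumes "0 \<le> t"
  shows "has_bochner_integral M (\<lambda>\<omega>. gbm a b t \<omega> powr q) (exp ((q * b + (q\<^sup>2 - q) * a\<^sup>2 / 2) * t))"
proof -
  have "has_bochner_integral M (\<lambda>\<omega>. exp (q * a * W t \<omega>) * exp (q * (b - a\<^sup>2 / 2) * t)) (exp ((q * a)\<^sup>2 * t / 2) * exp (q * (b - a\<^sup>2 / 2) * t))"
    by (intro has_bochner_integral_mult_left exp_W assms)
  moreover have "exp (q * a * W t \<omega>) * exp (q * (b - a\<^sup>2 / 2) * t) = gbm a b t \<omega> powr q" for \<omega>
    by (simp add: gbm_def powr_def mult_exp_exp algebra_simps)
  moreover have "exp ((q * a)\<^sup>2 * t / 2) * exp (q * (b - a\<^sup>2 / 2) * t) = exp ((q * b + (q\<^sup>2 - q) * a\<^sup>2 / 2) * t)"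
    unfolding mult_exp_exp by (simp add: field_simps power2_eq_square)
  ultimately show ?thesis by (simp only:)
qed

lemma gbm_square:
  assumes "0 \<le> t"
  shows "has_bochner_integral M (\<lambda>\<omega>. (gbm a b t \<omega>)\<^sup>2) (exp ((2 * b + a\<^sup>2) * t))"
  using gbm_powr[OF assms, of a b 2] by (simp add: powr_numeral[OF less_imp_le[OF gbm_pos]])

lemma gbm_fourth:
  assumes "0 \<le> t"
  shows "has_bochner_integral M (\<lambda>\<omega>. (gbm a b t \<omega>) ^ 4) (exp ((4 * b + 6 * a\<^sup>2) * t))"
  using gbm_powr[OF assms, of a b 4] by (simp add: powr_numeral[OF less_imp_le[OF gbm_pos]])

lemma gbm_step:
  "gbm a b t \<omega> = gbm a b s \<omega> * exp (a * (W t \<omega> - W s \<omega>) + (b - a\<^sup>2 / 2) * (t - s))"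
  unfolding gbm_def mult_exp_exp by (simp add: field_simps)

lemma growth_increment:
  assumes "0 \<le> s" "s \<le> t"
  shows "has_bochner_integral M (\<lambda>\<omega>. exp (a * (W t \<omega> - W s \<omega>) + (b - a\<^sup>2 / 2) * (t - s))) (exp (b * (t - s)))"
proof -
  have "has_bochner_integral M (\<lambda>\<omega>. exp (a * (W t \<omega> - W s \<omega>)) * exp ((b - a\<^sup>2 / 2) * (t - s)))
     (exp (a\<^sup>2 * (t - s) / 2) * exp ((b - a\<^sup>2 / 2) * (t - s)))"
    by (intro has_bochner_integral_mult_left exp_increment assms)
  moreover have "exp (a\<^sup>2 * (t - s) / 2) * exp ((b - a\<^sup>2 / 2) * (t - s)) = exp (b * (t - s))"
    unfolding mult_exp_exp by (simp add: field_simps)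
  ultimately show ?thesis by (simp only: exp_add)
qed

text \<open>The later value is the earlier one times an independent growth factor, which gives the
  mixed moment. The result is written as a noise part plus a drift part, so that each term shows a
  difference of exponentials that vanishes as \<open>t\<close> approaches \<open>s\<close>.\<close>

lemma gbm_diff_square:
  assumes "0 \<le> s" "s \<le> t"
  shows "has_bochner_integral M (\<lambda>\<omega>. (gbm a b t \<omega> - gbm a b s \<omega>)\<^sup>2)
    (exp (2 * b * t) * (exp (a\<^sup>2 * t) - exp (a\<^sup>2 * s)) + exp (a\<^sup>2 * s) * (exp (b * t) - exp (b * s))\<^sup>2)"
proof -
  have t: "0 \<le> t" using assms by simp
  define g where "g x = exp (a * x + (b - a\<^sup>2 / 2) * (t - s))" for x
  have gm[measurable]: "g \<in> borel_measurable borel" unfolding g_def by measurable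
  have m: "(\<lambda>\<omega>. (gbm a b s \<omega>)\<^sup>2) \<in> borel_measurable (F s)"
    using gbm_adapted[OF assms(1), of a b] by measurable
  have cross: "has_bochner_integral M (\<lambda>\<omega>. (gbm a b s \<omega>)\<^sup>2 * g (W t \<omega> - W s \<omega>)) (exp ((2 * b + a\<^sup>2) * s) * exp (b * (t - s)))"
    using expectation_mult_increment[OF assms m gm] gbm_square[OF assms(1), of a b]
      growth_increment[OF assms, of a b]
    by (auto simp: has_bochner_integral_iff g_def)
  have "has_bochner_integral M (\<lambda>\<omega>. (gbm a b t \<omega>)\<^sup>2 - 2 * ((gbm a b s \<omega>)\<^sup>2 * g (W t \<omega> - W s \<omega>)) + (gbm a b s \<omega>)\<^sup>2)
     (exp ((2 * b + a\<^sup>2) * t) - 2 * (exp ((2 * b + a\<^sup>2) * s) * exp (b * (t - s))) + exp ((2 * b + a\<^sup>2) * s))"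
    by (intro has_bochner_integral_add has_bochner_integral_diff has_bochner_integral_mult_right
        gbm_square cross assms t)
  moreover have "(gbm a b t \<omega>)\<^sup>2 - 2 * ((gbm a b s \<omega>)\<^sup>2 * g (W t \<omega> - W s \<omega>)) + (gbm a b s \<omega>)\<^sup>2 = (gbm a b t \<omega> - gbm a b s \<omega>)\<^sup>2" for \<omega>
    unfolding gbm_step[of a b t \<omega> s] g_def[symmetric] by (simp add: power2_eq_square algebra_simps)
  moreover have "exp ((2 * b + a\<^sup>2) * t) - 2 * (exp ((2 * b + a\<^sup>2) * s) * exp (b * (t - s))) + exp ((2 * b + a\<^sup>2) * s) =
    exp (2 * b * t) * (exp (a\<^sup>2 * t) - exp (a\<^sup>2 * s)) + exp (a\<^sup>2 * s) * (exp (b * t) - exp (b * s))\<^sup>2"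
  proof -
    have e1: "exp ((2 * b + a\<^sup>2) * t) = exp (a\<^sup>2 * t) * (exp (b * t))\<^sup>2"
      "exp ((2 * b + a\<^sup>2) * s) = exp (a\<^sup>2 * s) * (exp (b * s))\<^sup>2"
      "exp (2 * b * t) = (exp (b * t))\<^sup>2"
      unfolding power2_eq_square mult_exp_exp by (auto simp: algebra_simps)
    have e2: "exp ((2 * b + a\<^sup>2) * s) * exp (b * (t - s)) = exp (a\<^sup>2 * s) * exp (b * t) * exp (b * s)"
      unfolding mult_exp_exp by (auto simp: algebra_simps)
    show ?thesis unfolding e2 unfolding e1 by (simp add: power2_eq_square algebra_simps)
  qed
  ultimately show ?thesis by (simp only:)
qed

text \<open>The exponentials are Lipschitz on \<open>{0..T}\<close>. The drift part is quadratic in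
  \<open>t - s\<close>, and one of its factors is estimated by \<open>T\<close> to match the linear
  noise part.\<close>

lemma gbm_diff_square_le:
  assumes T: "0 \<le> T"
  obtains C where "0 \<le> C"
    "\<And>s t. 0 \<le> s \<Longrightarrow> s \<le> t \<Longrightarrow> t \<le> T \<Longrightarrow> expectation (\<lambda>\<omega>. (gbm a b t \<omega> - gbm a b s \<omega>)\<^sup>2) \<le> C * (t - s)"
proof -
  define B where "B = exp (\<bar>b\<bar> * T)"
  define A where "A = exp (a\<^sup>2 * T)"
  have pos: "0 \<le> A" "0 \<le> B" by (auto simp: A_def B_def)
  have "expectation (\<lambda>\<omega>. (gbm a b t \<omega> - gbm a b s \<omega>)\<^sup>2) \<le> (B\<^sup>2 * (A * a\<^sup>2) + A * (B\<^sup>2 * b\<^sup>2 * T)) * (t - s)"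
    if st: "0 \<le> s" "s \<le> t" "t \<le> T" for s t
  proof -
    have bt: "b * u \<le> \<bar>b\<bar> * T" if "0 \<le> u" "u \<le> T" for u
    proof -
      have "b * u \<le> \<bar>b\<bar> * u" using that by (intro mult_right_mono) auto
      also have "\<dots> \<le> \<bar>b\<bar> * T" using that by (intro mult_left_mono) auto
      finally show ?thesis .
    qed
    have 1: "exp (2 * b * t) \<le> B\<^sup>2"
      using bt[of t] st by (simp add: B_def power2_eq_square mult_exp_exp mult.commute)
    have aT: "a\<^sup>2 * t \<le> a\<^sup>2 * T" "a\<^sup>2 * s \<le> a\<^sup>2 * T" using st by (auto intro!: mult_left_mono)
    then have "\<bar>exp (a\<^sup>2 * t) - exp (a\<^sup>2 * s)\<bar> \<le> A * \<bar>a\<^sup>2 * t - a\<^sup>2 * s\<bar>"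
      unfolding A_def by (rule abs_exp_diff_le)
    also have "\<bar>a\<^sup>2 * t - a\<^sup>2 * s\<bar> = a\<^sup>2 * (t - s)"
      using st by (simp add: right_diff_distrib[symmetric] abs_mult)
    finally have 2: "\<bar>exp (a\<^sup>2 * t) - exp (a\<^sup>2 * s)\<bar> \<le> A * a\<^sup>2 * (t - s)" by simp
    have "\<bar>exp (b * t) - exp (b * s)\<bar> \<le> B * \<bar>b * t - b * s\<bar>"
      unfolding B_def using st by (intro abs_exp_diff_le bt) auto
    then have "(exp (b * t) - exp (b * s))\<^sup>2 \<le> (B * \<bar>b * t - b * s\<bar>)\<^sup>2"
      by (rule power2_le_iff_abs_le[THEN iffD2, rotated]) (use pos in auto)
    also have "\<dots> = B\<^sup>2 * b\<^sup>2 * ((t - s) * (t - s))"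
      by (simp add: power_mult_distrib right_diff_distrib[symmetric]) (simp add: power2_eq_square)
    also have "\<dots> \<le> B\<^sup>2 * b\<^sup>2 * (T * (t - s))"
      using st by (intro mult_left_mono mult_right_mono) auto
    finally have 3: "(exp (b * t) - exp (b * s))\<^sup>2 \<le> B\<^sup>2 * b\<^sup>2 * T * (t - s)" by simp
    have "expectation (\<lambda>\<omega>. (gbm a b t \<omega> - gbm a b s \<omega>)\<^sup>2) =
      exp (2 * b * t) * (exp (a\<^sup>2 * t) - exp (a\<^sup>2 * s)) + exp (a\<^sup>2 * s) * (exp (b * t) - exp (b * s))\<^sup>2"
      using gbm_diff_square[OF st(1,2)] by (simp add: has_bochner_integral_iff)
    also have "\<dots> \<le> B\<^sup>2 * (A * a\<^sup>2 * (t - s)) + A * (B\<^sup>2 * b\<^sup>2 * T * (t - s))"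
    proof (rule add_mono)
      have "exp (2 * b * t) * (exp (a\<^sup>2 * t) - exp (a\<^sup>2 * s)) \<le> exp (2 * b * t) * \<bar>exp (a\<^sup>2 * t) - exp (a\<^sup>2 * s)\<bar>"
        by (intro mult_left_mono) auto
      also have "\<dots> \<le> B\<^sup>2 * (A * a\<^sup>2 * (t - s))"
        using 1 2 by (intro mult_mono) auto
      finally show "exp (2 * b * t) * (exp (a\<^sup>2 * t) - exp (a\<^sup>2 * s)) \<le> B\<^sup>2 * (A * a\<^sup>2 * (t - s))" .
      show "exp (a\<^sup>2 * s) * (exp (b * t) - exp (b * s))\<^sup>2 \<le> A * (B\<^sup>2 * b\<^sup>2 * T * (t - s))"
        using 3 aT by (intro mult_mono) (auto simp: A_def)
    qed
    also have "\<dots> = (B\<^sup>2 * (A * a\<^sup>2) + A * (B\<^sup>2 * b\<^sup>2 * T)) * (t - s)" by (simp add: algebra_simps)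
    finally show ?thesis .
  qed
  moreover have "0 \<le> B\<^sup>2 * (A * a\<^sup>2) + A * (B\<^sup>2 * b\<^sup>2 * T)" using pos T by simp
  ultimately show ?thesis by (rule that[rotated])
qed

text \<open>\<open>D\<close> compares the Euler noise \<open>a * x\<close> with the exact growth
  factor of one step, recentred to mean 0. Its variance is of order \<open>h\<^sup>2\<close>, since
  the linear term of \<open>exp (a\<^sup>2 * h)\<close> cancels; summed over steps of length
  \<open>h\<close> it therefore contributes an error of order \<open>h\<close> only.\<close>

lemma compensated_increment:
  fixes a b s t :: real
  assumes "0 \<le> s" "s \<le> t"
  defines "h \<equiv> t - s"
  defines "D \<equiv> \<lambda>x. a * x - exp (a * x + (b - a\<^sup>2 / 2) * h) + exp (b * h)"
  shows "has_bochner_integral M (\<lambda>\<omega>. D (W t \<omega> - W s \<omega>)) 0"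
    and "has_bochner_integral M (\<lambda>\<omega>. (D (W t \<omega> - W s \<omega>))\<^sup>2)
      ((exp (b * h))\<^sup>2 * (exp (a\<^sup>2 * h) - 1 - a\<^sup>2 * h) + a\<^sup>2 * h * (exp (b * h) - 1)\<^sup>2)"
proof -
  let ?d = "\<lambda>\<omega>. W t \<omega> - W s \<omega>"
  let ?e = "\<lambda>\<omega>. exp (a * ?d \<omega> + (b - a\<^sup>2 / 2) * h)"
  define E where "E = exp (b * h)"
  have c: "has_bochner_integral M (\<lambda>\<omega>. k) k" for k :: real
    by (simp add: has_bochner_integral_iff prob_space)
  have e1: "has_bochner_integral M ?e E"
    unfolding h_def E_def by (intro growth_increment assms)
  have d1: "has_bochner_integral M ?d 0" and d2: "has_bochner_integral M (\<lambda>\<omega>. (?d \<omega>)\<^sup>2) h"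
    unfolding h_def by (intro increment_mean increment_square assms)+
  have "has_bochner_integral M (\<lambda>\<omega>. a * ?d \<omega> - ?e \<omega> + E) (a * 0 - E + E)"
    by (intro has_bochner_integral_add has_bochner_integral_diff has_bochner_integral_mult_right d1 e1 c)
  then show "has_bochner_integral M (\<lambda>\<omega>. D (W t \<omega> - W s \<omega>)) 0" by (simp add: D_def E_def)
  have "has_bochner_integral M (\<lambda>\<omega>. exp (2 * a * ?d \<omega>) * exp (2 * (b - a\<^sup>2 / 2) * h)) (exp ((2 * a)\<^sup>2 * (t - s) / 2) * exp (2 * (b - a\<^sup>2 / 2) * h))"
    by (intro has_bochner_integral_mult_left exp_increment assms)
  moreover have "exp (2 * a * ?d \<omega>) * exp (2 * (b - a\<^sup>2 / 2) * h) = (?e \<omega>)\<^sup>2" for \<omega>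
    unfolding power2_eq_square[of "exp _"] mult_exp_exp by (simp add: algebra_simps)
  moreover have "exp ((2 * a)\<^sup>2 * (t - s) / 2) * exp (2 * (b - a\<^sup>2 / 2) * h) = E\<^sup>2 * exp (a\<^sup>2 * h)"
    unfolding E_def power2_eq_square[of "exp _"] mult_exp_exp h_def[symmetric] by (simp add: algebra_simps)
  ultimately have e2: "has_bochner_integral M (\<lambda>\<omega>. (?e \<omega>)\<^sup>2) (E\<^sup>2 * exp (a\<^sup>2 * h))" by (simp only:)
  have "has_bochner_integral M (\<lambda>\<omega>. (?d \<omega> * exp (a * ?d \<omega>)) * exp ((b - a\<^sup>2 / 2) * h)) ((a * (t - s) * exp (a\<^sup>2 * (t - s) / 2)) * exp ((b - a\<^sup>2 / 2) * h))"
    by (intro has_bochner_integral_mult_left mult_exp_increment assms)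
  moreover have "(?d \<omega> * exp (a * ?d \<omega>)) * exp ((b - a\<^sup>2 / 2) * h) = ?d \<omega> * ?e \<omega>" for \<omega>
    by (simp add: exp_add)
  moreover have "(a * (t - s) * exp (a\<^sup>2 * (t - s) / 2)) * exp ((b - a\<^sup>2 / 2) * h) = a * h * E"
    unfolding E_def h_def[symmetric] mult.assoc mult_exp_exp by (simp add: field_simps)
  ultimately have de: "has_bochner_integral M (\<lambda>\<omega>. ?d \<omega> * ?e \<omega>) (a * h * E)" by (simp only:)
  have "has_bochner_integral M (\<lambda>\<omega>. a\<^sup>2 * (?d \<omega>)\<^sup>2 + (?e \<omega>)\<^sup>2 + E\<^sup>2 - 2 * a * (?d \<omega> * ?e \<omega>) + 2 * a * E * ?d \<omega> - 2 * E * ?e \<omega>)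
     (a\<^sup>2 * h + E\<^sup>2 * exp (a\<^sup>2 * h) + E\<^sup>2 - 2 * a * (a * h * E) + 2 * a * E * 0 - 2 * E * E)"
    by (intro has_bochner_integral_add has_bochner_integral_diff has_bochner_integral_mult_right d1 d2 e1 e2 de c)
  moreover have "a\<^sup>2 * (?d \<omega>)\<^sup>2 + (?e \<omega>)\<^sup>2 + E\<^sup>2 - 2 * a * (?d \<omega> * ?e \<omega>) + 2 * a * E * ?d \<omega> - 2 * E * ?e \<omega> = (D (?d \<omega>))\<^sup>2" for \<omega>
  proof -
    have "a\<^sup>2 * d\<^sup>2 + e\<^sup>2 + E\<^sup>2 - 2 * a * (d * e) + 2 * a * E * d - 2 * E * e = (a * d - e + E)\<^sup>2" for d e :: real
      by (simp add: power2_eq_square algebra_simps)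
    then show ?thesis unfolding D_def E_def by blast
  qed
  moreover have "a\<^sup>2 * h + E\<^sup>2 * exp (a\<^sup>2 * h) + E\<^sup>2 - 2 * a * (a * h * E) + 2 * a * E * 0 - 2 * E * E =
     E\<^sup>2 * (exp (a\<^sup>2 * h) - 1 - a\<^sup>2 * h) + a\<^sup>2 * h * (E - 1)\<^sup>2"
    by (simp add: power2_eq_square algebra_simps)
  ultimately show "has_bochner_integral M (\<lambda>\<omega>. (D (W t \<omega> - W s \<omega>))\<^sup>2)
      ((exp (b * h))\<^sup>2 * (exp (a\<^sup>2 * h) - 1 - a\<^sup>2 * h) + a\<^sup>2 * h * (exp (b * h) - 1)\<^sup>2)"
    unfolding E_def by (simp only:)
qed

end

text \<open>There are \<open>Suc k\<close> cells, so that the partition with index 0 is not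
  degenerate.\<close>

definition grid :: "real \<Rightarrow> nat \<Rightarrow> nat \<Rightarrow> real" where
  "grid T k i = T * real i / real (Suc k)"

section \<open>Equidistant grids, clipping and truncation\<close>

lemma grid_simps: "grid T k 0 = 0" "grid T k (Suc k) = T"
  "grid T k (Suc i) - grid T k i = T / real (Suc k)"
proof -
  show "grid T k 0 = 0" by (simp add: grid_def)
  show "grid T k (Suc k) = T" by (simp add: grid_def del: of_nat_Suc)
  have "grid T k (Suc i) - grid T k i = (T * real (Suc i) - T * real i) / real (Suc k)"
    by (simp only: grid_def diff_divide_distrib)
  then show "grid T k (Suc i) - grid T k i = T / real (Suc k)"
    by (simp add: algebra_simps)
qed

lemma grid_mono: "0 \<le> T \<Longrightarrow> i \<le> j \<Longrightarrow> grid T k i \<le> grid T k j"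
  unfolding grid_def by (intro divide_right_mono mult_left_mono) auto

lemma grid_nonneg: "0 \<le> T \<Longrightarrow> 0 \<le> grid T k i"
  unfolding grid_def by simp

lemma grid_le: "0 \<le> T \<Longrightarrow> i \<le> Suc k \<Longrightarrow> grid T k i \<le> T"
  using grid_mono[of T i "Suc k" k] by (simp add: grid_simps)

lemma grid_cover:
  assumes "0 < T" "0 < u" "u \<le> T"
  obtains i where "i < Suc k" "u \<in> {grid T k i<..grid T k (Suc i)}"
proof -
  define i where "i = (LEAST j. u \<le> grid T k j)"
  have ex: "u \<le> grid T k (Suc k)" using assms by (simp add: grid_simps)
  then have le: "u \<le> grid T k i" and ik: "i \<le> Suc k"
    unfolding i_def by (auto intro: LeastI Least_le)
  have "i \<noteq> 0"
  proof
    assume "i = 0"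
    then show False using le assms by (simp add: grid_simps)
  qed
  then obtain j where j: "i = Suc j" using not0_implies_Suc by blast
  have "\<not> u \<le> grid T k j"
    using not_less_Least[of j "\<lambda>j. u \<le> grid T k j"] j unfolding i_def by auto
  then show ?thesis using that[of j] le ik j by auto
qed

lemma grid_clip_step:
  assumes "0 \<le> T"
  shows "0 \<le> min (grid T k (Suc i)) t - min (grid T k i) t"
    "min (grid T k (Suc i)) t - min (grid T k i) t \<le> T / real (Suc k)"
proof -
  have "grid T k (Suc i) = grid T k i + T / real (Suc k)"
    using grid_simps(3)[of T k i] by simp
  moreover have "0 \<le> T / real (Suc k)" using assms by simp
  ultimately show "0 \<le> min (grid T k (Suc i)) t - min (grid T k i) t"
    "min (grid T k (Suc i)) t - min (grid T k i) t \<le> T / real (Suc k)"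
    by (auto simp: min_def)
qed

lemma grid_clip_sum:
  assumes "0 \<le> t" "t \<le> T"
  shows "(\<Sum>i<Suc k. min (grid T k (Suc i)) t - min (grid T k i) t) = t"
  using assms by (subst sum_lessThan_telescope) (simp add: grid_simps)

lemma simple_process_eq:
  assumes "\<forall>i<n. \<tau> i \<le> \<tau> (Suc i)" "i < n" "t \<in> {\<tau> i<..\<tau> (Suc i)}"
  shows "simple_process n \<tau> \<xi> t \<omega> = \<xi> i \<omega>"
proof -
  have "indicator {\<tau> j<..\<tau> (Suc j)} t = (0::real)" if "j < n" "j \<noteq> i" for j
  proof (cases "j < i")
    case True
    then have "\<tau> (Suc j) \<le> \<tau> i" using chain_le[OF assms(1), of "Suc j" i] assms(2) by simp
    then show ?thesis using assms(3) by (auto simp: indicator_def)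
  next
    case False
    then have "\<tau> (Suc i) \<le> \<tau> j" using chain_le[OF assms(1), of "Suc i" j] that by simp
    then show ?thesis using assms(3) by (auto simp: indicator_def)
  qed
  then have "simple_process n \<tau> \<xi> t \<omega> = (\<Sum>j<n. if j = i then \<xi> i \<omega> else 0)"
    unfolding simple_process_def using assms(3) by (intro sum.cong) auto
  then show ?thesis using assms(2) by simp
qed

text \<open>Where truncation acts, \<open>z / m \<ge> 1\<close>, so the factor
  \<open>(z / m)\<^sup>2\<close> can be inserted for free. The truncation error is thereby paid for
  by a fourth moment.\<close>

lemma truncation_square_le:
  fixes z m :: real
  assumes "0 < z" "0 < m"
  shows "(min z m - z)\<^sup>2 \<le> z ^ 4 / m\<^sup>2"
proof (cases "z \<le> m")
  case False
  then have "(min z m - z)\<^sup>2 = (z - m)\<^sup>2" by (simp add: power2_commute)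
  also have "\<dots> \<le> z\<^sup>2" using False assms by (intro power_mono) auto
  also have "\<dots> \<le> z\<^sup>2 * (z\<^sup>2 / m\<^sup>2)"
  proof -
    have "m\<^sup>2 \<le> z\<^sup>2" using False assms by (intro power_mono) auto
    then have "1 \<le> z\<^sup>2 / m\<^sup>2" using assms by simp
    then show ?thesis using mult_left_mono[of 1 "z\<^sup>2 / m\<^sup>2" "z\<^sup>2"] by simp
  qed
  finally show ?thesis by (simp add: power2_eq_square power4_eq_xxxx mult.assoc)
qed (use assms in \<open>simp add: min_def\<close>)

lemma continuous_on_atLeast_zero:
  fixes f :: "real \<Rightarrow> real"
  assumes "\<And>T. 0 < T \<Longrightarrow> continuous_on {0..T} f"
  shows "continuous_on {0..} f"
  unfolding continuous_on_eq_continuous_within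
proof
  fix x :: real assume x: "x \<in> {0..}"
  have "at x within {0..} = at x within {0..x+1}"
    using x by (intro at_within_nhd[of x "{..<x+1}"]) auto
  moreover have "continuous (at x within {0..x+1}) f"
    using assms[of "x + 1"] x by (auto simp: continuous_on_eq_continuous_within)
  ultimately show "continuous (at x within {0..}) f" by simp
qed

context brownian
begin

section \<open>Time integrals and the stochastic integral of geometric Brownian motion\<close>

lemma gbm_set_integrable:
  assumes "\<omega> \<in> space M"
  shows "set_integrable lborel {0..t} (\<lambda>s. gbm a b s \<omega>)"
  by (intro borel_integrable_atLeastAtMost' continuous_on_subset[OF gbm_continuous[OF assms]]) auto

text \<open>Freezing the path at time \<open>t\<close> makes it measurable jointly in time and
  \<open>F t\<close>, not just in \<open>M\<close>; the time integral then stays measurable with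
  respect to \<open>F t\<close>.\<close>

lemma gbm_integral_adapted:
  assumes t: "0 \<le> t"
  shows "(\<lambda>\<omega>. LINT s:{0..t}|lborel. gbm a b s \<omega>) \<in> borel_measurable (F t)"
proof -
  have "(\<lambda>(\<omega>, s). gbm a b (max 0 (min t s)) \<omega>) \<in> borel_measurable (F t \<Otimes>\<^sub>M borel)"
  proof (rule jointly_measurable_continuous)
    fix s show "gbm a b (max 0 (min t s)) \<in> borel_measurable (F t)"
      using t by (intro measurable_F_mono[OF _ _ gbm_adapted]) auto
  next
    fix \<omega> assume "\<omega> \<in> space (F t)"
    then have \<omega>: "\<omega> \<in> space M" using space_F t by simp
    have "continuous_on UNIV ((\<lambda>s. gbm a b s \<omega>) \<circ> (\<lambda>s. max 0 (min t s)))"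
      by (intro continuous_on_compose continuous_on_subset[OF gbm_continuous[OF \<omega>]] continuous_intros) auto
    then show "continuous_on UNIV (\<lambda>s. gbm a b (max 0 (min t s)) \<omega>)" by (simp add: comp_def)
  qed
  then have "(\<lambda>z. indicator {0..t} (snd z) *\<^sub>R gbm a b (max 0 (min t (snd z))) (fst z)) \<in> borel_measurable (F t \<Otimes>\<^sub>M lborel)"
    unfolding split_beta by measurable
  then have "(\<lambda>\<omega>. \<integral>s. indicator {0..t} s *\<^sub>R gbm a b (max 0 (min t s)) \<omega> \<partial>lborel) \<in> borel_measurable (F t)"
    by (intro lborel.borel_measurable_lebesgue_integral) (simp add: split_beta)
  moreover have "(\<integral>s. indicator {0..t} s *\<^sub>R gbm a b (max 0 (min t s)) \<omega> \<partial>lborel) = (LINT s:{0..t}|lborel. gbm a b s \<omega>)" for \<omega>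
    unfolding set_lebesgue_integral_def
    by (intro Bochner_Integration.integral_cong) (auto simp: indicator_def)
  ultimately show ?thesis by simp
qed

lemma gbm_integral_continuous:
  assumes \<omega>: "\<omega> \<in> space M"
  shows "continuous_on {0..} (\<lambda>t. LINT s:{0..t}|lborel. gbm a b s \<omega>)"
proof (rule continuous_on_atLeast_zero)
  fix T :: real
  have "continuous_on {0..T} (\<lambda>t. integral {0..t} (\<lambda>s. gbm a b s \<omega>))"
    by (intro indefinite_integral_continuous_1 set_borel_integral_eq_integral(1) gbm_set_integrable \<omega>)
  moreover have "integral {0..t} (\<lambda>s. gbm a b s \<omega>) = (LINT s:{0..t}|lborel. gbm a b s \<omega>)" if "t \<in> {0..T}" for t
    by (intro sym[OF set_borel_integral_eq_integral(2)] gbm_set_integrable \<omega>)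
  ultimately show "continuous_on {0..T} (\<lambda>t. LINT s:{0..t}|lborel. gbm a b s \<omega>)"
    by (rule continuous_on_eq)
qed

text \<open>Fubini puts the expectation inside. At each time the piecewise constant process equals
  the value at the left end of the cell, at most one mesh width away.\<close>

lemma grid_process_error:
  assumes T: "0 < T" and C: "0 \<le> C"
    "\<And>s t. 0 \<le> s \<Longrightarrow> s \<le> t \<Longrightarrow> t \<le> T \<Longrightarrow> expectation (\<lambda>\<omega>. (gbm a b t \<omega> - gbm a b s \<omega>)\<^sup>2) \<le> C * (t - s)"
  shows "(\<integral>\<^sup>+\<omega>. (\<integral>\<^sup>+t\<in>{0..T}. ennreal ((simple_process (Suc k) (grid T k) (\<lambda>i. gbm a b (grid T k i)) t \<omega> - gbm a b t \<omega>)\<^sup>2) \<partial>lborel) \<partial>M)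
    \<le> ennreal (C * T\<^sup>2 / real (Suc k))"
proof -
  let ?P = "simple_process (Suc k) (grid T k) (\<lambda>i. gbm a b (grid T k i))"
  have mono: "\<forall>i<Suc k. grid T k i \<le> grid T k (Suc i)" using grid_mono T by simp
  interpret P: pair_sigma_finite M lborel ..
  have "jointly_measurable M ?P"
    using T by (intro jointly_measurable_simple_process gbm_measurable grid_nonneg) simp
  then have jD: "jointly_measurable M (\<lambda>t \<omega>. ?P t \<omega> - gbm a b t \<omega>)"
    by (intro jointly_measurable_diff gbm_jointly_measurable)
  note [measurable] = jointly_measurable_indicator[OF jD, of T]
  have "(\<lambda>z. ennreal (((\<lambda>(\<omega>, t). indicator {0..T} t * (?P t \<omega> - gbm a b t \<omega>)) z)\<^sup>2)) \<in> borel_measurable (M \<Otimes>\<^sub>M borel)"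
    by measurable
  then have m: "(\<lambda>(\<omega>, t). ennreal ((indicator {0..T} t * (?P t \<omega> - gbm a b t \<omega>))\<^sup>2)) \<in> borel_measurable (M \<Otimes>\<^sub>M lborel)"
    by (simp add: split_beta cong: measurable_cong_sets)
  have "(\<integral>\<^sup>+\<omega>. (\<integral>\<^sup>+t\<in>{0..T}. ennreal ((?P t \<omega> - gbm a b t \<omega>)\<^sup>2) \<partial>lborel) \<partial>M) =
     (\<integral>\<^sup>+\<omega>. (\<integral>\<^sup>+t. ennreal ((indicator {0..T} t * (?P t \<omega> - gbm a b t \<omega>))\<^sup>2) \<partial>lborel) \<partial>M)"
    by (intro nn_integral_cong) (auto simp: indicator_def)
  also have "\<dots> = (\<integral>\<^sup>+t. (\<integral>\<^sup>+\<omega>. ennreal ((indicator {0..T} t * (?P t \<omega> - gbm a b t \<omega>))\<^sup>2) \<partial>M) \<partial>lborel)"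
    by (rule P.Fubini'[OF m, symmetric])
  also have "\<dots> \<le> (\<integral>\<^sup>+t. ennreal (C * T / real (Suc k)) * indicator {0..T} t \<partial>lborel)"
  proof (rule nn_integral_mono_AE)
    \<comment> \<open>Time 0 is excluded because the cells are open on the left, so that the simple
      process vanishes there.\<close>
    show "AE t in lborel. (\<integral>\<^sup>+\<omega>. ennreal ((indicator {0..T} t * (?P t \<omega> - gbm a b t \<omega>))\<^sup>2) \<partial>M) \<le> ennreal (C * T / real (Suc k)) * indicator {0..T} t"
      using AE_lborel_singleton[of 0]
    proof eventually_elim
      case (elim t)
      show ?case
      proof (cases "t \<in> {0..T}")
        case True
        with elim have t: "0 < t" "t \<le> T" by auto
        obtain i where i: "i < Suc k" "t \<in> {grid T k i<..grid T k (Suc i)}"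
          by (rule grid_cover[OF T t])
        have g: "0 \<le> grid T k i" "grid T k i \<le> t" using i T grid_nonneg[of T k i] by auto
        have "(\<integral>\<^sup>+\<omega>. ennreal ((indicator {0..T} t * (?P t \<omega> - gbm a b t \<omega>))\<^sup>2) \<partial>M) =
          (\<integral>\<^sup>+\<omega>. ennreal ((gbm a b t \<omega> - gbm a b (grid T k i) \<omega>)\<^sup>2) \<partial>M)"
          using True by (simp add: simple_process_eq[OF mono i] power2_commute)
        also have "\<dots> = ennreal (expectation (\<lambda>\<omega>. (gbm a b t \<omega> - gbm a b (grid T k i) \<omega>)\<^sup>2))"
          using gbm_diff_square[OF g, of a b] by (intro nn_integral_eq_integral) (auto simp: has_bochner_integral_iff)
        also have "\<dots> \<le> ennreal (C * (t - grid T k i))"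
          by (intro ennreal_leI C g t)
        also have "\<dots> \<le> ennreal (C * (T / real (Suc k)))"
          using i grid_simps(3)[of T k i] C(1) by (intro ennreal_leI mult_left_mono) auto
        finally show ?thesis using True by simp
      qed simp
    qed
  qed
  also have "\<dots> = ennreal (C * T / real (Suc k)) * ennreal T"
    using T by (subst nn_integral_cmult_indicator) auto
  also have "\<dots> = ennreal (C * T\<^sup>2 / real (Suc k))"
    using T C by (simp add: ennreal_mult[symmetric] power2_eq_square)
  finally show ?thesis .
qed


text \<open>The stochastic differential equation of \<open>gbm\<close>, solved for its integral
  against \<open>W\<close>. Simple integrands must be bounded, so the Riemann sums use values
  truncated at \<open>Suc k\<close>, the number of grid cells: refining the grid and raising the
  truncation level then go together, and every error is of order \<open>1 / Suc k\<close>.\<close>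

lemma gbm_integral_ito:
  "is_ito_integral M F W (\<lambda>t \<omega>. a * gbm a b t \<omega>)
     (\<lambda>t \<omega>. gbm a b t \<omega> - 1 - b * (LINT s:{0..t}|lborel. gbm a b s \<omega>))"
  (is "is_ito_integral M F W ?H ?I")
proof -
  have "adapted F ?I"
    unfolding adapted_def
  proof (intro allI impI)
    fix t :: real assume t: "0 \<le> t"
    show "?I t \<in> borel_measurable (F t)"
      using gbm_adapted[OF t, of a b] gbm_integral_adapted[OF t, of a b] by measurable
  qed
  moreover have "continuous_paths M ?I"
    unfolding continuous_paths_def
    by (intro AE_I2 continuous_intros gbm_continuous gbm_integral_continuous)
  moreover have "\<exists>n \<tau> \<xi>.
        (\<forall>k. simple_data M F (n k) (\<tau> k) (\<xi> k)) \<and>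
        (\<lambda>k::nat. \<integral>\<^sup>+\<omega>. (\<integral>\<^sup>+t\<in>{0..T}.
           ennreal ((simple_process (n k) (\<tau> k) (\<xi> k) t \<omega> - ?H t \<omega>)\<^sup>2) \<partial>lborel) \<partial>M)
          \<longlonglongrightarrow> 0 \<and>
        (\<forall>t\<in>{0..T}.
           (\<lambda>k. \<integral>\<^sup>+\<omega>. ennreal ((simple_ito_integral W (n k) (\<tau> k) (\<xi> k) t \<omega> - ?I t \<omega>)\<^sup>2) \<partial>M)
             \<longlonglongrightarrow> 0)" if T: "0 < T" for T
  proof -
    let ?Z = "gbm a b"
    obtain Cd where Cd: "0 \<le> Cd" "\<And>s t. 0 \<le> s \<Longrightarrow> s \<le> t \<Longrightarrow> t \<le> T \<Longrightarrow> expectation (\<lambda>\<omega>. (?Z t \<omega> - ?Z s \<omega>)\<^sup>2) \<le> Cd * (t - s)"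
      using gbm_diff_square_le[of T a b] T by (metis less_imp_le)
    define B where "B = exp (\<bar>b\<bar> * T)"
    define C2 where "C2 = exp (\<bar>2 * b + a\<^sup>2\<bar> * T)"
    define C4 where "C4 = exp (\<bar>4 * b + 6 * a\<^sup>2\<bar> * T)"
    \<comment> \<open>\<open>V * h\<^sup>2\<close> will bound the variance of one compensated step
      of length \<open>h\<close>; the two summands match the two terms of the variance in
      \<open>compensated_increment\<close>.\<close>
    define V where "V = B\<^sup>2 * (exp (a\<^sup>2 * T) * (a\<^sup>2)\<^sup>2) + a\<^sup>2 * T * (B\<^sup>2 * b\<^sup>2)"
    have pos: "0 \<le> B" "0 \<le> C2" "0 \<le> C4" "0 \<le> V" using T by (auto simp: B_def C2_def C4_def V_def)
    have expT: "exp (c * t) \<le> exp (\<bar>c\<bar> * T)" if "0 \<le> t" "t \<le> T" for c t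
    proof -
      have "c * t \<le> \<bar>c\<bar> * t" using that by (intro mult_right_mono) auto
      also have "\<dots> \<le> \<bar>c\<bar> * T" using that by (intro mult_left_mono) auto
      finally show ?thesis by simp
    qed
    have Z2: "integrable M (\<lambda>\<omega>. (?Z t \<omega>)\<^sup>2)" "expectation (\<lambda>\<omega>. (?Z t \<omega>)\<^sup>2) \<le> C2" if "0 \<le> t" "t \<le> T" for t
      using gbm_square[OF that(1), of a b] expT[OF that, of "2 * b + a\<^sup>2"] by (auto simp: has_bochner_integral_iff C2_def)
    have Z4: "integrable M (\<lambda>\<omega>. (?Z t \<omega>) ^ 4)" "expectation (\<lambda>\<omega>. (?Z t \<omega>) ^ 4) \<le> C4" if "0 \<le> t" "t \<le> T" for t
      using gbm_fourth[OF that(1), of a b] expT[OF that, of "4 * b + 6 * a\<^sup>2"] by (auto simp: has_bochner_integral_iff C4_def)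
    define \<xi> where "\<xi> k i \<omega> = a * min (?Z (grid T k i) \<omega>) (real (Suc k))" for k i \<omega>
    \<comment> \<open>The error made by truncation. It is unbounded but square integrable, so
      \<open>ito_sum_square\<close> applies to it.\<close>
    define \<zeta> where "\<zeta> k i \<omega> = \<xi> k i \<omega> - a * ?Z (grid T k i) \<omega>" for k i \<omega>
    define P where "P k = simple_process (Suc k) (grid T k) (\<lambda>i. ?Z (grid T k i))" for k
    have T0: "0 \<le> T" using T by simp
    have g0: "0 \<le> grid T k 0" "\<forall>i<Suc k. grid T k i \<le> grid T k (Suc i)" for k
      using grid_mono[OF T0] by (auto simp: grid_simps)
    have gT: "0 \<le> grid T k i" "grid T k i \<le> T" if "i < Suc k" for k i
      using grid_nonneg[OF T0] grid_le[OF T0] that by auto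
    have \<xi>m: "\<xi> k i \<in> borel_measurable (F (grid T k i))" if "i < Suc k" for k i
      using gbm_adapted[OF gT(1)[OF that], of a b] unfolding \<xi>_def by measurable
    have \<zeta>m: "\<zeta> k i \<in> borel_measurable (F (grid T k i))" if "i < Suc k" for k i
      using gbm_adapted[OF gT(1)[OF that], of a b] \<xi>m[OF that] unfolding \<zeta>_def by measurable
    have sd: "simple_data M F (Suc k) (grid T k) (\<xi> k)" for k
      unfolding simple_data_def
    proof (intro conjI allI impI g0[rule_format] \<xi>m)
      fix i assume "i < Suc k"
      have "\<bar>\<xi> k i \<omega>\<bar> \<le> \<bar>a\<bar> * real (Suc k)" for \<omega>
        unfolding \<xi>_def abs_mult using gbm_pos[of a b "grid T k i" \<omega>] by (intro mult_left_mono) auto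
      then show "\<exists>B. \<forall>\<omega>\<in>space M. \<bar>\<xi> k i \<omega>\<bar> \<le> B" by blast
    qed
    have \<zeta>2: "integrable M (\<lambda>\<omega>. (\<zeta> k i \<omega>)\<^sup>2)" "expectation (\<lambda>\<omega>. (\<zeta> k i \<omega>)\<^sup>2) \<le> a\<^sup>2 * C4 / real (Suc k)" if i: "i < Suc k" for k i
    proof -
      have le: "(\<zeta> k i \<omega>)\<^sup>2 \<le> a\<^sup>2 / real (Suc k) * (?Z (grid T k i) \<omega>) ^ 4" for \<omega>
      proof -
        let ?z = "?Z (grid T k i) \<omega>"
        have "(\<zeta> k i \<omega>)\<^sup>2 = a\<^sup>2 * (min ?z (real (Suc k)) - ?z)\<^sup>2"
          unfolding \<zeta>_def \<xi>_def by (simp add: power_mult_distrib[symmetric] right_diff_distrib)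
        also have "\<dots> \<le> a\<^sup>2 * (?z ^ 4 / (real (Suc k))\<^sup>2)"
          using gbm_pos by (intro mult_left_mono truncation_square_le) auto
        \<comment> \<open>One power of \<open>Suc k\<close> is given away, to put all errors on the
          common denominator \<open>Suc k\<close>.\<close>
        also have "\<dots> \<le> a\<^sup>2 * (?z ^ 4 / real (Suc k))"
          using gbm_pos[of a b "grid T k i" \<omega>]
          by (intro mult_left_mono divide_left_mono) (auto simp: power2_eq_square)
        finally show ?thesis by simp
      qed
      note int = integrable_mult_right[OF Z4(1)[OF gT[OF i]], of "a\<^sup>2 / real (Suc k)"]
      have m: "\<zeta> k i \<in> borel_measurable M" using measurable_F_M[OF gT(1)[OF i] \<zeta>m[OF i]] .
      show i\<zeta>: "integrable M (\<lambda>\<omega>. (\<zeta> k i \<omega>)\<^sup>2)"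
      proof (rule Bochner_Integration.integrable_bound[OF int])
        show "AE \<omega> in M. norm ((\<zeta> k i \<omega>)\<^sup>2) \<le> norm (a\<^sup>2 / real (Suc k) * (?Z (grid T k i) \<omega>) ^ 4)"
          using le order_trans[OF le abs_ge_self] by (intro AE_I2) simp
      qed (use m in measurable)
      have "expectation (\<lambda>\<omega>. (\<zeta> k i \<omega>)\<^sup>2) \<le> expectation (\<lambda>\<omega>. a\<^sup>2 / real (Suc k) * (?Z (grid T k i) \<omega>) ^ 4)"
        by (intro integral_mono i\<zeta> int le)
      also have "\<dots> = a\<^sup>2 / real (Suc k) * expectation (\<lambda>\<omega>. (?Z (grid T k i) \<omega>) ^ 4)"
        by (rule integral_mult_right_zero)
      also have "\<dots> \<le> a\<^sup>2 / real (Suc k) * C4"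
        using Z4(2)[OF gT[OF i]] by (intro mult_left_mono) auto
      finally show "expectation (\<lambda>\<omega>. (\<zeta> k i \<omega>)\<^sup>2) \<le> a\<^sup>2 * C4 / real (Suc k)" by simp
    qed
    have \<zeta>sum: "(\<Sum>i<Suc k. expectation (\<lambda>\<omega>. (\<zeta> k i \<omega>)\<^sup>2) * (min (grid T k (Suc i)) t - min (grid T k i) t)) \<le> a\<^sup>2 * C4 * T / real (Suc k)"
      if t: "0 \<le> t" "t \<le> T" for k t
    proof -
      have "(\<Sum>i<Suc k. expectation (\<lambda>\<omega>. (\<zeta> k i \<omega>)\<^sup>2) * (min (grid T k (Suc i)) t - min (grid T k i) t)) \<le>
         (\<Sum>i<Suc k. a\<^sup>2 * C4 / real (Suc k) * (min (grid T k (Suc i)) t - min (grid T k i) t))"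
        using \<zeta>2(2) grid_clip_step(1)[OF T0] by (intro sum_mono mult_right_mono) auto
      also have "\<dots> = a\<^sup>2 * C4 / real (Suc k) * t"
        unfolding sum_distrib_left[symmetric] grid_clip_sum[OF t] ..
      also have "\<dots> \<le> a\<^sup>2 * C4 / real (Suc k) * T"
        using t pos by (intro mult_left_mono) auto
      finally show ?thesis by simp
    qed
    note Perr = grid_process_error[OF T Cd, folded P_def]
    have jP: "jointly_measurable M (P k)" for k
      unfolding P_def using gT by (intro jointly_measurable_simple_process gbm_measurable)
    have jPZ: "jointly_measurable M (\<lambda>t \<omega>. P k t \<omega> - ?Z t \<omega>)" for k
      by (intro jointly_measurable_diff jP gbm_jointly_measurable)
    \<comment> \<open>The truncated integrand is the truncation error plus the untruncated step
      process, whose distance to the integrand is controlled by \<open>Perr\<close>.\<close>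
    have simple_\<xi>: "simple_process (Suc k) (grid T k) (\<xi> k) t \<omega> = simple_process (Suc k) (grid T k) (\<zeta> k) t \<omega> + a * P k t \<omega>" for k t \<omega>
      unfolding simple_process_def P_def sum_distrib_left sum.distrib[symmetric] \<zeta>_def
      by (intro sum.cong) (auto simp: algebra_simps)
    have E3: "(\<integral>\<^sup>+\<omega>. (\<integral>\<^sup>+t\<in>{0..T}. ennreal ((simple_process (Suc k) (grid T k) (\<xi> k) t \<omega> - ?H t \<omega>)\<^sup>2) \<partial>lborel) \<partial>M)
       \<le> ennreal ((2 * (a\<^sup>2 * C4 * T) + 2 * (a\<^sup>2 * (Cd * T\<^sup>2))) / real (Suc k))" for k
    proof -
      let ?q = "\<lambda>\<omega>. \<integral>\<^sup>+t\<in>{0..T}. ennreal ((simple_process (Suc k) (grid T k) (\<zeta> k) t \<omega>)\<^sup>2) \<partial>lborel"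
      let ?p = "\<lambda>\<omega>. \<integral>\<^sup>+t\<in>{0..T}. ennreal ((P k t \<omega> - ?Z t \<omega>)\<^sup>2) \<partial>lborel"
      have j\<zeta>: "jointly_measurable M (simple_process (Suc k) (grid T k) (\<zeta> k))"
        using measurable_F_M[OF gT(1) \<zeta>m] by (intro jointly_measurable_simple_process) auto
      have qm: "?q \<in> borel_measurable M" by (rule jointly_measurable_nn_integral[OF j\<zeta>]) auto
      have pm: "?p \<in> borel_measurable M" by (rule jointly_measurable_nn_integral[OF jPZ]) auto
      have "(\<integral>\<^sup>+\<omega>. (\<integral>\<^sup>+t\<in>{0..T}. ennreal ((simple_process (Suc k) (grid T k) (\<xi> k) t \<omega> - ?H t \<omega>)\<^sup>2) \<partial>lborel) \<partial>M)
        \<le> (\<integral>\<^sup>+\<omega>. 2 * ?q \<omega> + ennreal (2 * a\<^sup>2) * ?p \<omega> \<partial>M)"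
      proof (rule nn_integral_mono)
        fix \<omega> assume \<omega>: "\<omega> \<in> space M"
        note [measurable] = jointly_measurable_section[OF j\<zeta> \<omega>, of T] jointly_measurable_section[OF jPZ \<omega>, of T k]
        have "(\<integral>\<^sup>+t\<in>{0..T}. ennreal ((simple_process (Suc k) (grid T k) (\<xi> k) t \<omega> - ?H t \<omega>)\<^sup>2) \<partial>lborel) \<le>
          (\<integral>\<^sup>+t. 2 * ennreal ((indicator {0..T} t * simple_process (Suc k) (grid T k) (\<zeta> k) t \<omega>)\<^sup>2) +
              ennreal (2 * a\<^sup>2) * ennreal ((indicator {0..T} t * (P k t \<omega> - ?Z t \<omega>))\<^sup>2) \<partial>lborel)"
        proof (rule nn_integral_mono)
          fix t
          have "ennreal ((simple_process (Suc k) (grid T k) (\<xi> k) t \<omega> - ?H t \<omega>)\<^sup>2) =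
             ennreal ((simple_process (Suc k) (grid T k) (\<zeta> k) t \<omega> + a * (P k t \<omega> - ?Z t \<omega>))\<^sup>2)"
            unfolding simple_\<xi> by (simp add: algebra_simps)
          also have "\<dots> \<le> 2 * ennreal ((simple_process (Suc k) (grid T k) (\<zeta> k) t \<omega>)\<^sup>2) + 2 * ennreal ((a * (P k t \<omega> - ?Z t \<omega>))\<^sup>2)"
            by (rule ennreal_square_add_le)
          also have "2 * ennreal ((a * (P k t \<omega> - ?Z t \<omega>))\<^sup>2) = ennreal (2 * a\<^sup>2) * ennreal ((P k t \<omega> - ?Z t \<omega>)\<^sup>2)"
            by (simp add: power_mult_distrib ennreal_mult mult.assoc)
          finally show "ennreal ((simple_process (Suc k) (grid T k) (\<xi> k) t \<omega> - ?H t \<omega>)\<^sup>2) * indicator {0..T} t \<le>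
              2 * ennreal ((indicator {0..T} t * simple_process (Suc k) (grid T k) (\<zeta> k) t \<omega>)\<^sup>2) +
              ennreal (2 * a\<^sup>2) * ennreal ((indicator {0..T} t * (P k t \<omega> - ?Z t \<omega>))\<^sup>2)"
            by (auto simp: indicator_def)
        qed
        also have "\<dots> = 2 * (\<integral>\<^sup>+t. ennreal ((indicator {0..T} t * simple_process (Suc k) (grid T k) (\<zeta> k) t \<omega>)\<^sup>2) \<partial>lborel) +
              ennreal (2 * a\<^sup>2) * (\<integral>\<^sup>+t. ennreal ((indicator {0..T} t * (P k t \<omega> - ?Z t \<omega>))\<^sup>2) \<partial>lborel)"
          by (simp add: nn_integral_add nn_integral_cmult del: ennreal_mult'')
        also have "(\<integral>\<^sup>+t. ennreal ((indicator {0..T} t * simple_process (Suc k) (grid T k) (\<zeta> k) t \<omega>)\<^sup>2) \<partial>lborel) = ?q \<omega>"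
          by (intro nn_integral_cong) (auto simp: indicator_def)
        also have "(\<integral>\<^sup>+t. ennreal ((indicator {0..T} t * (P k t \<omega> - ?Z t \<omega>))\<^sup>2) \<partial>lborel) = ?p \<omega>"
          by (intro nn_integral_cong) (auto simp: indicator_def)
        finally show "(\<integral>\<^sup>+t\<in>{0..T}. ennreal ((simple_process (Suc k) (grid T k) (\<xi> k) t \<omega> - ?H t \<omega>)\<^sup>2) \<partial>lborel) \<le> 2 * ?q \<omega> + ennreal (2 * a\<^sup>2) * ?p \<omega>" .
      qed
      also have "\<dots> = 2 * (\<integral>\<^sup>+\<omega>. ?q \<omega> \<partial>M) + ennreal (2 * a\<^sup>2) * (\<integral>\<^sup>+\<omega>. ?p \<omega> \<partial>M)"
        using qm pm by (simp add: nn_integral_add nn_integral_cmult)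
      also have "\<dots> \<le> 2 * ennreal (a\<^sup>2 * C4 * T / real (Suc k)) + ennreal (2 * a\<^sup>2) * ennreal (Cd * T\<^sup>2 / real (Suc k))"
      proof (intro add_mono mult_left_mono Perr)
        have "(\<integral>\<^sup>+\<omega>. ?q \<omega> \<partial>M) = (\<integral>\<^sup>+\<omega>. ennreal (\<Sum>i<Suc k. (\<zeta> k i \<omega>)\<^sup>2 * (min (grid T k (Suc i)) T - min (grid T k i) T)) \<partial>M)"
          unfolding nn_integral_simple_process_square[OF g0 T0] ..
        also have "\<dots> = ennreal (\<integral>\<omega>. (\<Sum>i<Suc k. (\<zeta> k i \<omega>)\<^sup>2 * (min (grid T k (Suc i)) T - min (grid T k i) T)) \<partial>M)"
          using \<zeta>2(1) grid_clip_step(1)[OF T0]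
          by (intro nn_integral_eq_integral Bochner_Integration.integrable_sum AE_I2 sum_nonneg) auto
        also have "(\<integral>\<omega>. (\<Sum>i<Suc k. (\<zeta> k i \<omega>)\<^sup>2 * (min (grid T k (Suc i)) T - min (grid T k i) T)) \<partial>M) =
           (\<Sum>i<Suc k. expectation (\<lambda>\<omega>. (\<zeta> k i \<omega>)\<^sup>2) * (min (grid T k (Suc i)) T - min (grid T k i) T))"
          using \<zeta>2(1) by (subst Bochner_Integration.integral_sum) auto
        also have "ennreal \<dots> \<le> ennreal (a\<^sup>2 * C4 * T / real (Suc k))"
          using T0 by (intro ennreal_leI \<zeta>sum) auto
        finally show "(\<integral>\<^sup>+\<omega>. ?q \<omega> \<partial>M) \<le> ennreal (a\<^sup>2 * C4 * T / real (Suc k))" .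
      qed auto
      also have "\<dots> = ennreal (2 * (a\<^sup>2 * C4 * T / real (Suc k)) + 2 * a\<^sup>2 * (Cd * T\<^sup>2 / real (Suc k)))"
      proof -
        have "2 * ennreal x + ennreal c * ennreal y = ennreal (2 * x + c * y)" if "0 \<le> x" "0 \<le> y" "0 \<le> c" for x y c
          using that by (simp add: ennreal_plus ennreal_mult)
        then show ?thesis using pos T0 Cd(1) by simp
      qed
      also have "2 * (a\<^sup>2 * C4 * T / real (Suc k)) + 2 * a\<^sup>2 * (Cd * T\<^sup>2 / real (Suc k)) =
         (2 * (a\<^sup>2 * C4 * T) + 2 * (a\<^sup>2 * (Cd * T\<^sup>2))) / real (Suc k)"
        by (simp add: add_divide_distrib)
      finally show ?thesis .
    qed
    have lim: "(\<lambda>k. ennreal (K / real (Suc k))) \<longlonglongrightarrow> 0" for K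
    proof -
      have "(\<lambda>k. K / real (Suc k)) \<longlonglongrightarrow> 0"
        using LIMSEQ_Suc[OF lim_const_over_n[of K]] by simp
      then have "(\<lambda>k. ennreal (K / real (Suc k))) \<longlonglongrightarrow> ennreal 0" by (rule tendsto_ennrealI)
      then show ?thesis by simp
    qed
    have main: "(\<integral>\<^sup>+\<omega>. ennreal ((simple_ito_integral W (Suc k) (grid T k) (\<xi> k) t \<omega> - ?I t \<omega>)\<^sup>2) \<partial>M)
       \<le> ennreal ((4 * (a\<^sup>2 * C4 * T) + 4 * (C2 * V * T\<^sup>2) + 4 * (C2 * (B * b\<^sup>2 * T\<^sup>2)\<^sup>2) + 4 * (b\<^sup>2 * T * (Cd * T\<^sup>2))) / real (Suc k))"
      if t: "0 \<le> t" "t \<le> T" for k t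
    proof -
      define m where "m = real (Suc k)"
      have m: "1 \<le> m" "0 < m" by (auto simp: m_def)
      define s where "s i = min (grid T k i) t" for i
      define h where "h i = s (Suc i) - s i" for i
      let ?d = "\<lambda>i \<omega>. W (s (Suc i)) \<omega> - W (s i) \<omega>"
      define D where "D i x = a * x - exp (a * x + (b - a\<^sup>2 / 2) * h i) + exp (b * h i)" for i x
      \<comment> \<open>The mean of the relative error of one Euler step; it is of second order in
        \<open>h i\<close>.\<close>
      define \<beta> where "\<beta> i = 1 + b * h i - exp (b * h i)" for i
      \<comment> \<open>The error splits into the truncation of the coefficients (\<open>X1\<close>), a martingale part (\<open>X2\<close>),
        the second order bias of the drift (\<open>X3\<close>) and the Riemann sum error (\<open>X4\<close>).\<close>
      define X1 where "X1 = simple_ito_integral W (Suc k) (grid T k) (\<zeta> k) t"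
      define X2 where "X2 \<omega> = (\<Sum>i<Suc k. ?Z (s i) \<omega> * D i (?d i \<omega>))" for \<omega>
      define X3 where "X3 \<omega> = (\<Sum>i<Suc k. ?Z (s i) \<omega> * \<beta> i)" for \<omega>
      define X4 where "X4 \<omega> = b * (LINT u:{0..t}|lborel. ?Z u \<omega> - P k u \<omega>)" for \<omega>
      have h: "0 \<le> h i" "h i \<le> T / m" for i
        using grid_clip_step[OF T0] by (auto simp: h_def s_def m_def)
      have hT: "h i \<le> T" for i
      proof -
        have "T / m \<le> T / 1" using m T by (intro divide_left_mono) auto
        then show ?thesis using h(2)[of i] by simp
      qed
      have hsum: "(\<Sum>i<Suc k. h i) = t"
        unfolding h_def s_def using grid_clip_sum[OF t] .
      have s: "0 \<le> s i" "s i \<le> s (Suc i)" "s i \<le> T" for i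
        using grid_nonneg[OF T0] grid_mono[OF T0, of i "Suc i"] t h(1)[of i] by (auto simp: s_def h_def)
      have bh: "\<bar>b * h i\<bar> \<le> \<bar>b\<bar> * T" for i
        unfolding abs_mult using h(1) hT by (intro mult_left_mono) auto
      \<comment> \<open>Either the grid point precedes \<open>t\<close> and clipping leaves it
        alone, or the clipped cell is empty and its contribution is 0. So grid points may be
        exchanged for clipped ones in all sums.\<close>
      have clip: "?Z (grid T k i) \<omega> = ?Z (s i) \<omega> \<or> s (Suc i) = s i" for i \<omega>
        using grid_mono[OF T0, of i "Suc i" k] by (auto simp: s_def min_def)
      have eq: "simple_ito_integral W (Suc k) (grid T k) (\<xi> k) t \<omega> - ?I t \<omega> = (X1 \<omega> + X2 \<omega>) + (X3 \<omega> + X4 \<omega>)"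
        if \<omega>: "\<omega> \<in> space M" for \<omega>
      proof -
        have "simple_ito_integral W (Suc k) (grid T k) (\<xi> k) t \<omega> = X1 \<omega> + (\<Sum>i<Suc k. a * ?Z (s i) \<omega> * ?d i \<omega>)"
          unfolding X1_def simple_ito_integral_def sum.distrib[symmetric] s_def[symmetric]
        proof (rule sum.cong)
          fix i
          show "\<xi> k i \<omega> * ?d i \<omega> = \<zeta> k i \<omega> * ?d i \<omega> + a * ?Z (s i) \<omega> * ?d i \<omega>"
            using clip[of i \<omega>] by (auto simp: \<zeta>_def algebra_simps)
        qed simp
        moreover have "?Z t \<omega> - 1 = (\<Sum>i<Suc k. ?Z (s (Suc i)) \<omega> - ?Z (s i) \<omega>)"
          using t by (subst sum_lessThan_telescope) (simp add: s_def grid_simps gbm_zero[OF \<omega>])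
        moreover have "b * (LINT u:{0..t}|lborel. ?Z u \<omega>) = X4 \<omega> + (\<Sum>i<Suc k. b * ?Z (s i) \<omega> * h i)"
        proof -
          have "(LINT u:{0..t}|lborel. ?Z u \<omega> - P k u \<omega>) = (LINT u:{0..t}|lborel. ?Z u \<omega>) - (LINT u:{0..t}|lborel. P k u \<omega>)"
            unfolding P_def by (intro set_integral_diff gbm_set_integrable \<omega> set_integral_simple_process(1) g0 t)
          moreover have "(LINT u:{0..t}|lborel. P k u \<omega>) = (\<Sum>i<Suc k. ?Z (grid T k i) \<omega> * h i)"
            unfolding P_def h_def s_def by (rule set_integral_simple_process(2)[OF g0 t(1)])
          moreover have "(\<Sum>i<Suc k. ?Z (grid T k i) \<omega> * h i) = (\<Sum>i<Suc k. ?Z (s i) \<omega> * h i)"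
          proof (rule sum.cong)
            fix i
            show "?Z (grid T k i) \<omega> * h i = ?Z (s i) \<omega> * h i"
              using clip[of i \<omega>] by (auto simp: h_def)
          qed simp
          ultimately show ?thesis
            unfolding X4_def by (simp only: right_diff_distrib sum_distrib_left mult.assoc)
        qed
        \<comment> \<open>One Euler step against one exact step, both relative to
          \<open>?Z (s i)\<close>: adding and subtracting the mean growth
          \<open>exp (b * h i)\<close> splits the difference into the centred part
          \<open>D i\<close> and the bias \<open>\<beta> i\<close>.\<close>
        moreover have "(\<Sum>i<Suc k. a * ?Z (s i) \<omega> * ?d i \<omega>) - (\<Sum>i<Suc k. ?Z (s (Suc i)) \<omega> - ?Z (s i) \<omega>) + (\<Sum>i<Suc k. b * ?Z (s i) \<omega> * h i) = X2 \<omega> + X3 \<omega>"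
          unfolding X2_def X3_def sum.distrib[symmetric] sum_subtractf[symmetric]
        proof (rule sum.cong)
          fix i
          have "?Z (s (Suc i)) \<omega> = ?Z (s i) \<omega> * exp (a * ?d i \<omega> + (b - a\<^sup>2 / 2) * h i)"
            unfolding h_def by (rule gbm_step)
          moreover have "a * z * d - (z * e - z) + b * z * u = z * (a * d - e + v) + z * (1 + b * u - v)" for z d e u v :: real
            by (simp add: algebra_simps)
          ultimately show "a * ?Z (s i) \<omega> * ?d i \<omega> - (?Z (s (Suc i)) \<omega> - ?Z (s i) \<omega>) + b * ?Z (s i) \<omega> * h i =
              ?Z (s i) \<omega> * D i (?d i \<omega>) + ?Z (s i) \<omega> * \<beta> i"
            unfolding D_def \<beta>_def by (simp only:)
        qed simp
        ultimately show ?thesis by linarith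
      qed
      have X1m[measurable]: "X1 \<in> borel_measurable M"
        unfolding X1_def simple_ito_integral_def
        using measurable_F_M[OF gT(1) \<zeta>m] gT t grid_nonneg[OF T0]
        by (intro borel_measurable_sum borel_measurable_times borel_measurable_diff W_measurable) auto
      have Zm: "?Z (s i) \<in> borel_measurable M" "W (s i) \<in> borel_measurable M" for i
        using s by (auto intro: gbm_measurable W_measurable)
      note [measurable] = Zm
      have [measurable]: "D i \<in> borel_measurable borel" for i unfolding D_def by measurable
      have [measurable]: "X2 \<in> borel_measurable M" "X3 \<in> borel_measurable M"
        unfolding X2_def X3_def by measurable
      have jZP: "jointly_measurable M (\<lambda>u \<omega>. ?Z u \<omega> - P k u \<omega>)"
        by (intro jointly_measurable_diff jP gbm_jointly_measurable)
      have [measurable]: "X4 \<in> borel_measurable M"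
        unfolding X4_def using jointly_measurable_set_integral[OF jZP, of t] by measurable
      have n1: "(\<integral>\<^sup>+\<omega>. ennreal ((X1 \<omega>)\<^sup>2) \<partial>M) \<le> ennreal (a\<^sup>2 * C4 * T / m)"
        using ito_sum_square[OF g0 \<zeta>m \<zeta>2(1) t(1)] \<zeta>sum[OF t, of k]
        unfolding X1_def m_def
        by (subst nn_integral_eq_integral) (auto simp: has_bochner_integral_iff intro!: ennreal_leI)
      \<comment> \<open>The summands are orthogonal, so their variances add: each is of order
        \<open>h\<^sup>2\<close>, and the \<open>h i\<close> sum up to \<open>t\<close>.\<close>
      have n2: "(\<integral>\<^sup>+\<omega>. ennreal ((X2 \<omega>)\<^sup>2) \<partial>M) \<le> ennreal (C2 * V * T\<^sup>2 / m)"
      proof -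
        define v where "v i = (exp (b * h i))\<^sup>2 * (exp (a\<^sup>2 * h i) - 1 - a\<^sup>2 * h i) + a\<^sup>2 * h i * (exp (b * h i) - 1)\<^sup>2" for i
        have hb: "has_bochner_integral M (\<lambda>\<omega>. (X2 \<omega>)\<^sup>2) (\<Sum>i<Suc k. expectation (\<lambda>\<omega>. (?Z (s i) \<omega>)\<^sup>2) * v i)"
          unfolding X2_def
        proof (rule increment_sum_square(1))
          fix i
          show "has_bochner_integral M (\<lambda>\<omega>. D i (?d i \<omega>)) 0" "has_bochner_integral M (\<lambda>\<omega>. (D i (?d i \<omega>))\<^sup>2) (v i)"
            using compensated_increment[OF s(1,2)[of i], of a b] unfolding D_def v_def h_def by auto
          show "?Z (s i) \<in> borel_measurable (F (s i))" "integrable M (\<lambda>\<omega>. (?Z (s i) \<omega>)\<^sup>2)"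
            using s gbm_adapted Z2(1) by auto
        qed (use s in auto)
        have v: "v i \<le> V * (h i)\<^sup>2" for i
        proof -
          have e: "exp (b * h i) \<le> B" unfolding B_def using bh[of i] by simp
          have "\<bar>exp (a\<^sup>2 * h i) - 1 - a\<^sup>2 * h i\<bar> \<le> exp (a\<^sup>2 * T) * (a\<^sup>2 * h i)\<^sup>2"
            using h(1)[of i] hT[of i] by (intro exp_remainder_le) (auto simp: abs_mult intro!: mult_left_mono)
          then have 1: "exp (a\<^sup>2 * h i) - 1 - a\<^sup>2 * h i \<le> exp (a\<^sup>2 * T) * ((a\<^sup>2)\<^sup>2 * (h i)\<^sup>2)"
            by (simp add: power_mult_distrib)
          have "\<bar>exp (b * h i) - exp 0\<bar> \<le> B * \<bar>b * h i - 0\<bar>"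
            unfolding B_def using bh[of i] T0 by (intro abs_exp_diff_le) auto
          then have "(exp (b * h i) - 1)\<^sup>2 \<le> (B * \<bar>b * h i\<bar>)\<^sup>2"
            using pos by (intro power2_le_iff_abs_le[THEN iffD2]) auto
          then have 2: "(exp (b * h i) - 1)\<^sup>2 \<le> B\<^sup>2 * b\<^sup>2 * (h i)\<^sup>2"
            by (simp add: power_mult_distrib)
          have "v i \<le> B\<^sup>2 * (exp (a\<^sup>2 * T) * ((a\<^sup>2)\<^sup>2 * (h i)\<^sup>2)) + a\<^sup>2 * T * (B\<^sup>2 * b\<^sup>2 * (h i)\<^sup>2)"
            unfolding v_def
          proof (rule add_mono)
            have "(exp (b * h i))\<^sup>2 * (exp (a\<^sup>2 * h i) - 1 - a\<^sup>2 * h i) \<le> (exp (b * h i))\<^sup>2 * (exp (a\<^sup>2 * T) * ((a\<^sup>2)\<^sup>2 * (h i)\<^sup>2))"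
              using 1 by (intro mult_left_mono) auto
            also have "\<dots> \<le> B\<^sup>2 * (exp (a\<^sup>2 * T) * ((a\<^sup>2)\<^sup>2 * (h i)\<^sup>2))"
              using e by (intro mult_right_mono power_mono) auto
            finally show "(exp (b * h i))\<^sup>2 * (exp (a\<^sup>2 * h i) - 1 - a\<^sup>2 * h i) \<le> B\<^sup>2 * (exp (a\<^sup>2 * T) * ((a\<^sup>2)\<^sup>2 * (h i)\<^sup>2))" .
            show "a\<^sup>2 * h i * (exp (b * h i) - 1)\<^sup>2 \<le> a\<^sup>2 * T * (B\<^sup>2 * b\<^sup>2 * (h i)\<^sup>2)"
              using 2 h(1)[of i] hT[of i] T0 by (intro mult_mono mult_left_mono) auto
          qed
          also have "\<dots> = V * (h i)\<^sup>2" unfolding V_def by (simp add: algebra_simps)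
          finally show ?thesis .
        qed
        have "(\<Sum>i<Suc k. expectation (\<lambda>\<omega>. (?Z (s i) \<omega>)\<^sup>2) * v i) \<le> (\<Sum>i<Suc k. C2 * V * (T / m) * h i)"
        proof (rule sum_mono)
          fix i
          have E0: "0 \<le> expectation (\<lambda>\<omega>. (?Z (s i) \<omega>)\<^sup>2)" by simp
          have "expectation (\<lambda>\<omega>. (?Z (s i) \<omega>)\<^sup>2) * v i \<le> expectation (\<lambda>\<omega>. (?Z (s i) \<omega>)\<^sup>2) * (V * (h i)\<^sup>2)"
            using v E0 by (intro mult_left_mono)
          also have "\<dots> \<le> C2 * (V * (h i)\<^sup>2)"
            using Z2(2)[OF s(1,3)] pos by (intro mult_right_mono) auto
          also have "\<dots> \<le> C2 * (V * (T / m * h i))"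
            unfolding power2_eq_square using pos h[of i] by (intro mult_left_mono mult_right_mono) auto
          finally show "expectation (\<lambda>\<omega>. (?Z (s i) \<omega>)\<^sup>2) * v i \<le> C2 * V * (T / m) * h i" by (simp add: mult.assoc)
        qed
        also have "\<dots> = C2 * V * (T / m) * t" unfolding sum_distrib_left[symmetric] hsum ..
        also have "\<dots> \<le> C2 * V * (T / m) * T" using t pos T0 m by (intro mult_left_mono) auto
        also have "\<dots> = C2 * V * T\<^sup>2 / m" by (simp add: power2_eq_square)
        finally have "(\<Sum>i<Suc k. expectation (\<lambda>\<omega>. (?Z (s i) \<omega>)\<^sup>2) * v i) \<le> C2 * V * T\<^sup>2 / m" .
        then show ?thesis
          using hb by (subst nn_integral_eq_integral) (auto simp: has_bochner_integral_iff intro!: ennreal_leI)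
      qed
      \<comment> \<open>The biases are not orthogonal, so Cauchy-Schwarz over the \<open>m\<close>
        cells costs an extra factor \<open>m\<close>. They are small enough:
        \<open>(\<beta> i)\<^sup>2\<close> is of order \<open>m\<close> to the power -4.\<close>
      have n3: "(\<integral>\<^sup>+\<omega>. ennreal ((X3 \<omega>)\<^sup>2) \<partial>M) \<le> ennreal (C2 * (B * b\<^sup>2 * T\<^sup>2)\<^sup>2 / m)"
      proof -
        define c where "c = (B * b\<^sup>2 * T\<^sup>2 / m\<^sup>2)\<^sup>2"
        have \<beta>: "(\<beta> i)\<^sup>2 \<le> c" for i
        proof -
          have "\<bar>exp (b * h i) - 1 - b * h i\<bar> \<le> B * (b * h i)\<^sup>2"
            unfolding B_def by (rule exp_remainder_le[OF bh])
          moreover have "\<bar>\<beta> i\<bar> = \<bar>exp (b * h i) - 1 - b * h i\<bar>" unfolding \<beta>_def by linarith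
          moreover have "B * (b * h i)\<^sup>2 \<le> B * (b\<^sup>2 * (T / m)\<^sup>2)"
            unfolding power_mult_distrib using h[of i] pos by (intro mult_left_mono power_mono) auto
          ultimately have "\<bar>\<beta> i\<bar> \<le> B * b\<^sup>2 * T\<^sup>2 / m\<^sup>2" by (simp add: power_divide)
          then show ?thesis unfolding c_def using pos by (intro power2_le_iff_abs_le[THEN iffD2]) auto
        qed
        have X3: "(X3 \<omega>)\<^sup>2 \<le> (m * c) * (\<Sum>i<Suc k. (?Z (s i) \<omega>)\<^sup>2)" for \<omega>
        proof -
          have "(X3 \<omega>)\<^sup>2 \<le> (\<Sum>i<Suc k. (?Z (s i) \<omega>)\<^sup>2) * (\<Sum>i<Suc k. (\<beta> i)\<^sup>2)"
            unfolding X3_def by (rule Cauchy_Schwarz_ineq_sum)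
          also have "\<dots> \<le> (\<Sum>i<Suc k. (?Z (s i) \<omega>)\<^sup>2) * (\<Sum>i<Suc k. c)"
            using \<beta> by (intro mult_left_mono sum_mono sum_nonneg) auto
          also have "\<dots> = (m * c) * (\<Sum>i<Suc k. (?Z (s i) \<omega>)\<^sup>2)"
            by (simp add: m_def del: sum.lessThan_Suc)
          finally show ?thesis .
        qed
        have "(\<integral>\<^sup>+\<omega>. ennreal ((X3 \<omega>)\<^sup>2) \<partial>M) \<le> (\<integral>\<^sup>+\<omega>. ennreal ((m * c) * (\<Sum>i<Suc k. (?Z (s i) \<omega>)\<^sup>2)) \<partial>M)"
          by (intro nn_integral_mono ennreal_leI X3)
        also have "\<dots> = ennreal (expectation (\<lambda>\<omega>. (m * c) * (\<Sum>i<Suc k. (?Z (s i) \<omega>)\<^sup>2)))"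
          using Z2(1)[OF s(1,3)] m
          by (intro nn_integral_eq_integral integrable_mult_right Bochner_Integration.integrable_sum AE_I2 mult_nonneg_nonneg sum_nonneg)
             (auto simp: c_def)
        also have "expectation (\<lambda>\<omega>. (m * c) * (\<Sum>i<Suc k. (?Z (s i) \<omega>)\<^sup>2)) = (m * c) * (\<Sum>i<Suc k. expectation (\<lambda>\<omega>. (?Z (s i) \<omega>)\<^sup>2))"
          using Z2(1)[OF s(1,3)] by (subst integral_mult_right_zero, subst Bochner_Integration.integral_sum) auto
        also have "ennreal \<dots> \<le> ennreal ((m * c) * (\<Sum>i<Suc k. C2))"
          using Z2(2)[OF s(1,3)] m by (intro ennreal_leI mult_left_mono sum_mono) (auto simp: c_def)
        also have "(m * c) * (\<Sum>i<Suc k. C2) = C2 * (m\<^sup>2 * c)"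
          by (simp add: m_def power2_eq_square del: sum.lessThan_Suc)
        also have "m\<^sup>2 * c = (B * b\<^sup>2 * T\<^sup>2)\<^sup>2 / m\<^sup>2"
          unfolding c_def using m by (simp add: power_divide power2_eq_square)
        also have "C2 * ((B * b\<^sup>2 * T\<^sup>2)\<^sup>2 / m\<^sup>2) \<le> C2 * ((B * b\<^sup>2 * T\<^sup>2)\<^sup>2 / m)"
          using m pos by (intro mult_left_mono divide_left_mono) (auto simp: power2_eq_square)
        finally show ?thesis by (simp add: ennreal_leI)
      qed
      have n4: "(\<integral>\<^sup>+\<omega>. ennreal ((X4 \<omega>)\<^sup>2) \<partial>M) \<le> ennreal (b\<^sup>2 * T * (Cd * T\<^sup>2) / m)"
      proof -
        let ?p = "\<lambda>\<omega>. \<integral>\<^sup>+t\<in>{0..T}. ennreal ((P k t \<omega> - ?Z t \<omega>)\<^sup>2) \<partial>lborel"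
        have pm: "?p \<in> borel_measurable M" by (rule jointly_measurable_nn_integral[OF jPZ]) auto
        have "(\<integral>\<^sup>+\<omega>. ennreal ((X4 \<omega>)\<^sup>2) \<partial>M) \<le> (\<integral>\<^sup>+\<omega>. ennreal (b\<^sup>2 * T) * ?p \<omega> \<partial>M)"
        proof (rule nn_integral_mono)
          fix \<omega> assume \<omega>: "\<omega> \<in> space M"
          have "ennreal ((X4 \<omega>)\<^sup>2) = ennreal (b\<^sup>2) * ennreal ((LINT u:{0..t}|lborel. ?Z u \<omega> - P k u \<omega>)\<^sup>2)"
            unfolding X4_def by (simp add: power_mult_distrib ennreal_mult)
          also have "\<dots> \<le> ennreal (b\<^sup>2) * (ennreal t * (\<integral>\<^sup>+u\<in>{0..t}. ennreal ((?Z u \<omega> - P k u \<omega>)\<^sup>2) \<partial>lborel))"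
            by (intro mult_left_mono set_integral_square_le t jointly_measurable_section[OF jZP \<omega>]) auto
          also have "\<dots> \<le> ennreal (b\<^sup>2) * (ennreal T * (\<integral>\<^sup>+u\<in>{0..T}. ennreal ((?Z u \<omega> - P k u \<omega>)\<^sup>2) \<partial>lborel))"
            using t by (intro mult_left_mono mult_mono ennreal_leI nn_integral_indicator_mono) auto
          also have "\<dots> = ennreal (b\<^sup>2 * T) * ?p \<omega>"
            using T0 by (simp add: ennreal_mult mult.assoc power2_commute)
          finally show "ennreal ((X4 \<omega>)\<^sup>2) \<le> ennreal (b\<^sup>2 * T) * ?p \<omega>" .
        qed
        also have "\<dots> = ennreal (b\<^sup>2 * T) * (\<integral>\<^sup>+\<omega>. ?p \<omega> \<partial>M)"
          by (rule nn_integral_cmult[OF pm])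
        also have "\<dots> \<le> ennreal (b\<^sup>2 * T) * ennreal (Cd * T\<^sup>2 / m)"
          unfolding m_def by (intro mult_left_mono Perr) auto
        also have "\<dots> = ennreal (b\<^sup>2 * T * (Cd * T\<^sup>2 / m))"
          using T0 Cd(1) m by (subst ennreal_mult) auto
        finally show ?thesis by simp
      qed
      have "(\<integral>\<^sup>+\<omega>. ennreal ((simple_ito_integral W (Suc k) (grid T k) (\<xi> k) t \<omega> - ?I t \<omega>)\<^sup>2) \<partial>M) \<le>
        (\<integral>\<^sup>+\<omega>. 4 * ennreal ((X1 \<omega>)\<^sup>2) + 4 * ennreal ((X2 \<omega>)\<^sup>2) + 4 * ennreal ((X3 \<omega>)\<^sup>2) + 4 * ennreal ((X4 \<omega>)\<^sup>2) \<partial>M)"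
      proof (rule nn_integral_mono)
        fix \<omega> assume \<omega>: "\<omega> \<in> space M"
        have sq: "(x + y + (z + w))\<^sup>2 \<le> 4 * x\<^sup>2 + 4 * y\<^sup>2 + 4 * z\<^sup>2 + 4 * w\<^sup>2" for x y z w :: real
        proof -
          have "0 \<le> (x - y)\<^sup>2 + (x - z)\<^sup>2 + (x - w)\<^sup>2 + (y - z)\<^sup>2 + (y - w)\<^sup>2 + (z - w)\<^sup>2" by simp
          then show ?thesis by (simp add: power2_eq_square algebra_simps)
        qed
        show "ennreal ((simple_ito_integral W (Suc k) (grid T k) (\<xi> k) t \<omega> - ?I t \<omega>)\<^sup>2) \<le>
           4 * ennreal ((X1 \<omega>)\<^sup>2) + 4 * ennreal ((X2 \<omega>)\<^sup>2) + 4 * ennreal ((X3 \<omega>)\<^sup>2) + 4 * ennreal ((X4 \<omega>)\<^sup>2)"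
          unfolding eq[OF \<omega>] using ennreal_leI[OF sq[of "X1 \<omega>" "X2 \<omega>" "X3 \<omega>" "X4 \<omega>"]]
          by (simp add: ennreal_plus ennreal_mult)
      qed
      also have "\<dots> = 4 * (\<integral>\<^sup>+\<omega>. ennreal ((X1 \<omega>)\<^sup>2) \<partial>M) + 4 * (\<integral>\<^sup>+\<omega>. ennreal ((X2 \<omega>)\<^sup>2) \<partial>M) + 4 * (\<integral>\<^sup>+\<omega>. ennreal ((X3 \<omega>)\<^sup>2) \<partial>M) + 4 * (\<integral>\<^sup>+\<omega>. ennreal ((X4 \<omega>)\<^sup>2) \<partial>M)"
        by (simp add: nn_integral_add nn_integral_cmult)
      also have "\<dots> \<le> 4 * ennreal (a\<^sup>2 * C4 * T / m) + 4 * ennreal (C2 * V * T\<^sup>2 / m) + 4 * ennreal (C2 * (B * b\<^sup>2 * T\<^sup>2)\<^sup>2 / m) + 4 * ennreal (b\<^sup>2 * T * (Cd * T\<^sup>2) / m)"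
        by (intro add_mono mult_left_mono n1 n2 n3 n4) auto
      also have "\<dots> = ennreal (4 * (a\<^sup>2 * C4 * T / m) + 4 * (C2 * V * T\<^sup>2 / m) + 4 * (C2 * (B * b\<^sup>2 * T\<^sup>2)\<^sup>2 / m) + 4 * (b\<^sup>2 * T * (Cd * T\<^sup>2) / m))"
      proof -
        have "4 * ennreal x + 4 * ennreal y + 4 * ennreal z + 4 * ennreal w = ennreal (4 * x + 4 * y + 4 * z + 4 * w)"
          if "0 \<le> x" "0 \<le> y" "0 \<le> z" "0 \<le> w" for x y z w
          using that by (simp add: ennreal_plus ennreal_mult)
        then show ?thesis using pos T0 Cd(1) m by simp
      qed
      also have "4 * (a\<^sup>2 * C4 * T / m) + 4 * (C2 * V * T\<^sup>2 / m) + 4 * (C2 * (B * b\<^sup>2 * T\<^sup>2)\<^sup>2 / m) + 4 * (b\<^sup>2 * T * (Cd * T\<^sup>2) / m) =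
        (4 * (a\<^sup>2 * C4 * T) + 4 * (C2 * V * T\<^sup>2) + 4 * (C2 * (B * b\<^sup>2 * T\<^sup>2)\<^sup>2) + 4 * (b\<^sup>2 * T * (Cd * T\<^sup>2))) / m"
        by (simp only: add_divide_distrib times_divide_eq_right)
      finally show ?thesis unfolding m_def .
    qed
    show ?thesis
    proof (intro exI conjI allI ballI)
      show "simple_data M F (Suc k) (grid T k) (\<xi> k)" for k by (rule sd)
      show "(\<lambda>k. \<integral>\<^sup>+\<omega>. (\<integral>\<^sup>+t\<in>{0..T}. ennreal ((simple_process (Suc k) (grid T k) (\<xi> k) t \<omega> - ?H t \<omega>)\<^sup>2) \<partial>lborel) \<partial>M) \<longlonglongrightarrow> 0"
        by (rule tendsto_sandwich[OF _ _ tendsto_const lim]) (auto intro!: always_eventually E3 simp del: of_nat_Suc)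
      fix t assume "t \<in> {0..T}"
      then have t: "0 \<le> t" "t \<le> T" by auto
      show "(\<lambda>k. \<integral>\<^sup>+\<omega>. ennreal ((simple_ito_integral W (Suc k) (grid T k) (\<xi> k) t \<omega> - ?I t \<omega>)\<^sup>2) \<partial>M) \<longlonglongrightarrow> 0"
        by (rule tendsto_sandwich[OF _ _ tendsto_const lim]) (auto intro!: always_eventually main[OF t] simp del: of_nat_Suc)
    qed
  qed
  ultimately show ?thesis unfolding is_ito_integral_def by blast
qed

end

subsection \<open>The lower bound\<close>

lemma nn_integral_exp_Icc_finite:
  fixes k \<theta> R :: real
  assumes "0 \<le> k" "0 < R"
  shows "(\<integral>\<^sup>+t\<in>{0..R}. ennreal (k * exp (\<theta> * t)) \<partial>lborel) < \<infinity>"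
proof -
  have "(\<integral>\<^sup>+t\<in>{0..R}. ennreal (k * exp (\<theta> * t)) \<partial>lborel) \<le> (\<integral>\<^sup>+t\<in>{0..R}. ennreal (k * exp (\<bar>\<theta>\<bar> * R)) \<partial>lborel)"
  proof (intro nn_integral_mono)
    fix t
    have "\<theta> * t \<le> \<bar>\<theta>\<bar> * R" if "t \<in> {0..R}"
    proof -
      have "\<theta> * t \<le> \<bar>\<theta>\<bar> * t" using that by (intro mult_right_mono) auto
      also have "\<dots> \<le> \<bar>\<theta>\<bar> * R" using that by (intro mult_left_mono) auto
      finally show ?thesis .
    qed
    then show "ennreal (k * exp (\<theta> * t)) * indicator {0..R} t \<le> ennreal (k * exp (\<bar>\<theta>\<bar> * R)) * indicator {0..R} t"
      using assms by (auto simp: indicator_def intro!: ennreal_leI mult_left_mono)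
  qed
  also have "\<dots> < \<infinity>" using assms
    by (subst nn_integral_cmult_indicator) (auto simp: ennreal_mult_less_top)
  finally show ?thesis .
qed

lemma nn_integral_exp_atLeast_finite:
  fixes k \<eta> :: real
  assumes "0 \<le> k" "0 < \<eta>"
  shows "(\<integral>\<^sup>+t\<in>{0..}. ennreal (k * exp (- \<eta> * t)) \<partial>lborel) < \<infinity>"
proof -
  have "(\<integral>\<^sup>+t\<in>{0..}. ennreal (k * exp (- \<eta> * t)) \<partial>lborel) = ennreal (0 - (- k / \<eta> * exp (- \<eta> * 0)))"
  proof (rule nn_integral_FTC_atLeast)
    have "((\<lambda>t. - k / \<eta> * exp (- \<eta> * t)) \<longlongrightarrow> - k / \<eta> * 0) at_top"
    proof (intro tendsto_mult tendsto_const filterlim_compose[OF exp_at_bot])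
      have "filterlim (\<lambda>t. \<eta> * t) at_top at_top"
        using assms by (intro filterlim_tendsto_pos_mult_at_top[OF tendsto_const]) (auto simp: filterlim_ident)
      then show "filterlim (\<lambda>t. - \<eta> * t) at_bot at_top"
        by (simp add: filterlim_uminus_at_bot)
    qed
    then show "((\<lambda>t. - k / \<eta> * exp (- \<eta> * t)) \<longlongrightarrow> 0) at_top" by simp
  qed (use assms in \<open>auto intro!: derivative_eq_intros\<close>)
  then show ?thesis by simp
qed

context brownian
begin

text \<open>Fubini and \<open>gbm_powr\<close>. The weight \<open>w\<close> and the time set
  \<open>A\<close> are free, so that the local integrability of consumption and portfolio as well as
  the discounted objective are instances.\<close>

lemma nn_integral_gbm_powr:
  fixes w :: "real \<Rightarrow> real"
  assumes w[measurable]: "w \<in> borel_measurable borel" and w0: "\<And>t. 0 \<le> w t"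
    and A[measurable]: "A \<in> sets borel" and A0: "A \<subseteq> {0..}"
  shows "(\<integral>\<^sup>+\<omega>. (\<integral>\<^sup>+t\<in>A. ennreal (w t * gbm a b t \<omega> powr q) \<partial>lborel) \<partial>M) =
     (\<integral>\<^sup>+t\<in>A. ennreal (w t * exp ((q * b + (q\<^sup>2 - q) * a\<^sup>2 / 2) * t)) \<partial>lborel)"
proof -
  interpret P: pair_sigma_finite M lborel ..
  have c: "(\<lambda>z. gbm a b (max 0 (snd z)) (fst z)) \<in> borel_measurable (M \<Otimes>\<^sub>M borel)"
    using jointly_measurable_clip[OF gbm_jointly_measurable[of a b]] by (simp add: split_beta)
  then have "(\<lambda>z. ennreal (w (snd z) * gbm a b (max 0 (snd z)) (fst z) powr q) * indicator A (snd z)) \<in> borel_measurable (M \<Otimes>\<^sub>M borel)"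
    by measurable
  then have m: "(\<lambda>(\<omega>, t). ennreal (w t * gbm a b (max 0 t) \<omega> powr q) * indicator A t) \<in> borel_measurable (M \<Otimes>\<^sub>M lborel)"
    by (simp add: split_beta cong: measurable_cong_sets)
  have "(\<integral>\<^sup>+\<omega>. (\<integral>\<^sup>+t\<in>A. ennreal (w t * gbm a b t \<omega> powr q) \<partial>lborel) \<partial>M) =
      (\<integral>\<^sup>+\<omega>. (\<integral>\<^sup>+t. ennreal (w t * gbm a b (max 0 t) \<omega> powr q) * indicator A t \<partial>lborel) \<partial>M)"
    using A0 by (intro nn_integral_cong) (auto simp: indicator_def max_def)
  also have "\<dots> = (\<integral>\<^sup>+t. (\<integral>\<^sup>+\<omega>. ennreal (w t * gbm a b (max 0 t) \<omega> powr q) * indicator A t \<partial>M) \<partial>lborel)"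
    by (rule P.Fubini'[OF m, symmetric])
  also have "\<dots> = (\<integral>\<^sup>+t\<in>A. ennreal (w t * exp ((q * b + (q\<^sup>2 - q) * a\<^sup>2 / 2) * t)) \<partial>lborel)"
  proof (rule nn_integral_cong)
    fix t
    show "(\<integral>\<^sup>+\<omega>. ennreal (w t * gbm a b (max 0 t) \<omega> powr q) * indicator A t \<partial>M) =
       ennreal (w t * exp ((q * b + (q\<^sup>2 - q) * a\<^sup>2 / 2) * t)) * indicator A t"
    proof (cases "t \<in> A")
      case True
      then have t: "0 \<le> t" using A0 by auto
      have "(\<integral>\<^sup>+\<omega>. ennreal (w t * gbm a b t \<omega> powr q) \<partial>M) = ennreal (expectation (\<lambda>\<omega>. w t * gbm a b t \<omega> powr q))"
        using gbm_powr[OF t, of a b q] w0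
        by (intro nn_integral_eq_integral) (auto simp: has_bochner_integral_iff)
      also have "expectation (\<lambda>\<omega>. w t * gbm a b t \<omega> powr q) = w t * exp ((q * b + (q\<^sup>2 - q) * a\<^sup>2 / 2) * t)"
        using gbm_powr[OF t, of a b q] by (simp add: has_bochner_integral_iff)
      finally show ?thesis using True t by simp
    qed simp
  qed
  finally show ?thesis .
qed

text \<open>With proportional feedback all quantities are powers of one geometric Brownian motion,
  and the expected discounted disutility is an explicit exponential in time, here
  \<open>k * exp (- \<eta> * s)\<close>.\<close>

lemma finite_objective_exists:
  assumes \<sigma>: "\<sigma> > 0" and \<gamma>: "\<gamma> > 1" and \<rho>: "\<rho> > (1 - \<gamma>) * (r + l\<^sup>2 / (2 * \<gamma>))"
  shows "\<exists>(c, \<pi>)\<in>admissible M F W r \<sigma> l 1. \<exists>A. objective M \<rho> \<gamma> c = ereal A"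
proof -
  \<comment> \<open>Half of the gap in the hypothesis on \<open>\<rho>\<close>. Consumption takes up
    one half, the other half remains as the rate of decay.\<close>
  define \<eta> where "\<eta> = (\<rho> - (1 - \<gamma>) * (r + l\<^sup>2 / (2 * \<gamma>))) / 2"
  \<comment> \<open>Chosen so that \<open>(\<gamma> - 1) * \<kappa> = \<eta>\<close>, the amount by
    which consuming at rate \<open>\<kappa>\<close> raises the growth exponent of the
    disutility.\<close>
  define \<kappa> where "\<kappa> = \<eta> / (\<gamma> - 1)"
  \<comment> \<open>The volatility of wealth under the Merton portfolio: it maximises
    \<open>l * a - \<gamma> * a\<^sup>2 / 2\<close>, and the maximum is the term
    \<open>l\<^sup>2 / (2 * \<gamma>)\<close> of the hypothesis.\<close>
  define a where "a = l / \<gamma>"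
  define b where "b = r + l * a - \<kappa>"
  have pos: "0 < \<eta>" "0 < \<kappa>" using \<rho> \<gamma> by (auto simp: \<eta>_def \<kappa>_def)
  define X where "X = gbm a b"
  define c where "c t \<omega> = \<kappa> * X t \<omega>" for t \<omega>
  define \<pi> where "\<pi> t \<omega> = a / \<sigma> * X t \<omega>" for t \<omega>
  have Xpos: "0 < X t \<omega>" for t \<omega> unfolding X_def by (rule gbm_pos)
  have aX: "adapted F X" unfolding adapted_def X_def using gbm_adapted by blast
  have jX: "jointly_measurable M X" unfolding X_def by (rule gbm_jointly_measurable)
  have cL: "c \<in> L1_loc_nonneg M F"
    unfolding L1_loc_nonneg_def
  proof (intro CollectI conjI allI impI ballI)
    show "adapted F c" using aX unfolding adapted_def c_def by (auto intro!: borel_measurable_times)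
    show "jointly_measurable M c" using jX unfolding jointly_measurable_def c_def split_beta by measurable
    show "0 \<le> c t \<omega>" for t \<omega> using pos Xpos[of t \<omega>] by (simp add: c_def)
    fix R :: real assume R: "0 < R"
    have "(\<integral>\<^sup>+\<omega>. (\<integral>\<^sup>+t\<in>{0..R}. ennreal \<bar>c t \<omega>\<bar> \<partial>lborel) \<partial>M) = (\<integral>\<^sup>+\<omega>. (\<integral>\<^sup>+t\<in>{0..R}. ennreal (\<kappa> * gbm a b t \<omega> powr 1) \<partial>lborel) \<partial>M)"
      using pos gbm_pos less_imp_le[OF gbm_pos] by (simp add: c_def X_def abs_mult)
    also have "\<dots> = (\<integral>\<^sup>+t\<in>{0..R}. ennreal (\<kappa> * exp ((1 * b + (1\<^sup>2 - 1) * a\<^sup>2 / 2) * t)) \<partial>lborel)"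
      using pos by (intro nn_integral_gbm_powr) auto
    also have "\<dots> < \<infinity>" using pos R by (intro nn_integral_exp_Icc_finite) auto
    finally show "(\<integral>\<^sup>+\<omega>. (\<integral>\<^sup>+t\<in>{0..R}. ennreal \<bar>c t \<omega>\<bar> \<partial>lborel) \<partial>M) < \<infinity>" .
  qed
  have \<pi>L: "\<pi> \<in> L2_loc M F"
    unfolding L2_loc_def
  proof (intro CollectI conjI allI impI)
    show "adapted F \<pi>" using aX unfolding adapted_def \<pi>_def by (auto intro!: borel_measurable_times)
    show "jointly_measurable M \<pi>" using jX unfolding jointly_measurable_def \<pi>_def split_beta by measurable
    fix R :: real assume R: "0 < R"
    have "\<bar>\<pi> t \<omega>\<bar>\<^sup>2 = (a / \<sigma>)\<^sup>2 * gbm a b t \<omega> powr 2" for t \<omega>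
      using gbm_pos[of a b t \<omega>] by (simp add: \<pi>_def X_def power_mult_distrib powr_numeral power_divide)
    then have "(\<integral>\<^sup>+\<omega>. (\<integral>\<^sup>+t\<in>{0..R}. ennreal (\<bar>\<pi> t \<omega>\<bar>\<^sup>2) \<partial>lborel) \<partial>M) = (\<integral>\<^sup>+\<omega>. (\<integral>\<^sup>+t\<in>{0..R}. ennreal ((a / \<sigma>)\<^sup>2 * gbm a b t \<omega> powr 2) \<partial>lborel) \<partial>M)"
      by (simp only:)
    also have "\<dots> = (\<integral>\<^sup>+t\<in>{0..R}. ennreal ((a / \<sigma>)\<^sup>2 * exp ((2 * b + (2\<^sup>2 - 2) * a\<^sup>2 / 2) * t)) \<partial>lborel)"
      by (intro nn_integral_gbm_powr) auto
    also have "\<dots> < \<infinity>" using R by (intro nn_integral_exp_Icc_finite) auto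
    finally show "(\<integral>\<^sup>+\<omega>. (\<integral>\<^sup>+t\<in>{0..R}. ennreal (\<bar>\<pi> t \<omega>\<bar>\<^sup>2) \<partial>lborel) \<partial>M) < \<infinity>" .
  qed
  have wealth: "wealth_process M F W r \<sigma> l 1 c \<pi> X"
    unfolding wealth_process_def
  proof (intro conjI exI)
    show "adapted F X" by (rule aX)
    show "continuous_paths M X"
      unfolding continuous_paths_def X_def by (intro AE_I2 gbm_continuous)
    have "(\<lambda>t \<omega>. \<sigma> * \<pi> t \<omega>) = (\<lambda>t \<omega>. a * gbm a b t \<omega>)"
      using \<sigma> by (simp add: \<pi>_def X_def)
    then show "is_ito_integral M F W (\<lambda>t \<omega>. \<sigma> * \<pi> t \<omega>) (\<lambda>t \<omega>. gbm a b t \<omega> - 1 - b * (LINT s:{0..t}|lborel. gbm a b s \<omega>))"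
      using gbm_integral_ito[of a b] by simp
    show "AE \<omega> in M. \<forall>t\<ge>0. X t \<omega> = 1 + (LINT s:{0..t}|lborel. r * X s \<omega> + \<sigma> * l * \<pi> s \<omega>) +
        (gbm a b t \<omega> - 1 - b * (LINT s:{0..t}|lborel. gbm a b s \<omega>)) - (LINT s:{0..t}|lborel. c s \<omega>)"
    proof (intro AE_I2 allI impI)
      fix \<omega> and t :: real
      have "(\<lambda>s. r * X s \<omega> + \<sigma> * l * \<pi> s \<omega>) = (\<lambda>s. (r + l * a) * X s \<omega>)"
        using \<sigma> by (auto simp: \<pi>_def fun_eq_iff algebra_simps)
      then have "(LINT s:{0..t}|lborel. r * X s \<omega> + \<sigma> * l * \<pi> s \<omega>) = (r + l * a) * (LINT s:{0..t}|lborel. X s \<omega>)"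
        by simp
      moreover have "(LINT s:{0..t}|lborel. c s \<omega>) = \<kappa> * (LINT s:{0..t}|lborel. X s \<omega>)"
        unfolding c_def by simp
      moreover have "b * (LINT s:{0..t}|lborel. X s \<omega>) = (r + l * a) * (LINT s:{0..t}|lborel. X s \<omega>) - \<kappa> * (LINT s:{0..t}|lborel. X s \<omega>)"
        unfolding b_def by (rule left_diff_distrib)
      ultimately show "X t \<omega> = 1 + (LINT s:{0..t}|lborel. r * X s \<omega> + \<sigma> * l * \<pi> s \<omega>) +
        (gbm a b t \<omega> - 1 - b * (LINT s:{0..t}|lborel. gbm a b s \<omega>)) - (LINT s:{0..t}|lborel. c s \<omega>)"
        unfolding X_def[symmetric] by linarith
    qed
  qed
  have adm: "(c, \<pi>) \<in> admissible M F W r \<sigma> l 1"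
    unfolding admissible_def using cL \<pi>L wealth less_imp_le[OF Xpos] by auto
  define k where "k = \<kappa> powr (1 - \<gamma>) / (\<gamma> - 1)"
  have k0: "0 \<le> k" using \<gamma> by (simp add: k_def)
  let ?\<theta> = "(1 - \<gamma>) * b + ((1 - \<gamma>)\<^sup>2 - (1 - \<gamma>)) * a\<^sup>2 / 2"
  have "(\<integral>\<^sup>+\<omega>. (\<integral>\<^sup>+s\<in>{0..}. disutility \<rho> \<gamma> s (c s \<omega>) \<partial>lborel) \<partial>M) =
     (\<integral>\<^sup>+\<omega>. (\<integral>\<^sup>+s\<in>{0..}. ennreal ((k * exp (- \<rho> * s)) * gbm a b s \<omega> powr (1 - \<gamma>)) \<partial>lborel) \<partial>M)"
  proof (intro nn_integral_cong arg_cong2[where f="(*)"] refl)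
    fix \<omega> and s :: real
    have "c s \<omega> \<noteq> 0" using pos Xpos[of s \<omega>] by (simp add: c_def)
    moreover have "(c s \<omega>) powr (1 - \<gamma>) = \<kappa> powr (1 - \<gamma>) * gbm a b s \<omega> powr (1 - \<gamma>)"
      unfolding c_def X_def using pos gbm_pos[of a b s \<omega>] by (simp add: powr_mult)
    ultimately show "disutility \<rho> \<gamma> s (c s \<omega>) = ennreal ((k * exp (- \<rho> * s)) * gbm a b s \<omega> powr (1 - \<gamma>))"
      by (simp add: disutility_nonzero k_def mult_ac)
  qed
  also have "\<dots> = (\<integral>\<^sup>+s\<in>{0..}. ennreal ((k * exp (- \<rho> * s)) * exp (?\<theta> * s)) \<partial>lborel)"
    using k0 by (intro nn_integral_gbm_powr) auto
  also have "\<dots> = (\<integral>\<^sup>+s\<in>{0..}. ennreal (k * exp (- \<eta> * s)) \<partial>lborel)"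
  proof -
    \<comment> \<open>The exponent factors into \<open>1 - \<gamma>\<close> and the risk-adjusted
      growth rate of wealth, drift minus \<open>\<gamma> * a\<^sup>2 / 2\<close>, in which the
      choice of \<open>a\<close> can be inserted.\<close>
    have "?\<theta> = (1 - \<gamma>) * (b - \<gamma> * a\<^sup>2 / 2)"
      by (simp add: power2_eq_square field_simps)
    also have "b - \<gamma> * a\<^sup>2 / 2 = r + l\<^sup>2 / (2 * \<gamma>) - \<kappa>"
      unfolding b_def a_def using \<gamma> by (simp add: power2_eq_square field_simps)
    also have "(1 - \<gamma>) * \<dots> = (1 - \<gamma>) * (r + l\<^sup>2 / (2 * \<gamma>)) - (1 - \<gamma>) * \<kappa>" by (rule right_diff_distrib)
    also have "(1 - \<gamma>) * \<kappa> = - \<eta>" unfolding \<kappa>_def using \<gamma> by (simp add: field_simps)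
    finally have "?\<theta> = (1 - \<gamma>) * (r + l\<^sup>2 / (2 * \<gamma>)) - - \<eta>" .
    moreover have "2 * \<eta> = \<rho> - (1 - \<gamma>) * (r + l\<^sup>2 / (2 * \<gamma>))" by (simp add: \<eta>_def)
    ultimately have "- \<rho> + ?\<theta> = - \<eta>" by linarith
    then have "(- \<rho> + ?\<theta>) * s = - \<eta> * s" for s by (simp only:)
    then have "exp (- \<rho> * s) * exp (?\<theta> * s) = exp (- \<eta> * s)" for s
      unfolding mult_exp_exp distrib_right[symmetric] by (simp only:)
    then show ?thesis by (simp only: mult.assoc)
  qed
  also have "\<dots> < \<infinity>" by (rule nn_integral_exp_atLeast_finite[OF k0 pos(1)])
  finally have "(\<integral>\<^sup>+\<omega>. (\<integral>\<^sup>+s\<in>{0..}. disutility \<rho> \<gamma> s (c s \<omega>) \<partial>lborel) \<partial>M) < \<infinity>" .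
  moreover obtain O1 where O1: "O1 = (\<integral>\<^sup>+\<omega>. (\<integral>\<^sup>+s\<in>{0..}. disutility \<rho> \<gamma> s (c s \<omega>) \<partial>lborel) \<partial>M)" by blast
  ultimately obtain A where "0 \<le> A" "O1 = ennreal A" by (cases O1) auto
  then have "objective M \<rho> \<gamma> c = ereal (- A)"
    unfolding objective_disutility O1[symmetric] by (simp add: enn2ereal_ennreal)
  then show ?thesis using adm by blast
qed

end

subsection \<open>Scaling\<close>

lemma jointly_measurable_scale:
  "jointly_measurable M Z \<Longrightarrow> jointly_measurable M (\<lambda>t \<omega>. k * Z t \<omega>)"
  unfolding jointly_measurable_def split_beta by measurable

lemma nn_integral_scale:
  assumes jZ: "jointly_measurable M Z" and g[measurable]: "g \<in> borel_measurable borel" and g0: "g 0 = (0::real)"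
  shows "(\<integral>\<^sup>+\<omega>. (\<integral>\<^sup>+t\<in>{0..R}. ennreal v * ennreal (g (Z t \<omega>)) \<partial>lborel) \<partial>M) =
    ennreal v * (\<integral>\<^sup>+\<omega>. (\<integral>\<^sup>+t\<in>{0..R}. ennreal (g (Z t \<omega>)) \<partial>lborel) \<partial>M)"
proof -
  have "(\<integral>\<^sup>+t\<in>{0..R}. ennreal v * ennreal (g (Z t \<omega>)) \<partial>lborel) = ennreal v * (\<integral>\<^sup>+t\<in>{0..R}. ennreal (g (Z t \<omega>)) \<partial>lborel)"
    if \<omega>: "\<omega> \<in> space M" for \<omega>
  proof -
    have "(\<lambda>t. ennreal (g (indicator {0..R} t * Z t \<omega>))) \<in> borel_measurable lborel"
      using jointly_measurable_section[OF jZ \<omega>, of R] by measurable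
    moreover have "(\<lambda>t. ennreal (g (indicator {0..R} t * Z t \<omega>))) = (\<lambda>t. ennreal (g (Z t \<omega>)) * indicator {0..R} t)"
      using g0 by (auto simp: indicator_def)
    ultimately have m: "(\<lambda>t. ennreal (g (Z t \<omega>)) * indicator {0..R} t) \<in> borel_measurable lborel" by (simp only:)
    show ?thesis unfolding mult.assoc by (rule nn_integral_cmult[OF m])
  qed
  moreover have "(\<lambda>\<omega>. \<integral>\<^sup>+t\<in>{0..R}. ennreal (g (Z t \<omega>)) \<partial>lborel) \<in> borel_measurable M"
    by (rule jointly_measurable_nn_integral[OF jZ g g0])
  ultimately show ?thesis by (simp add: nn_integral_cmult cong: nn_integral_cong)
qed

lemma disutility_scale:
  assumes "0 < k" "0 \<le> y"
  shows "disutility \<rho> \<gamma> s (k * y) = ennreal (k powr (1 - \<gamma>)) * disutility \<rho> \<gamma> s y"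
proof (cases "y = 0")
  case True
  then show ?thesis using assms by (simp add: disutility_zero ennreal_mult_top)
next
  case False
  then have eq: "exp (- \<rho> * s) * ((k * y) powr (1 - \<gamma>) / (\<gamma> - 1)) = k powr (1 - \<gamma>) * (exp (- \<rho> * s) * (y powr (1 - \<gamma>) / (\<gamma> - 1)))"
    using assms by (simp add: powr_mult)
  have "k * y \<noteq> 0" using False assms by simp
  then show ?thesis unfolding disutility_nonzero[OF \<open>k * y \<noteq> 0\<close>] disutility_nonzero[OF False] eq
    by (intro ennreal_mult') simp
qed

context brownian
begin

text \<open>The approximating coefficients are multiplied by \<open>k\<close>, which multiplies both
  mean square errors by \<open>k\<^sup>2\<close>. Measurability of \<open>H\<close> is needed to
  pull this factor out of the nonnegative integrals.\<close>

lemma is_ito_integral_scale: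
  assumes jH: "jointly_measurable M H" and ito: "is_ito_integral M F W H I"
  shows "is_ito_integral M F W (\<lambda>t \<omega>. k * H t \<omega>) (\<lambda>t \<omega>. k * I t \<omega>)"
proof -
  have aI: "adapted F I" and cI: "continuous_paths M I" using ito by (auto simp: is_ito_integral_def)
  have "adapted F (\<lambda>t \<omega>. k * I t \<omega>)"
    using aI unfolding adapted_def by (auto intro!: borel_measurable_times)
  moreover have "continuous_paths M (\<lambda>t \<omega>. k * I t \<omega>)"
    using cI unfolding continuous_paths_def by eventually_elim (intro continuous_intros)
  moreover have "\<exists>n \<tau> \<xi>.
        (\<forall>k. simple_data M F (n k) (\<tau> k) (\<xi> k)) \<and>
        (\<lambda>j::nat. \<integral>\<^sup>+\<omega>. (\<integral>\<^sup>+t\<in>{0..T}.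
           ennreal ((simple_process (n j) (\<tau> j) (\<xi> j) t \<omega> - k * H t \<omega>)\<^sup>2) \<partial>lborel) \<partial>M)
          \<longlonglongrightarrow> 0 \<and>
        (\<forall>t\<in>{0..T}.
           (\<lambda>j. \<integral>\<^sup>+\<omega>. ennreal ((simple_ito_integral W (n j) (\<tau> j) (\<xi> j) t \<omega> - k * I t \<omega>)\<^sup>2) \<partial>M)
             \<longlonglongrightarrow> 0)" if T: "0 < T" for T
  proof -
    from ito T obtain n \<tau> \<xi> where sd: "\<And>j. simple_data M F (n j) (\<tau> j) (\<xi> j)"
      and Q: "(\<lambda>j::nat. \<integral>\<^sup>+\<omega>. (\<integral>\<^sup>+t\<in>{0..T}. ennreal ((simple_process (n j) (\<tau> j) (\<xi> j) t \<omega> - H t \<omega>)\<^sup>2) \<partial>lborel) \<partial>M) \<longlonglongrightarrow> 0"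
      and e: "\<forall>t\<in>{0..T}. (\<lambda>j. \<integral>\<^sup>+\<omega>. ennreal ((simple_ito_integral W (n j) (\<tau> j) (\<xi> j) t \<omega> - I t \<omega>)\<^sup>2) \<partial>M) \<longlonglongrightarrow> 0"
      unfolding is_ito_integral_def by blast
    note D = simple_dataD[OF sd]
    let ?\<xi> = "\<lambda>j i \<omega>. k * \<xi> j i \<omega>"
    have sq: "ennreal ((k * x - k * y)\<^sup>2) = ennreal (k\<^sup>2) * ennreal ((x - y)\<^sup>2)" for x y :: real
      by (simp add: right_diff_distrib[symmetric] power_mult_distrib ennreal_mult)
    have sp: "simple_process (n j) (\<tau> j) (?\<xi> j) t \<omega> = k * simple_process (n j) (\<tau> j) (\<xi> j) t \<omega>" for j t \<omega>
      unfolding simple_process_def sum_distrib_left by (simp add: mult.assoc)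
    have si: "simple_ito_integral W (n j) (\<tau> j) (?\<xi> j) t \<omega> = k * simple_ito_integral W (n j) (\<tau> j) (\<xi> j) t \<omega>" for j t \<omega>
      unfolding simple_ito_integral_def sum_distrib_left by (simp add: mult.assoc)
    have sd': "simple_data M F (n j) (\<tau> j) (?\<xi> j)" for j
      unfolding simple_data_def
    proof (intro conjI allI impI)
      show "0 \<le> \<tau> j 0" "\<And>i. i < n j \<Longrightarrow> \<tau> j i \<le> \<tau> j (Suc i)" using D by auto
      fix i assume i: "i < n j"
      show "?\<xi> j i \<in> borel_measurable (F (\<tau> j i))" using D(4)[OF i] by measurable
      obtain B where "\<forall>\<omega>\<in>space M. \<bar>\<xi> j i \<omega>\<bar> \<le> B"
        using sd[of j] i unfolding simple_data_def by blast
      then have "\<forall>\<omega>\<in>space M. \<bar>?\<xi> j i \<omega>\<bar> \<le> \<bar>k\<bar> * B"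
        by (auto simp: abs_mult intro: mult_left_mono)
      then show "\<exists>B. \<forall>\<omega>\<in>space M. \<bar>?\<xi> j i \<omega>\<bar> \<le> B" by blast
    qed
    have 1: "(\<integral>\<^sup>+\<omega>. (\<integral>\<^sup>+t\<in>{0..T}. ennreal ((simple_process (n j) (\<tau> j) (?\<xi> j) t \<omega> - k * H t \<omega>)\<^sup>2) \<partial>lborel) \<partial>M) =
       ennreal (k\<^sup>2) * (\<integral>\<^sup>+\<omega>. (\<integral>\<^sup>+t\<in>{0..T}. ennreal ((simple_process (n j) (\<tau> j) (\<xi> j) t \<omega> - H t \<omega>)\<^sup>2) \<partial>lborel) \<partial>M)" for j
    proof -
      have jd: "jointly_measurable M (\<lambda>t \<omega>. simple_process (n j) (\<tau> j) (\<xi> j) t \<omega> - H t \<omega>)"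
        using D(5) by (intro jointly_measurable_diff jH jointly_measurable_simple_process) auto
      have "(\<integral>\<^sup>+t\<in>{0..T}. ennreal ((simple_process (n j) (\<tau> j) (?\<xi> j) t \<omega> - k * H t \<omega>)\<^sup>2) \<partial>lborel) =
         ennreal (k\<^sup>2) * (\<integral>\<^sup>+t\<in>{0..T}. ennreal ((simple_process (n j) (\<tau> j) (\<xi> j) t \<omega> - H t \<omega>)\<^sup>2) \<partial>lborel)"
        if \<omega>: "\<omega> \<in> space M" for \<omega>
      proof -
        have "(\<lambda>t. ennreal ((indicator {0..T} t * (simple_process (n j) (\<tau> j) (\<xi> j) t \<omega> - H t \<omega>))\<^sup>2)) \<in> borel_measurable lborel"
          using jointly_measurable_section[OF jd \<omega>, of T] by measurable
        moreover have "(\<lambda>t. ennreal ((indicator {0..T} t * (simple_process (n j) (\<tau> j) (\<xi> j) t \<omega> - H t \<omega>))\<^sup>2)) =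
           (\<lambda>t. ennreal ((simple_process (n j) (\<tau> j) (\<xi> j) t \<omega> - H t \<omega>)\<^sup>2) * indicator {0..T} t)"
          by (auto simp: indicator_def)
        ultimately have m: "(\<lambda>t. ennreal ((simple_process (n j) (\<tau> j) (\<xi> j) t \<omega> - H t \<omega>)\<^sup>2) * indicator {0..T} t) \<in> borel_measurable lborel"
          by (simp only:)
        show ?thesis
          unfolding sp sq mult.assoc by (rule nn_integral_cmult[OF m])
      qed
      moreover have "(\<lambda>\<omega>. \<integral>\<^sup>+t\<in>{0..T}. ennreal ((simple_process (n j) (\<tau> j) (\<xi> j) t \<omega> - H t \<omega>)\<^sup>2) \<partial>lborel) \<in> borel_measurable M"
        by (rule jointly_measurable_nn_integral[OF jd]) auto
      ultimately show ?thesis by (simp add: nn_integral_cmult cong: nn_integral_cong)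
    qed
    have 2: "(\<integral>\<^sup>+\<omega>. ennreal ((simple_ito_integral W (n j) (\<tau> j) (?\<xi> j) t \<omega> - k * I t \<omega>)\<^sup>2) \<partial>M) =
       ennreal (k\<^sup>2) * (\<integral>\<^sup>+\<omega>. ennreal ((simple_ito_integral W (n j) (\<tau> j) (\<xi> j) t \<omega> - I t \<omega>)\<^sup>2) \<partial>M)" if t: "t \<in> {0..T}" for j t
    proof -
      have [measurable]: "I t \<in> borel_measurable M" "simple_ito_integral W (n j) (\<tau> j) (\<xi> j) t \<in> borel_measurable M"
        using aI t measurable_F_M simple_ito_measurable[OF sd] by (auto simp: adapted_def)
      show ?thesis unfolding si sq by (intro nn_integral_cmult) measurable
    qed
    have lim: "(\<lambda>j. ennreal (k\<^sup>2) * f j) \<longlonglongrightarrow> 0" if "f \<longlonglongrightarrow> 0" for f :: "nat \<Rightarrow> ennreal"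
      using ennreal_tendsto_cmult[OF _ that, of "ennreal (k\<^sup>2)"] by simp
    show ?thesis
    proof (intro exI conjI allI ballI)
      show "simple_data M F (n j) (\<tau> j) (?\<xi> j)" for j by (rule sd')
      show "(\<lambda>j::nat. \<integral>\<^sup>+\<omega>. (\<integral>\<^sup>+t\<in>{0..T}. ennreal ((simple_process (n j) (\<tau> j) (?\<xi> j) t \<omega> - k * H t \<omega>)\<^sup>2) \<partial>lborel) \<partial>M) \<longlonglongrightarrow> 0"
        unfolding 1 by (rule lim[OF Q])
      show "(\<lambda>j. \<integral>\<^sup>+\<omega>. ennreal ((simple_ito_integral W (n j) (\<tau> j) (?\<xi> j) t \<omega> - k * I t \<omega>)\<^sup>2) \<partial>M) \<longlonglongrightarrow> 0"
        if t: "t \<in> {0..T}" for t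
        unfolding 2[OF t] using e t by (intro lim) auto
    qed
  qed
  ultimately show ?thesis unfolding is_ito_integral_def by blast
qed

text \<open>The wealth equation is linear in wealth, consumption, portfolio and initial capital
  together, and a positive factor preserves the sign constraints.\<close>

lemma admissible_scale:
  assumes adm: "(c, \<pi>) \<in> admissible M F W r \<sigma> l x" and k: "0 < k"
  shows "(\<lambda>t \<omega>. k * c t \<omega>, \<lambda>t \<omega>. k * \<pi> t \<omega>) \<in> admissible M F W r \<sigma> l (k * x)"
proof -
  from adm obtain X I where c: "c \<in> L1_loc_nonneg M F" and \<pi>: "\<pi> \<in> L2_loc M F"
    and Xa: "adapted F X" and Xc: "continuous_paths M X" and ito: "is_ito_integral M F W (\<lambda>t \<omega>. \<sigma> * \<pi> t \<omega>) I"
    and eq: "AE \<omega> in M. \<forall>t\<ge>0.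
           X t \<omega> = x + (LINT s:{0..t}|lborel. r * X s \<omega> + \<sigma> * l * \<pi> s \<omega>) + I t \<omega>
                     - (LINT s:{0..t}|lborel. c s \<omega>)"
    and X0: "AE \<omega> in M. \<forall>t\<ge>0. 0 \<le> X t \<omega>"
    unfolding admissible_def wealth_process_def by auto
  have jc: "jointly_measurable M c" and j\<pi>: "jointly_measurable M \<pi>"
    using c \<pi> by (auto simp: L1_loc_nonneg_def L2_loc_def)
  have sc: "adapted F (\<lambda>t \<omega>. k * Z t \<omega>)" if "adapted F Z" for Z
    using that unfolding adapted_def by (auto intro!: borel_measurable_times)
  have "(\<lambda>t \<omega>. k * c t \<omega>) \<in> L1_loc_nonneg M F"
    unfolding L1_loc_nonneg_def
  proof (intro CollectI conjI allI impI ballI)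
    show "adapted F (\<lambda>t \<omega>. k * c t \<omega>)" using c by (intro sc) (auto simp: L1_loc_nonneg_def)
    show "jointly_measurable M (\<lambda>t \<omega>. k * c t \<omega>)" by (rule jointly_measurable_scale[OF jc])
    show "0 \<le> k * c t \<omega>" if "0 \<le> t" "\<omega> \<in> space M" for t \<omega>
      using c k that by (auto simp: L1_loc_nonneg_def)
    fix R :: real assume "0 < R"
    then have fin: "(\<integral>\<^sup>+\<omega>. (\<integral>\<^sup>+t\<in>{0..R}. ennreal \<bar>c t \<omega>\<bar> \<partial>lborel) \<partial>M) < \<infinity>" using c by (auto simp: L1_loc_nonneg_def)
    have "ennreal \<bar>k * c t \<omega>\<bar> = ennreal k * ennreal \<bar>c t \<omega>\<bar>" for t \<omega>
      using k by (simp add: abs_mult ennreal_mult)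
    then show "(\<integral>\<^sup>+\<omega>. (\<integral>\<^sup>+t\<in>{0..R}. ennreal \<bar>k * c t \<omega>\<bar> \<partial>lborel) \<partial>M) < \<infinity>"
      using fin nn_integral_scale[OF jc, of "\<lambda>x. \<bar>x\<bar>" k R] by (simp add: ennreal_mult_less_top)
  qed
  moreover have "(\<lambda>t \<omega>. k * \<pi> t \<omega>) \<in> L2_loc M F"
    unfolding L2_loc_def
  proof (intro CollectI conjI allI impI)
    show "adapted F (\<lambda>t \<omega>. k * \<pi> t \<omega>)" using \<pi> by (intro sc) (auto simp: L2_loc_def)
    show "jointly_measurable M (\<lambda>t \<omega>. k * \<pi> t \<omega>)" by (rule jointly_measurable_scale[OF j\<pi>])
    fix R :: real assume "0 < R"
    then have fin: "(\<integral>\<^sup>+\<omega>. (\<integral>\<^sup>+t\<in>{0..R}. ennreal (\<bar>\<pi> t \<omega>\<bar>\<^sup>2) \<partial>lborel) \<partial>M) < \<infinity>" using \<pi> by (auto simp: L2_loc_def)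
    have "ennreal (\<bar>k * \<pi> t \<omega>\<bar>\<^sup>2) = ennreal (k\<^sup>2) * ennreal (\<bar>\<pi> t \<omega>\<bar>\<^sup>2)" for t \<omega>
      by (simp add: abs_mult power_mult_distrib ennreal_mult)
    then show "(\<integral>\<^sup>+\<omega>. (\<integral>\<^sup>+t\<in>{0..R}. ennreal (\<bar>k * \<pi> t \<omega>\<bar>\<^sup>2) \<partial>lborel) \<partial>M) < \<infinity>"
      using fin nn_integral_scale[OF j\<pi>, of "\<lambda>x. \<bar>x\<bar>\<^sup>2" "k\<^sup>2" R] by (simp add: ennreal_mult_less_top)
  qed
  moreover have "wealth_process M F W r \<sigma> l (k * x) (\<lambda>t \<omega>. k * c t \<omega>) (\<lambda>t \<omega>. k * \<pi> t \<omega>) (\<lambda>t \<omega>. k * X t \<omega>)"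
    unfolding wealth_process_def
  proof (intro conjI exI)
    show "adapted F (\<lambda>t \<omega>. k * X t \<omega>)" by (rule sc[OF Xa])
    show "continuous_paths M (\<lambda>t \<omega>. k * X t \<omega>)"
      using Xc unfolding continuous_paths_def by eventually_elim (intro continuous_intros)
    have "is_ito_integral M F W (\<lambda>t \<omega>. k * (\<sigma> * \<pi> t \<omega>)) (\<lambda>t \<omega>. k * I t \<omega>)"
      by (intro is_ito_integral_scale jointly_measurable_scale j\<pi> ito)
    then show "is_ito_integral M F W (\<lambda>t \<omega>. \<sigma> * (k * \<pi> t \<omega>)) (\<lambda>t \<omega>. k * I t \<omega>)"
      by (simp add: mult.left_commute)
    show "AE \<omega> in M. \<forall>t\<ge>0. k * X t \<omega> = k * x + (LINT s:{0..t}|lborel. r * (k * X s \<omega>) + \<sigma> * l * (k * \<pi> s \<omega>)) + k * I t \<omega> - (LINT s:{0..t}|lborel. k * c s \<omega>)"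
      using eq
    proof eventually_elim
      case (elim \<omega>)
      have "(LINT s:{0..t}|lborel. r * (k * X s \<omega>) + \<sigma> * l * (k * \<pi> s \<omega>)) = k * (LINT s:{0..t}|lborel. r * X s \<omega> + \<sigma> * l * \<pi> s \<omega>)" for t
      proof -
        have "(\<lambda>s. r * (k * X s \<omega>) + \<sigma> * l * (k * \<pi> s \<omega>)) = (\<lambda>s. k * (r * X s \<omega> + \<sigma> * l * \<pi> s \<omega>))"
          by (simp add: fun_eq_iff algebra_simps)
        then show ?thesis by (simp only: set_integral_mult_right)
      qed
      moreover have "(LINT s:{0..t}|lborel. k * c s \<omega>) = k * (LINT s:{0..t}|lborel. c s \<omega>)" for t
        by simp
      ultimately show ?case using elim by (simp add: right_diff_distrib distrib_left)
    qed
  qed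
  moreover have "AE \<omega> in M. \<forall>t\<ge>0. 0 \<le> k * X t \<omega>"
    using X0 by eventually_elim (use k in auto)
  ultimately show ?thesis unfolding admissible_def by blast
qed

lemma objective_scale:
  assumes adm: "(c, \<pi>) \<in> admissible M F W r \<sigma> l x" and k: "0 < k"
  shows "objective M \<rho> \<gamma> (\<lambda>t \<omega>. k * c t \<omega>) = ereal (k powr (1 - \<gamma>)) * objective M \<rho> \<gamma> c"
proof -
  have jc: "jointly_measurable M c" and c0: "\<And>t \<omega>. 0 \<le> t \<Longrightarrow> \<omega> \<in> space M \<Longrightarrow> 0 \<le> c t \<omega>"
    using adm by (auto simp: admissible_def L1_loc_nonneg_def)
  define B where "B \<omega> s = disutility \<rho> \<gamma> s (c (max 0 s) \<omega>) * indicator {0..} s" for \<omega> s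
  have Bm: "(\<lambda>(\<omega>, s). B \<omega> s) \<in> borel_measurable (M \<Otimes>\<^sub>M borel)"
    using jointly_measurable_disutility[OF jc, of \<rho> \<gamma>] unfolding B_def split_beta by measurable
  have B2: "B \<omega> \<in> borel_measurable lborel" if "\<omega> \<in> space M" for \<omega>
    using measurable_compose[OF measurable_Pair1'[OF that] Bm] by simp
  have B3: "(\<lambda>\<omega>. \<integral>\<^sup>+s. B \<omega> s \<partial>lborel) \<in> borel_measurable M"
    using Bm by (auto intro!: lborel.borel_measurable_nn_integral)
  have "(\<integral>\<^sup>+\<omega>. (\<integral>\<^sup>+s\<in>{0..}. disutility \<rho> \<gamma> s (k * c s \<omega>) \<partial>lborel) \<partial>M) =
     (\<integral>\<^sup>+\<omega>. ennreal (k powr (1 - \<gamma>)) * (\<integral>\<^sup>+s. B \<omega> s \<partial>lborel) \<partial>M)"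
  proof (rule nn_integral_cong)
    fix \<omega> assume \<omega>: "\<omega> \<in> space M"
    have "(\<integral>\<^sup>+s\<in>{0..}. disutility \<rho> \<gamma> s (k * c s \<omega>) \<partial>lborel) = (\<integral>\<^sup>+s. ennreal (k powr (1 - \<gamma>)) * B \<omega> s \<partial>lborel)"
      unfolding B_def using c0[OF _ \<omega>] k
      by (intro nn_integral_cong) (auto simp: indicator_def disutility_scale max_def)
    also have "\<dots> = ennreal (k powr (1 - \<gamma>)) * (\<integral>\<^sup>+s. B \<omega> s \<partial>lborel)"
      by (rule nn_integral_cmult[OF B2[OF \<omega>]])
    finally show "(\<integral>\<^sup>+s\<in>{0..}. disutility \<rho> \<gamma> s (k * c s \<omega>) \<partial>lborel) = ennreal (k powr (1 - \<gamma>)) * (\<integral>\<^sup>+s. B \<omega> s \<partial>lborel)" .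
  qed
  also have "\<dots> = ennreal (k powr (1 - \<gamma>)) * (\<integral>\<^sup>+\<omega>. (\<integral>\<^sup>+s. B \<omega> s \<partial>lborel) \<partial>M)"
    by (rule nn_integral_cmult[OF B3])
  also have "(\<integral>\<^sup>+\<omega>. (\<integral>\<^sup>+s. B \<omega> s \<partial>lborel) \<partial>M) = (\<integral>\<^sup>+\<omega>. (\<integral>\<^sup>+s\<in>{0..}. disutility \<rho> \<gamma> s (c s \<omega>) \<partial>lborel) \<partial>M)"
    unfolding B_def by (intro nn_integral_cong) (auto simp: indicator_def max_def)
  finally show ?thesis
    unfolding objective_disutility by (simp add: times_ennreal.rep_eq enn2ereal_ennreal)
qed

text \<open>Scaling maps strategies for \<open>x\<close> to strategies for \<open>k * x\<close>. One
  inequality suffices, since the same statement with \<open>1 / k\<close> gives the converse; the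
  factor is kept on the right to avoid division in \<open>ereal\<close>.\<close>

lemma value_function_scale:
  assumes k: "0 < k"
  shows "value_function M F W r \<sigma> l \<rho> \<gamma> x \<le> ereal (k powr (\<gamma> - 1)) * value_function M F W r \<sigma> l \<rho> \<gamma> (k * x)"
  unfolding value_function_def[of _ _ _ _ _ _ _ _ x]
proof (rule SUP_least, clarify)
  fix c \<pi> assume adm: "(c, \<pi>) \<in> admissible M F W r \<sigma> l x"
  have "objective M \<rho> \<gamma> (\<lambda>t \<omega>. k * c t \<omega>) \<le> value_function M F W r \<sigma> l \<rho> \<gamma> (k * x)"
    unfolding value_function_def using SUP_upper[OF admissible_scale[OF adm k], of "\<lambda>(c, \<pi>). objective M \<rho> \<gamma> c"] by simp
  then have "ereal (k powr (\<gamma> - 1)) * (ereal (k powr (1 - \<gamma>)) * objective M \<rho> \<gamma> c) \<le> ereal (k powr (\<gamma> - 1)) * value_function M F W r \<sigma> l \<rho> \<gamma> (k * x)"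
    unfolding objective_scale[OF adm k] by (rule ereal_mult_left_mono) simp
  moreover have "ereal (k powr (\<gamma> - 1)) * (ereal (k powr (1 - \<gamma>)) * objective M \<rho> \<gamma> c) = objective M \<rho> \<gamma> c"
    using k by (simp add: mult.assoc[symmetric] powr_add[symmetric] one_ereal_def[symmetric])
  ultimately show "objective M \<rho> \<gamma> c \<le> ereal (k powr (\<gamma> - 1)) * value_function M F W r \<sigma> l \<rho> \<gamma> (k * x)" by simp
qed

text \<open>The constant is \<open>(1 - \<gamma>)\<close> times the value at 1, positive because
  that value is strictly negative and \<open>\<gamma> > 1\<close>. Scaling by \<open>x\<close> and
  by \<open>1 / x\<close> bounds the value at \<open>x\<close> from both sides.\<close>

lemma value_function_power:
  assumes \<sigma>: "\<sigma> > 0" and \<gamma>: "\<gamma> > 1" and \<rho>: "\<rho> > (1 - \<gamma>) * (r + l\<^sup>2 / (2 * \<gamma>))"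
  shows "\<exists>a>0. \<forall>x>0. value_function M F W r \<sigma> l \<rho> \<gamma> x = ereal (a * (x powr (1 - \<gamma>) / (1 - \<gamma>)))"
proof -
  let ?V = "value_function M F W r \<sigma> l \<rho> \<gamma>"
  obtain K where K: "K > 0" "\<And>c \<pi>. (c, \<pi>) \<in> admissible M F W r \<sigma> l 1 \<Longrightarrow> objective M \<rho> \<gamma> c \<le> ereal (- K)"
    using objective_upper_bound[OF \<gamma>, of r \<sigma> l \<rho>] by blast
  have up: "?V 1 \<le> ereal (- K)"
    unfolding value_function_def by (rule SUP_least) (use K in auto)
  obtain c \<pi> A where "(c, \<pi>) \<in> admissible M F W r \<sigma> l 1" "objective M \<rho> \<gamma> c = ereal A"
    using finite_objective_exists[OF assms] by blast
  then have "ereal A \<le> ?V 1"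
    unfolding value_function_def using SUP_upper[of "(c, \<pi>)" _ "\<lambda>(c, \<pi>). objective M \<rho> \<gamma> c"] by force
  with up obtain v where v: "?V 1 = ereal v" by (cases "?V 1") auto
  then have "v < 0" using up K(1) by simp
  have "?V x = ereal ((1 - \<gamma>) * v * (x powr (1 - \<gamma>) / (1 - \<gamma>)))" if x: "0 < x" for x
  proof -
    have "?V 1 \<le> ereal (x powr (\<gamma> - 1)) * ?V x"
      using value_function_scale[OF x, of r \<sigma> l \<rho> \<gamma> 1] by simp
    moreover have "?V x \<le> ereal ((1 / x) powr (\<gamma> - 1)) * ?V 1"
      using value_function_scale[of "1 / x" r \<sigma> l \<rho> \<gamma> x] x by simp
    moreover have e: "(1 / x) powr (\<gamma> - 1) = x powr (1 - \<gamma>)"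
      using x powr_minus[of x "\<gamma> - 1"] by (simp add: powr_divide inverse_eq_divide)
    ultimately have le: "ereal v \<le> ereal (x powr (\<gamma> - 1)) * ?V x" "?V x \<le> ereal (x powr (1 - \<gamma>) * v)"
      by (auto simp: v)
    \<comment> \<open>The two scaling inequalities also exclude both infinite values at
      \<open>x\<close>, which permits real arithmetic from here on.\<close>
    then obtain w where w: "?V x = ereal w" using x by (cases "?V x") auto
    have "v \<le> x powr (\<gamma> - 1) * w" "w \<le> x powr (1 - \<gamma>) * v" using le w by auto
    then have "x powr (1 - \<gamma>) * v \<le> x powr (1 - \<gamma>) * (x powr (\<gamma> - 1) * w)"
      by (intro mult_left_mono) auto
    also have "\<dots> = w" using x by (simp add: mult.assoc[symmetric] powr_add[symmetric])
    finally have "w = x powr (1 - \<gamma>) * v" using \<open>w \<le> x powr (1 - \<gamma>) * v\<close> by simp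
    then show ?thesis using w \<gamma> by (simp add: mult.commute)
  qed
  moreover have "(1 - \<gamma>) * v > 0" using \<open>v < 0\<close> \<gamma> by (simp add: mult_neg_neg)
  ultimately show ?thesis by blast
qed

end

subsection \<open>Reduction to continuous paths\<close>

text \<open>Bad paths are replaced by the zero path on one null set. Laws, independence and the
  integrals defining the Ito integral see the process only up to null sets, so they are
  unchanged.\<close>

lemma (in usual_filtered_prob_space) brownian_continuous_version:
  assumes bm: "standard_brownian_motion M F W"
  obtains W' where "brownian M F W'"
    "\<And>H I. is_ito_integral M F W H I \<longleftrightarrow> is_ito_integral M F W' H I"
proof -
  have "AE \<omega> in M. continuous_on {0..} (\<lambda>t. W t \<omega>) \<and> W 0 \<omega> = 0"
    using bm by (auto simp: standard_brownian_motion_def continuous_paths_def)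
  then obtain N where N: "N \<in> null_sets M"
    and good: "\<And>\<omega>. \<omega> \<in> space M \<Longrightarrow> \<omega> \<notin> N \<Longrightarrow> continuous_on {0..} (\<lambda>t. W t \<omega>) \<and> W 0 \<omega> = 0"
    by (auto elim!: AE_E3)
  define W' where "W' t \<omega> = (if \<omega> \<in> N then 0 else W t \<omega>)" for t \<omega>
  have eq: "AE \<omega> in M. \<forall>t. W' t \<omega> = W t \<omega>"
    using AE_not_in[OF N] by eventually_elim (simp add: W'_def)
  \<comment> \<open>Completeness of \<open>F 0\<close> makes the exceptional set known at all times,
    so that modifying the paths there keeps the process adapted.\<close>
  have NF: "N \<in> sets (F t)" if "0 \<le> t" for t
    using filtration_complete[OF N subset_refl] filtration_mono[of 0 t] that by auto
  have ad: "adapted F W'"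
    unfolding adapted_def
  proof (intro allI impI)
    fix t :: real assume t: "0 \<le> t"
    have "W t \<in> borel_measurable (F t)" using bm t by (auto simp: standard_brownian_motion_def adapted_def)
    then show "W' t \<in> borel_measurable (F t)"
      unfolding W'_def using NF[OF t] by (intro measurable_If_set) auto
  qed
  have WM: "W t \<in> borel_measurable M" "W' t \<in> borel_measurable M" if "0 \<le> t" for t
    using bm ad that measurable_from_subalg[OF filtration_subalgebra[OF that]]
    by (auto simp: standard_brownian_motion_def adapted_def)
  have cont: "continuous_on {0..} (\<lambda>t. W' t \<omega>)" "W' 0 \<omega> = 0" if "\<omega> \<in> space M" for \<omega>
    using good[OF that] by (cases "\<omega> \<in> N"; auto simp: W'_def)+
  have dist: "distributed M lborel (\<lambda>\<omega>. W' t \<omega> - W' s \<omega>) (normal_density 0 (sqrt (t - s)))"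
    and ind: "indep_set (sets (F s)) (sets (vimage_algebra (space M) (\<lambda>\<omega>. W' t \<omega> - W' s \<omega>) borel))"
    if st: "0 \<le> s" "s < t" for s t
  proof -
    have d: "distributed M lborel (\<lambda>\<omega>. W t \<omega> - W s \<omega>) (normal_density 0 (sqrt (t - s)))"
      and i: "indep_set (sets (F s)) (sets (vimage_algebra (space M) (\<lambda>\<omega>. W t \<omega> - W s \<omega>) borel))"
      using bm st by (auto simp: standard_brownian_motion_def)
    have [measurable]: "W t \<in> borel_measurable M" "W s \<in> borel_measurable M" "W' t \<in> borel_measurable M" "W' s \<in> borel_measurable M"
      using WM st by auto
    have "distr M lborel (\<lambda>\<omega>. W' t \<omega> - W' s \<omega>) = distr M lborel (\<lambda>\<omega>. W t \<omega> - W s \<omega>)"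
      using eq by (intro distr_cong_AE) auto
    then show "distributed M lborel (\<lambda>\<omega>. W' t \<omega> - W' s \<omega>) (normal_density 0 (sqrt (t - s)))"
      using d by (simp add: distributed_def)
    show "indep_set (sets (F s)) (sets (vimage_algebra (space M) (\<lambda>\<omega>. W' t \<omega> - W' s \<omega>) borel))"
    proof (rule indep_setI)
      show sub: "sets (F s) \<subseteq> events"
        using filtration_subalgebra[OF st(1)] by (auto simp: subalgebra_def)
      show "sets (vimage_algebra (space M) (\<lambda>\<omega>. W' t \<omega> - W' s \<omega>) borel) \<subseteq> events"
        by (subst sets_vimage_algebra2) auto
      fix A B assume A: "A \<in> sets (F s)" and "B \<in> sets (vimage_algebra (space M) (\<lambda>\<omega>. W' t \<omega> - W' s \<omega>) borel)"
      then obtain S where S[measurable]: "S \<in> sets borel" and B: "B = (\<lambda>\<omega>. W' t \<omega> - W' s \<omega>) -` S \<inter> space M"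
        by (subst (asm) sets_vimage_algebra2) auto
      define B0 where "B0 = (\<lambda>\<omega>. W t \<omega> - W s \<omega>) -` S \<inter> space M"
      have B0: "B0 \<in> sets (vimage_algebra (space M) (\<lambda>\<omega>. W t \<omega> - W s \<omega>) borel)"
        unfolding B0_def by (subst sets_vimage_algebra2) auto
      have [measurable]: "A \<in> events" "B0 \<in> events" "B \<in> events"
        using A sub unfolding B0_def B by auto
      \<comment> \<open>Events about the modified increment agree with those about the original one
        up to a null set, so the product formula carries over.\<close>
      have "prob (A \<inter> B) = prob (A \<inter> B0)" "prob B = prob B0"
        using eq by (auto intro!: finite_measure_eq_AE simp: B B0_def)
      then show "prob (A \<inter> B) = prob A * prob B"
        using indep_setD[OF i A B0] by simp
    qed
  qed
  have bm': "standard_brownian_motion M F W'"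
    unfolding standard_brownian_motion_def continuous_paths_def
    using ad cont dist ind by auto
  have "brownian M F W'"
    by (intro brownian.intro usual_filtered_prob_space_axioms brownian_axioms.intro bm' cont)
  moreover have "is_ito_integral M F W H I \<longleftrightarrow> is_ito_integral M F W' H I" for H I
  proof -
    have "(\<integral>\<^sup>+\<omega>. ennreal ((simple_ito_integral W n \<tau> \<xi> t \<omega> - I t \<omega>)\<^sup>2) \<partial>M) =
       (\<integral>\<^sup>+\<omega>. ennreal ((simple_ito_integral W' n \<tau> \<xi> t \<omega> - I t \<omega>)\<^sup>2) \<partial>M)" for n \<tau> \<xi> t
      using eq by (intro nn_integral_cong_AE) (auto simp: simple_ito_integral_def)
    then show ?thesis unfolding is_ito_integral_def by simp
  qed
  ultimately show ?thesis by (rule that)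
qed

theorem proposition3p2:
  fixes M :: "'a measure" and F :: "real \<Rightarrow> 'a measure" and W :: "real \<Rightarrow> 'a \<Rightarrow> real"
    and r \<mu> \<rho> \<sigma> lam \<gamma> :: real
  assumes "usual_filtered_prob_space M F"
    and "standard_brownian_motion M F W"
    and "\<sigma> > 0"
    and "lam = (\<mu> - r) / \<sigma>"
    and "\<gamma> > 1"
    and "\<rho> > (1 - \<gamma>) * (r + lam\<^sup>2 / (2 * \<gamma>))"
  shows "\<exists>a::real. a > 0 \<and>
    (\<forall>x>0. value_function M F W r \<sigma> lam \<rho> \<gamma> x = ereal (a * (x powr (1 - \<gamma>) / (1 - \<gamma>))))"
proof -
  interpret usual_filtered_prob_space M F by fact
  obtain W' where W': "brownian M F W'"
    and ito: "\<And>H I. is_ito_integral M F W H I \<longleftrightarrow> is_ito_integral M F W' H I"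
    by (rule brownian_continuous_version[OF assms(2)]) (rule that)
  \<comment> \<open>The Brownian motion enters the value function through
    \<open>is_ito_integral\<close> alone.\<close>
  have "value_function M F W = value_function M F W'"
    unfolding value_function_def[abs_def] admissible_def wealth_process_def ito ..
  then show ?thesis
    using brownian.value_function_power[OF W' assms(3,5,6)] by simp
qed

end
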